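(* For each $h\in\mathbb{N}$ and $\epsilon>0$ there exists $\delta>0$ such that the following holds. Let $k_1,\dots,k_h\le\left(\frac{1}{h}-\epsilon\right)n$ and let $\mathcal{F}_1\subseteq\binom{[n]}{k_1},\dots,\mathcal{F}_h\subseteq\binom{[n]}{k_h}$ be families with $\mu(\mathcal{F}_i)\ge\epsilon$ for all $i$. Suppose that for each $i\in[h]$ with $k_i\ge\delta n$ the family $\mathcal{F}_i$ is $\left(\lceil1/\delta\rceil,\delta\right)$-regular. Choose uniformly at random a tuple $(\mathbf{A}_1,\dots,\mathbf{A}_h)$ of pairwise disjoint sets with $\mathbf{A}_i\in\binom{[n]}{k_i}$. Then \[\Pr[\mathbf{A}_1\in\mathcal{F}_1,\dots,\mathbf{A}_h\in\mathcal{F}_h]>\delta.\]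
   Context: For $\mathcal{F}\subseteq\binom{[n]}{k}$, $\mu(\mathcal{F})=|\mathcal{F}|/\binom{n}{k}$. For $B\subseteq J\subseteq[n]$, $\mathcal{F}_J^B=\{A\subseteq[n]\setminus J: A\cup B\in\mathcal{F}\}\subseteq\binom{[n]\setminus J}{k-|B|}$, with $\mu(\mathcal{F}_J^B)$ its uniform measure in $\binom{[n]\setminus J}{k-|B|}$. $\mathcal{F}$ is $(r,\epsilon)$-regular if $|\mu(\mathcal{F}_J^B)-\mu(\mathcal{F})|<\epsilon$ for all $J\subseteq[n]$ with $|J|\le r$ and all $B\subseteq J$. *)

theory Defs
  imports "HOL-Probability.Probability" "HOL-Library.Ramsey"
begin

definition unif_measure :: "'a set \<Rightarrow> nat \<Rightarrow> 'a set set \<Rightarrow> real" where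
  "unif_measure X k \<F> = real (card \<F>) / real (card X choose k)"

definition restriction :: "'a set \<Rightarrow> 'a set set \<Rightarrow> 'a set \<Rightarrow> 'a set \<Rightarrow> 'a set set" where
  "restriction X \<F> J B = {A. A \<subseteq> X - J \<and> A \<union> B \<in> \<F>}"

text \<open>The conditions \<open>card B \<le> k\<close> and \<open>k - card B \<le> card (X - J)\<close> say exactly that the
  layer of \<open>(k - card B)\<close>-subsets of \<open>X - J\<close> is defined and nonempty, i.e. that the
  restriction has a uniform measure at all. Without them \<open>0 / 0 = 0\<close>
  and truncated subtraction would impose spurious conditions.\<close>

definition family_regular ::
  "'a set \<Rightarrow> nat \<Rightarrow> nat \<Rightarrow> real \<Rightarrow> 'a set set \<Rightarrow> bool" where
  "family_regular X k r \<epsilon> \<F> \<longleftrightarrow>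
    (\<forall>J B. J \<subseteq> X \<and> card J \<le> r \<and> B \<subseteq> J \<and> card B \<le> k \<and> k - card B \<le> card (X - J) \<longrightarrow>
      \<bar>unif_measure (X - J) (k - card B) (restriction X \<F> J B) - unif_measure X k \<F>\<bar> < \<epsilon>)"

text \<open>A tuple \<open>(A\<^sub>1, \<dots>, A\<^sub>h)\<close> is an extensional function on \<open>{1..h}\<close>.\<close>

definition disjoint_tuples :: "'a set \<Rightarrow> nat \<Rightarrow> (nat \<Rightarrow> nat) \<Rightarrow> (nat \<Rightarrow> 'a set) set" where
  "disjoint_tuples X h k =
    {A \<in> (\<Pi>\<^sub>E i\<in>{1..h}. nsets X (k i)). disjoint_family_on A {1..h}}"

end

theory Submission
  imports Defs
begin

text \<open>
  Colour \<open>[n]\<close> uniformly with \<open>h\<close> colours and then pick a random \<open>k\<^sub>i\<close>-subset of the \<open>i\<close>-th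
  colour class; conditioned on success this is a uniform disjoint tuple. So it suffices that for each
  single family the density \<open>g(C)\<close> of \<open>\<F>\<close> among the \<open>k\<close>-subsets of a \<open>1/h\<close>-random set \<open>C\<close> is
  bounded below except with probability \<open>1/(2h)\<close>.

  Deleting random points from \<open>C\<close> makes \<open>g\<close> a supermartingale. If \<open>g\<close> were tiny with noticeable
  probability, then the normalised potential \<open>w = - ln (g + exp (-L)) / L\<close> would have mean bounded
  away from \<open>0\<close> at every density below \<open>1/h\<close>. As \<open>w\<close> is bounded, there is a density \<open>q\<close> between
  \<open>k/n\<close> and \<open>1/h\<close> where the derivative of its mean is bounded. That derivative controls the
  discrete gradient of \<open>w\<close>: jumps of size at most \<open>\<kappa>\<close> contribute \<open>O(\<kappa>)\<close> to the energy, and the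
  probabilities of larger jumps have bounded sum. Hypercontractivity, as in Friedgut's junta
  theorem, then makes \<open>w\<close> close in \<open>L\<^sup>2\<close> to a function of a bounded set \<open>J\<close> of coordinates.
  Hence \<open>g\<close> is tiny almost everywhere on some subcube \<open>C \<inter> J = B\<close>. This contradicts regularity, by
  which \<open>g\<close> has mean bounded below on every such subcube; when \<open>k < \<delta> n\<close> that bound holds for free,
  because a random \<open>k\<close>-set misses \<open>J\<close>.
\<close>

section \<open>Fourier analysis on the biased cube\<close>

text \<open>Friedgut's theorem is about Boolean functions. For real functions bounded energy does
  not yield a junta: a normalised linear form has bounded energy, spread over many tiny jumps, and
  is far from every function of few coordinates. The logarithm removes this obstacle.
  Superharmonicity of \<open>g\<close> bounds the sum of \<open>exp v - 1 - v\<close> over the jumps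
  \<open>v\<close> of \<open>- ln (g + exp (-L))\<close> by \<open>L\<close> times the drift of
  \<open>w\<close>. This penalty is linear beyond the scale 1, that is, for jumps of
  \<open>w\<close> beyond \<open>1 / L\<close>, so jumps of \<open>w\<close> up to a fixed \<kappa>
  with \<open>1 \<le> L * \<kappa>\<close> carry only energy of order \<kappa>. The remaining jumps
  behave as for a Boolean function, and hypercontractivity is applied to them alone. The density
  \<open>q\<close> comes from the mean value theorem and cannot be prescribed; hence lower bounds on
  subcubes must be available on a whole interval of densities below \<open>1 / h\<close>. The
  probabilistic part needs large \<open>n\<close>. For bounded \<open>n\<close> the families turn
  out to be complete layers: regularity with \<open>J = X\<close> forces this, and where it is not
  assumed \<open>k = 0\<close>.\<close>

definition bweight :: "real \<Rightarrow> 'a set \<Rightarrow> 'a set \<Rightarrow> real" where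
  "bweight q X C = q ^ card C * (1 - q) ^ card (X - C)"

definition bexp :: "real \<Rightarrow> 'a set \<Rightarrow> ('a set \<Rightarrow> real) \<Rightarrow> real" where
  "bexp q X f = (\<Sum>C\<in>Pow X. bweight q X C * f C)"

lemma bweight_nonneg: "0 \<le> q \<Longrightarrow> q \<le> 1 \<Longrightarrow> 0 \<le> bweight q X C"
  by (simp add: bweight_def)

lemma bweight_pos: "0 < q \<Longrightarrow> q < 1 \<Longrightarrow> 0 < bweight q X C"
  by (simp add: bweight_def)

lemma bexp_cong:
  assumes "\<And>C. C \<subseteq> X \<Longrightarrow> f C = g C"
  shows "bexp q X f = bexp q X g"
  unfolding bexp_def using assms by (intro sum.cong) auto

lemma bexp_mono:
  assumes "0 \<le> q" "q \<le> 1" "\<And>C. C \<subseteq> X \<Longrightarrow> f C \<le> g C"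
  shows "bexp q X f \<le> bexp q X g"
  unfolding bexp_def using assms by (intro sum_mono mult_left_mono) (auto simp: bweight_nonneg)

lemma bexp_nonneg:
  assumes "0 \<le> q" "q \<le> 1" "\<And>C. C \<subseteq> X \<Longrightarrow> 0 \<le> f C"
  shows "0 \<le> bexp q X f"
  unfolding bexp_def using assms by (intro sum_nonneg) (auto simp: bweight_nonneg)

lemma bexp_add: "bexp q X (\<lambda>C. f C + g C) = bexp q X f + bexp q X g"
  by (simp add: bexp_def distrib_left sum.distrib)

lemma bexp_diff: "bexp q X (\<lambda>C. f C - g C) = bexp q X f - bexp q X g"
  by (simp add: bexp_def right_diff_distrib sum_subtractf)

lemma bexp_cmult: "bexp q X (\<lambda>C. c * f C) = c * bexp q X f"
  by (simp add: bexp_def sum_distrib_left mult_ac)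

lemma bexp_sum: "bexp q X (\<lambda>C. \<Sum>i\<in>I. f i C) = (\<Sum>i\<in>I. bexp q X (f i))"
  unfolding bexp_def sum_distrib_left by (rule sum.swap)

lemma bexp_insert:
  assumes "finite X" "i \<notin> X"
  shows "bexp q (insert i X) f = bexp q X (\<lambda>C. q * f (insert i C) + (1 - q) * f C)"
proof -
  have inj: "inj_on (insert i) (Pow X)"
    using assms(2) by (auto simp: inj_on_def)
  have disj: "Pow X \<inter> insert i ` Pow X = {}"
    using assms(2) by auto
  have 1: "bweight q (insert i X) C = (1 - q) * bweight q X C" if "C \<subseteq> X" for C
  proof -
    have "insert i X - C = insert i (X - C)" using that assms(2) by auto
    then show ?thesis using assms that by (simp add: bweight_def)
  qed
  have 2: "bweight q (insert i X) (insert i C) = q * bweight q X C" if "C \<subseteq> X" for C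
  proof -
    have "insert i X - insert i C = X - C" using that assms(2) by auto
    moreover have "card (insert i C) = Suc (card C)"
      using assms that by (meson card_insert_disjoint finite_subset subsetD)
    ultimately show ?thesis by (simp add: bweight_def)
  qed
  have "bexp q (insert i X) f = (\<Sum>C\<in>Pow X. bweight q (insert i X) C * f C)
      + (\<Sum>C\<in>insert i ` Pow X. bweight q (insert i X) C * f C)"
    unfolding bexp_def Pow_insert using assms(1) disj by (intro sum.union_disjoint) auto
  also have "(\<Sum>C\<in>insert i ` Pow X. bweight q (insert i X) C * f C)
      = (\<Sum>C\<in>Pow X. bweight q (insert i X) (insert i C) * f (insert i C))"
    by (simp add: sum.reindex[OF inj])
  also have "(\<Sum>C\<in>Pow X. bweight q (insert i X) C * f C) + \<dots>
     = (\<Sum>C\<in>Pow X. bweight q X C * (q * f (insert i C) + (1 - q) * f C))"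
    unfolding sum.distrib[symmetric]
    by (intro sum.cong refl) (simp add: 1 2 distrib_left mult_ac)
  finally show ?thesis by (simp add: bexp_def)
qed

lemma bexp_remove:
  assumes "finite X" "i \<in> X"
  shows "bexp q X f = bexp q (X - {i}) (\<lambda>C. q * f (insert i C) + (1 - q) * f C)"
  using bexp_insert[of "X - {i}" i q f] assms by (simp add: insert_absorb)

lemma bexp_empty [simp]: "bexp q {} f = f {}"
  by (simp add: bexp_def bweight_def)

lemma bexp_const: "finite X \<Longrightarrow> bexp q X (\<lambda>_. c) = c"
proof (induction X rule: finite_induct)
  case (insert i X)
  then show ?case by (simp add: bexp_insert algebra_simps)
qed simp

text \<open>Independence of the coordinates, for products whose factor at \<open>i\<close> sees only
  whether \<open>i\<close> belongs to the set.\<close>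

lemma bexp_prod:
  assumes "finite X"
  shows "bexp q X (\<lambda>C. \<Prod>i\<in>X. s i (i \<in> C)) = (\<Prod>i\<in>X. q * s i True + (1 - q) * s i False)"
  using assms
proof (induction X rule: finite_induct)
  case (insert j X)
  have 1: "(\<Prod>i\<in>X. s i (i \<in> insert j C)) = (\<Prod>i\<in>X. s i (i \<in> C))" for C
  proof (intro prod.cong refl)
    fix i assume "i \<in> X"
    then have "(i \<in> insert j C) = (i \<in> C)" using insert.hyps(2) by auto
    then show "s i (i \<in> insert j C) = s i (i \<in> C)" by simp
  qed
  have "bexp q (insert j X) (\<lambda>C. \<Prod>i\<in>insert j X. s i (i \<in> C))
     = bexp q X (\<lambda>C. (q * s j True + (1 - q) * s j False) * (\<Prod>i\<in>X. s i (i \<in> C)))"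
    unfolding bexp_insert[OF insert.hyps]
  proof (intro bexp_cong)
    fix C assume "C \<subseteq> X"
    then have "j \<notin> C" using insert.hyps by auto
    then show "q * (\<Prod>i\<in>insert j X. s i (i \<in> insert j C)) + (1 - q) * (\<Prod>i\<in>insert j X. s i (i \<in> C))
      = (q * s j True + (1 - q) * s j False) * (\<Prod>i\<in>X. s i (i \<in> C))"
      unfolding prod.insert[OF insert.hyps] 1 by (simp add: algebra_simps)
  qed
  then show ?case using insert by (simp add: bexp_cmult)
qed simp

lemma bexp_Cauchy_Schwarz:
  assumes "0 \<le> q" "q \<le> 1"
  shows "(bexp q X (\<lambda>C. f C * g C))\<^sup>2 \<le> bexp q X (\<lambda>C. (f C)\<^sup>2) * bexp q X (\<lambda>C. (g C)\<^sup>2)"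
proof -
  let ?s = "\<lambda>C. sqrt (bweight q X C)"
  have s: "bweight q X C = ?s C * ?s C" for C
    by (simp add: bweight_nonneg[OF assms])
  have e: "(?s C * x) * (?s C * y) = bweight q X C * (x * y)" for C x y
    by (subst s) (simp only: mult_ac)
  show ?thesis
    using Cauchy_Schwarz_ineq_sum[of "\<lambda>C. ?s C * f C" "\<lambda>C. ?s C * g C" "Pow X"]
    unfolding bexp_def power2_eq_square e .
qed

text \<open>The standardised indicator of one coordinate: mean 0 and variance 1 at density
  \<open>q\<close>. \<open>bchar\<close> multiplies these into the \<open>q\<close>-biased
  Fourier-Walsh basis, and \<open>bcoeff\<close> gives the Fourier coefficients.\<close>

definition bfactor :: "real \<Rightarrow> bool \<Rightarrow> real" where
  "bfactor q b = (of_bool b - q) / sqrt (q * (1 - q))"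

definition bchar :: "real \<Rightarrow> 'a set \<Rightarrow> 'a set \<Rightarrow> real" where
  "bchar q S C = (\<Prod>i\<in>S. bfactor q (i \<in> C))"

definition bcoeff :: "real \<Rightarrow> 'a set \<Rightarrow> ('a set \<Rightarrow> real) \<Rightarrow> 'a set \<Rightarrow> real" where
  "bcoeff q X f S = bexp q X (\<lambda>C. f C * bchar q S C)"

lemma bchar_insert_same:
  assumes "i \<notin> S" shows "bchar q S (insert i C) = bchar q S C"
  unfolding bchar_def
proof (intro prod.cong refl)
  fix j assume "j \<in> S"
  then have "(j \<in> insert i C) = (j \<in> C)" using assms by auto
  then show "bfactor q (j \<in> insert i C) = bfactor q (j \<in> C)" by simp
qed

lemma bchar_Int: "S \<subseteq> J \<Longrightarrow> bchar q S (C \<inter> J) = bchar q S C"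
  unfolding bchar_def by (intro prod.cong) auto

lemma bfactor_mult:
  fixes q :: real
  assumes "0 < q" "q < 1"
  shows "bfactor q True * bfactor q True = (1 - q) / q" "bfactor q False * bfactor q False = q / (1 - q)"
    "bfactor q True * bfactor q False = -1" "bfactor q False * bfactor q True = -1" "q * bfactor q True + (1 - q) * bfactor q False = 0"
proof -
  have m: "x / sqrt (q * (1 - q)) * (y / sqrt (q * (1 - q))) = x * y / (q * (1 - q))" for x y
  proof -
    have "sqrt (q * (1 - q)) * sqrt (q * (1 - q)) = q * (1 - q)" using assms by simp
    then show ?thesis by (simp only: times_divide_times_eq)
  qed
  show "bfactor q True * bfactor q True = (1 - q) / q" "bfactor q False * bfactor q False = q / (1 - q)"
    "bfactor q True * bfactor q False = -1" "bfactor q False * bfactor q True = -1"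
    using assms(1,2) unfolding bfactor_def m by (simp_all add: field_simps)
  show "q * bfactor q True + (1 - q) * bfactor q False = 0"
    by (simp add: bfactor_def algebra_simps)
qed

text \<open>Factorises over the coordinates by \<open>bexp_prod\<close>: a coordinate in both sets
  contributes the variance 1, one in exactly one of them the mean 0.\<close>

lemma bchar_orthonormal:
  assumes "finite X" "S \<subseteq> X" "T \<subseteq> X" and q: "0 < q" "q < 1"
  shows "bexp q X (\<lambda>C. bchar q S C * bchar q T C) = of_bool (S = T)"
proof -
  let ?u = "bfactor q"
  let ?s = "\<lambda>i b. (if i \<in> S then ?u b else 1) * (if i \<in> T then ?u b else 1)"
  have p: "bchar q S C = (\<Prod>i\<in>X. if i \<in> S then ?u (i \<in> C) else 1)" if "S \<subseteq> X" for S C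
    unfolding bchar_def using that assms(1)
    by (simp add: prod.If_cases Int_absorb1)
  have "bexp q X (\<lambda>C. bchar q S C * bchar q T C) = bexp q X (\<lambda>C. \<Prod>i\<in>X. ?s i (i \<in> C))"
    unfolding p[OF assms(2)] p[OF assms(3)] prod.distrib ..
  also have "\<dots> = (\<Prod>i\<in>X. q * ?s i True + (1 - q) * ?s i False)"
    by (rule bexp_prod[OF assms(1)])
  also have "\<dots> = (\<Prod>i\<in>X. of_bool (i \<in> S \<longleftrightarrow> i \<in> T))"
  proof (rule prod.cong[OF refl])
    fix i
    show "q * ?s i True + (1 - q) * ?s i False = of_bool (i \<in> S \<longleftrightarrow> i \<in> T)"
      using bfactor_mult[OF q] q by (cases "i \<in> S"; cases "i \<in> T") auto
  qed
  also have "\<dots> = of_bool (S = T)"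
  proof (cases "S = T")
    case False
    then obtain i where "i \<in> X" "(i \<in> S) \<noteq> (i \<in> T)" using assms(2,3) by blast
    then show ?thesis using False assms(1) by (auto intro!: prod_zero)
  qed simp
  finally show ?thesis .
qed

lemma prod_1_plus:
  fixes f :: "'a \<Rightarrow> 'b :: comm_ring_1"
  assumes "finite X"
  shows "(\<Prod>i\<in>X. 1 + f i) = (\<Sum>S\<in>Pow X. prod f S)"
  using assms
proof (induction X rule: finite_induct)
  case (insert i X)
  have inj: "inj_on (insert i) (Pow X)" using insert.hyps(2) by (auto simp: inj_on_def)
  have "(\<Sum>S\<in>Pow (insert i X). prod f S) = (\<Sum>S\<in>Pow X. prod f S) + (\<Sum>S\<in>insert i ` Pow X. prod f S)"
    unfolding Pow_insert using insert.hyps by (intro sum.union_disjoint) auto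
  also have "(\<Sum>S\<in>insert i ` Pow X. prod f S) = (\<Sum>S\<in>Pow X. f i * prod f S)"
    unfolding sum.reindex[OF inj] o_def
    using insert.hyps by (intro sum.cong refl prod.insert) (auto intro: finite_subset)
  finally show ?case using insert by (simp add: distrib_right flip: sum_distrib_left)
qed simp

text \<open>Completeness without a dimension count: by \<open>prod_1_plus\<close> the kernel summed
  over all \<open>S\<close> is a product over the coordinates, which vanishes as soon as
  \<open>C\<close> and \<open>D\<close> differ somewhere and for \<open>C = D\<close> is the
  reciprocal of the weight.\<close>

lemma bchar_expansion:
  assumes "finite X" "D \<subseteq> X" and q: "0 < q" "q < 1"
  shows "f D = (\<Sum>S\<in>Pow X. bcoeff q X f S * bchar q S D)"
proof -
  let ?u = "\<lambda>i C. bfactor q (i \<in> C)"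
  note uu = bfactor_mult[OF q]
  have nz: "q \<noteq> 0" "1 - q \<noteq> 0"
    using q by auto
  have k: "bweight q X C * (\<Sum>S\<in>Pow X. bchar q S C * bchar q S D) = of_bool (C = D)" if C: "C \<subseteq> X" for C
  proof -
    have "(\<Sum>S\<in>Pow X. bchar q S C * bchar q S D) = (\<Prod>i\<in>X. 1 + ?u i C * ?u i D)"
      unfolding prod_1_plus[OF assms(1)] bchar_def prod.distrib ..
    also have "bweight q X C * \<dots> = of_bool (C = D)"
    proof (cases "C = D")
      case True
      have "bweight q X D = (\<Prod>i\<in>X. if i \<in> D then q else 1 - q)"
        using assms(1,2) by (simp add: bweight_def prod.If_cases Int_absorb1 Diff_eq)
      then have "bweight q X D * (\<Prod>i\<in>X. 1 + ?u i D * ?u i D)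
          = (\<Prod>i\<in>X. (if i \<in> D then q else 1 - q) * (1 + ?u i D * ?u i D))"
        by (simp only: prod.distrib)
      also have "\<dots> = (\<Prod>i\<in>X. 1)"
        using nz by (intro prod.cong refl) (auto simp: distrib_left uu)
      finally show ?thesis using True by simp
    next
      case False
      then obtain i where i: "i \<in> X" "(i \<in> C) \<noteq> (i \<in> D)" using C assms(2) by blast
      then have "1 + ?u i C * ?u i D = 0" using uu by (cases "i \<in> C") auto
      then have "(\<Prod>i\<in>X. 1 + ?u i C * ?u i D) = 0" by (intro prod_zero[OF assms(1)] bexI[OF _ i(1)])
      then show ?thesis using False by simp
    qed
    finally show ?thesis .
  qed
  have "(\<Sum>S\<in>Pow X. bcoeff q X f S * bchar q S D)
     = (\<Sum>C\<in>Pow X. \<Sum>S\<in>Pow X. bweight q X C * (f C * bchar q S C) * bchar q S D)"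
    unfolding bcoeff_def bexp_def sum_distrib_right by (rule sum.swap)
  also have "\<dots> = (\<Sum>C\<in>Pow X. f C * (bweight q X C * (\<Sum>S\<in>Pow X. bchar q S C * bchar q S D)))"
    by (simp add: sum_distrib_left mult_ac)
  also have "\<dots> = (\<Sum>C\<in>Pow X. f C * of_bool (C = D))"
    using k by (intro sum.cong) auto
  also have "\<dots> = f D"
    using assms(1,2) by (simp add: of_bool_def if_distrib cong: if_cong)
  finally show ?thesis by simp
qed

lemma bexp_bchar_sum_sq:
  assumes "finite X" "\<S> \<subseteq> Pow X" and q: "0 < q" "q < 1"
  shows "bexp q X (\<lambda>C. (\<Sum>S\<in>\<S>. c S * bchar q S C)\<^sup>2) = (\<Sum>S\<in>\<S>. (c S)\<^sup>2)"
proof -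
  have fin: "finite \<S>" using assms(1,2) finite_subset by auto
  have "bexp q X (\<lambda>C. (\<Sum>S\<in>\<S>. c S * bchar q S C)\<^sup>2)
     = bexp q X (\<lambda>C. \<Sum>S\<in>\<S>. \<Sum>T\<in>\<S>. (c S * c T) * (bchar q S C * bchar q T C))"
    by (simp add: power2_eq_square sum_product mult_ac)
  also have "\<dots> = (\<Sum>S\<in>\<S>. \<Sum>T\<in>\<S>. (c S * c T) * of_bool (S = T))"
    unfolding bexp_sum bexp_cmult
  proof (intro sum.cong refl)
    fix S T assume "S \<in> \<S>" "T \<in> \<S>"
    then have "S \<subseteq> X" "T \<subseteq> X" using assms(2) by auto
    then show "c S * c T * bexp q X (\<lambda>C. bchar q S C * bchar q T C) = c S * c T * of_bool (S = T)"
      by (simp only: bchar_orthonormal[OF assms(1) _ _ q])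
  qed
  also have "\<dots> = (\<Sum>S\<in>\<S>. (c S)\<^sup>2)"
    using fin by (simp add: of_bool_def if_distrib power2_eq_square cong: if_cong)
  finally show ?thesis .
qed

lemma bexp_mult_bchar_sum:
  "bexp q X (\<lambda>C. f C * (\<Sum>S\<in>\<S>. bcoeff q X f S * bchar q S C)) = (\<Sum>S\<in>\<S>. (bcoeff q X f S)\<^sup>2)"
proof -
  have "bexp q X (\<lambda>C. f C * (\<Sum>S\<in>\<S>. bcoeff q X f S * bchar q S C))
     = bexp q X (\<lambda>C. \<Sum>S\<in>\<S>. bcoeff q X f S * (f C * bchar q S C))"
    by (simp add: sum_distrib_left mult_ac)
  then show ?thesis
    unfolding bexp_sum bexp_cmult bcoeff_def[symmetric] by (simp add: power2_eq_square)
qed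

lemma Bessel_bcoeff:
  assumes "finite X" "\<S> \<subseteq> Pow X" and q: "0 < q" "q < 1"
  shows "(\<Sum>S\<in>\<S>. (bcoeff q X f S)\<^sup>2) \<le> bexp q X (\<lambda>C. (f C)\<^sup>2)"
proof -
  let ?p = "\<lambda>C. \<Sum>S\<in>\<S>. bcoeff q X f S * bchar q S C"
  have "0 \<le> bexp q X (\<lambda>C. (f C - ?p C)\<^sup>2)"
    using q by (intro bexp_nonneg) auto
  also have "(\<lambda>C. (f C - ?p C)\<^sup>2) = (\<lambda>C. (f C)\<^sup>2 - 2 * (f C * ?p C) + (?p C)\<^sup>2)"
    by (auto simp: power2_eq_square algebra_simps)
  also have "bexp q X \<dots> = bexp q X (\<lambda>C. (f C)\<^sup>2) - (\<Sum>S\<in>\<S>. (bcoeff q X f S)\<^sup>2)"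
    unfolding bexp_add bexp_diff bexp_cmult bexp_mult_bchar_sum bexp_bchar_sum_sq[OF assms] by simp
  finally show ?thesis by simp
qed

text \<open>One-coordinate case of Bonami's fourth moment inequality; the right side is
  \<open>(a\<^sup>2 + b\<^sup>2)\<^sup>2\<close>. A centred Bernoulli variable is skewed, so an odd
  term in \<open>a * c ^ 3\<close> survives, and \<open>t \<le> 1/2\<close> leaves room to absorb
  it.\<close>

lemma hypercontractive_two_point:
  fixes q t a b :: real
  assumes q: "0 \<le> q" "q \<le> 1" and t: "0 \<le> t" "t \<le> 1/2"
  shows "q * (a + t * (1 - q) * b) ^ 4 + (1 - q) * (a - t * q * b) ^ 4 \<le> a ^ 4 + 2 * (a\<^sup>2 * b\<^sup>2) + b ^ 4"
proof -
  define v where "v = q * (1 - q)"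
  define c where "c = t * b"
  have v: "0 \<le> v" "v \<le> 1/4"
    using q zero_le_power2[of "q - 1/2"] mult_left_le_one_le[of q q]
    by (auto simp: v_def power2_eq_square field_simps)
  have c2: "c\<^sup>2 \<le> b\<^sup>2 / 4"
  proof -
    have "t\<^sup>2 \<le> (1/2)\<^sup>2" using t by (intro power_mono) auto
    then have "t\<^sup>2 * b\<^sup>2 \<le> 1/4 * b\<^sup>2" by (intro mult_right_mono) (auto simp: power2_eq_square)
    then show ?thesis by (simp add: c_def power_mult_distrib)
  qed
  \<comment> \<open>The coefficients are the second, third and fourth central moments of a Bernoulli
    variable with variance \<open>v\<close>; the first one vanishes.\<close>
  have eq: "q * (a + t * (1 - q) * b) ^ 4 + (1 - q) * (a - t * q * b) ^ 4
     = a ^ 4 + 6 * v * (a\<^sup>2 * c\<^sup>2) + 4 * (v * (1 - 2 * q)) * (a * c ^ 3) + v * (1 - 3 * v) * c ^ 4"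
  proof -
    have c: "t * (1 - q) * b = (1 - q) * c" "t * q * b = q * c" by (auto simp: c_def)
    have p: "(a + x) ^ 4 = a ^ 4 + 4 * a ^ 3 * x + 6 * (a\<^sup>2 * x\<^sup>2) + 4 * a * x ^ 3 + x ^ 4" for x
      by (simp add: power4_eq_xxxx power3_eq_cube power2_eq_square algebra_simps)
    have m: "(a - x) ^ 4 = a ^ 4 - 4 * a ^ 3 * x + 6 * (a\<^sup>2 * x\<^sup>2) - 4 * a * x ^ 3 + x ^ 4" for x
      by (simp add: power4_eq_xxxx power3_eq_cube power2_eq_square algebra_simps)
    have k: "q * (1 - q) ^ 2 + (1 - q) * q ^ 2 = v" "q * (1 - q) ^ 3 - (1 - q) * q ^ 3 = v * (1 - 2 * q)"
      "q * (1 - q) ^ 4 + (1 - q) * q ^ 4 = v * (1 - 3 * v)"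
      by (simp_all add: v_def power4_eq_xxxx power3_eq_cube power2_eq_square algebra_simps)
    have "q * (a + (1 - q) * c) ^ 4 + (1 - q) * (a - q * c) ^ 4
      = a ^ 4 + 6 * (q * (1 - q) ^ 2 + (1 - q) * q ^ 2) * (a\<^sup>2 * c\<^sup>2)
        + 4 * (q * (1 - q) ^ 3 - (1 - q) * q ^ 3) * (a * c ^ 3) + (q * (1 - q) ^ 4 + (1 - q) * q ^ 4) * c ^ 4"
      unfolding p m power_mult_distrib by (simp add: algebra_simps)
    then show ?thesis unfolding c k by (simp add: mult_ac)
  qed
  \<comment> \<open>The odd term is dominated by even ones: \<open>4 * v * |1 - 2 * q|\<close> is at
    most 1, and AM-GM splits \<open>|a * c|\<close>.\<close>
  have "4 * (v * (1 - 2 * q)) * (a * c ^ 3) \<le> \<bar>4 * (v * (1 - 2 * q))\<bar> * \<bar>a * c ^ 3\<bar>"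
    by (metis abs_ge_self abs_mult)
  also have "\<dots> \<le> 1 * \<bar>a * c ^ 3\<bar>"
  proof (rule mult_right_mono)
    have "v * \<bar>1 - 2 * q\<bar> \<le> 1/4 * 1" using v q by (intro mult_mono) auto
    then show "\<bar>4 * (v * (1 - 2 * q))\<bar> \<le> 1" using v by (simp add: abs_mult)
  qed simp
  also have "\<bar>a * c ^ 3\<bar> = \<bar>a * c\<bar> * c\<^sup>2"
    by (simp add: abs_mult power3_eq_cube power2_eq_square mult_ac)
  also have "\<bar>a * c\<bar> * c\<^sup>2 \<le> ((a\<^sup>2 + c\<^sup>2) / 2) * c\<^sup>2"
  proof (rule mult_right_mono)
    show "\<bar>a * c\<bar> \<le> (a\<^sup>2 + c\<^sup>2) / 2"
      using sum_squares_bound[of "\<bar>a\<bar>" "\<bar>c\<bar>"] by (simp add: abs_mult)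
  qed simp
  finally have 1: "4 * (v * (1 - 2 * q)) * (a * c ^ 3) \<le> (a\<^sup>2 * c\<^sup>2) / 2 + c ^ 4 / 2"
    by (simp add: power4_eq_xxxx power2_eq_square algebra_simps)
  have 2: "6 * v * (a\<^sup>2 * c\<^sup>2) \<le> 6 * (1/4) * (a\<^sup>2 * c\<^sup>2)"
    using v by (intro mult_right_mono) auto
  have "v * (1 - 3 * v) \<le> v * 1" using v by (intro mult_left_mono) auto
  then have 3: "v * (1 - 3 * v) * c ^ 4 \<le> 1/4 * c ^ 4"
    using v by (intro mult_right_mono) auto
  have 4: "a\<^sup>2 * c\<^sup>2 \<le> a\<^sup>2 * (b\<^sup>2/4)" by (rule mult_left_mono[OF c2]) simp
  have "(c\<^sup>2)\<^sup>2 \<le> (b\<^sup>2/4)\<^sup>2" by (rule power_mono[OF c2]) simp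
  then have 5: "c ^ 4 \<le> b ^ 4 / 16" by (simp add: power_divide flip: power_mult)
  have 6: "0 \<le> a\<^sup>2 * b\<^sup>2" "0 \<le> b ^ 4" by auto
  show ?thesis unfolding eq using 1 2 3 4 5 6 by linarith
qed

text \<open>Bonami's induction. Splitting off \<open>i\<close> leaves
  \<open>A + t * (x - q) * B\<close>, where \<open>x\<close> indicates \<open>i\<close> and
  \<open>A\<close>, \<open>B\<close> do not depend on it; the two-point inequality removes the
  coordinate, and Cauchy-Schwarz with the induction hypothesis bounds the mixed term. The admissible
  \<rho> shrinks as \<open>q\<close> tends to 0 or 1, which is why densities are later kept away
  from both ends.\<close>

lemma hypercontractive_4_2:
  assumes "finite X" and q: "0 < q" "q < 1" and \<rho>: "0 \<le> \<rho>" "\<rho> \<le> sqrt (q * (1 - q)) / 2"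
  shows "bexp q X (\<lambda>C. (\<Sum>S\<in>Pow X. \<rho> ^ card S * c S * bchar q S C) ^ 4) \<le> (\<Sum>S\<in>Pow X. (c S)\<^sup>2)\<^sup>2"
  using assms(1)
proof (induction X arbitrary: c rule: finite_induct)
  case empty
  then show ?case by (simp add: bchar_def flip: power_mult)
next
  case (insert i X)
  let ?\<sigma> = "sqrt (q * (1 - q))"
  \<comment> \<open>Undoes the normalisation in \<open>bfactor\<close>, so that the bound on \<rho>
    becomes the \<open>t \<le> 1/2\<close> of the two-point inequality.\<close>
  define t where "t = \<rho> / ?\<sigma>"
  have \<sigma>: "0 < ?\<sigma>" using q by simp
  have t: "0 \<le> t" "t \<le> 1/2" using \<rho> \<sigma> q by (auto simp: t_def field_simps)
  let ?A = "\<lambda>C. \<Sum>S\<in>Pow X. \<rho> ^ card S * c S * bchar q S C"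
  let ?B = "\<lambda>C. \<Sum>S\<in>Pow X. \<rho> ^ card S * c (insert i S) * bchar q S C"
  have inj: "inj_on (insert i) (Pow X)" using insert.hyps(2) by (auto simp: inj_on_def)
  have split: "(\<Sum>S\<in>Pow (insert i X). G S) = (\<Sum>S\<in>Pow X. G S) + (\<Sum>S\<in>Pow X. G (insert i S))"
    for G :: "'a set \<Rightarrow> real"
  proof -
    have "(\<Sum>S\<in>Pow (insert i X). G S) = (\<Sum>S\<in>Pow X. G S) + (\<Sum>S\<in>insert i ` Pow X. G S)"
      unfolding Pow_insert using insert.hyps by (intro sum.union_disjoint) auto
    then show ?thesis by (simp add: sum.reindex[OF inj])
  qed
  have p4: "(x\<^sup>2)\<^sup>2 = x ^ 4" for x :: real
    by (simp flip: power_mult)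
  have main: "(\<Sum>S\<in>Pow (insert i X). \<rho> ^ card S * c S * bchar q S C)
      = ?A C + t * (of_bool (i \<in> C) - q) * ?B C" for C
  proof -
    have "(\<Sum>S\<in>Pow X. \<rho> ^ card (insert i S) * c (insert i S) * bchar q (insert i S) C)
       = (\<Sum>S\<in>Pow X. t * (of_bool (i \<in> C) - q) * (\<rho> ^ card S * c (insert i S) * bchar q S C))"
    proof (intro sum.cong refl)
      fix S assume "S \<in> Pow X"
      then have "finite S" "i \<notin> S" using insert.hyps by (auto intro: finite_subset)
      then show "\<rho> ^ card (insert i S) * c (insert i S) * bchar q (insert i S) C
         = t * (of_bool (i \<in> C) - q) * (\<rho> ^ card S * c (insert i S) * bchar q S C)"
        by (simp add: bchar_def t_def bfactor_def)
    qed
    then show ?thesis unfolding split by (simp add: sum_distrib_left)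
  qed
  have AB: "?A (insert i C) = ?A C" "?B (insert i C) = ?B C" for C
    using insert.hyps(2) by (auto intro!: sum.cong bchar_insert_same)
  have "bexp q (insert i X) (\<lambda>C. (\<Sum>S\<in>Pow (insert i X). \<rho> ^ card S * c S * bchar q S C) ^ 4)
     = bexp q X (\<lambda>C. q * (?A C + t * (1 - q) * ?B C) ^ 4 + (1 - q) * (?A C - t * q * ?B C) ^ 4)"
    unfolding main bexp_insert[OF insert.hyps]
  proof (rule bexp_cong)
    fix C assume "C \<subseteq> X"
    then have i: "(i \<in> C) = False" using insert.hyps by auto
    show "q * (?A (insert i C) + t * (of_bool (i \<in> insert i C) - q) * ?B (insert i C)) ^ 4
        + (1 - q) * (?A C + t * (of_bool (i \<in> C) - q) * ?B C) ^ 4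
      = q * (?A C + t * (1 - q) * ?B C) ^ 4 + (1 - q) * (?A C - t * q * ?B C) ^ 4"
      unfolding AB i by simp
  qed
  also have "\<dots> \<le> bexp q X (\<lambda>C. (?A C) ^ 4 + 2 * ((?A C)\<^sup>2 * (?B C)\<^sup>2) + (?B C) ^ 4)"
    by (rule bexp_mono, use q in linarith, use q in linarith, rule hypercontractive_two_point) (use q t in linarith)+
  also have "\<dots> = bexp q X (\<lambda>C. (?A C) ^ 4) + 2 * bexp q X (\<lambda>C. (?A C)\<^sup>2 * (?B C)\<^sup>2) + bexp q X (\<lambda>C. (?B C) ^ 4)"
    by (simp only: bexp_add bexp_cmult)
  also have "\<dots> \<le> (\<Sum>S\<in>Pow X. (c S)\<^sup>2)\<^sup>2 + 2 * ((\<Sum>S\<in>Pow X. (c S)\<^sup>2) * (\<Sum>S\<in>Pow X. (c (insert i S))\<^sup>2))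
     + (\<Sum>S\<in>Pow X. (c (insert i S))\<^sup>2)\<^sup>2"
  proof -
    have "(bexp q X (\<lambda>C. (?A C)\<^sup>2 * (?B C)\<^sup>2))\<^sup>2
       \<le> bexp q X (\<lambda>C. ((?A C)\<^sup>2)\<^sup>2) * bexp q X (\<lambda>C. ((?B C)\<^sup>2)\<^sup>2)"
      by (rule bexp_Cauchy_Schwarz) (use q in linarith)+
    also have "\<dots> = bexp q X (\<lambda>C. (?A C) ^ 4) * bexp q X (\<lambda>C. (?B C) ^ 4)"
      unfolding p4 ..
    also have "\<dots> \<le> (\<Sum>S\<in>Pow X. (c S)\<^sup>2)\<^sup>2 * (\<Sum>S\<in>Pow X. (c (insert i S))\<^sup>2)\<^sup>2"
    proof (rule mult_mono)
      show "0 \<le> bexp q X (\<lambda>C. (?B C) ^ 4)"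
        by (rule bexp_nonneg) (use q in \<open>auto intro: zero_le_even_power\<close>)
    qed (rule insert.IH zero_le_power2)+
    finally have "(bexp q X (\<lambda>C. (?A C)\<^sup>2 * (?B C)\<^sup>2))\<^sup>2
        \<le> ((\<Sum>S\<in>Pow X. (c S)\<^sup>2) * (\<Sum>S\<in>Pow X. (c (insert i S))\<^sup>2))\<^sup>2"
      unfolding power_mult_distrib .
    then have "bexp q X (\<lambda>C. (?A C)\<^sup>2 * (?B C)\<^sup>2) \<le> (\<Sum>S\<in>Pow X. (c S)\<^sup>2) * (\<Sum>S\<in>Pow X. (c (insert i S))\<^sup>2)"
      by (rule power2_le_imp_le) (intro mult_nonneg_nonneg sum_nonneg zero_le_power2)
    with insert.IH[of c] insert.IH[of "\<lambda>S. c (insert i S)"] show ?thesis by linarith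
  qed
  also have "\<dots> = (\<Sum>S\<in>Pow (insert i X). (c S)\<^sup>2)\<^sup>2"
    unfolding split power2_sum by simp
  finally show ?case .
qed

section \<open>Influences and juntas\<close>

text \<open>Discrete derivative. Using \<open>insert i C\<close> and \<open>C - {i}\<close> makes it
  independent of whether \<open>i\<close> lies in \<open>C\<close>.\<close>

definition bdiff :: "'a \<Rightarrow> ('a set \<Rightarrow> real) \<Rightarrow> 'a set \<Rightarrow> real" where
  "bdiff i f C = f (insert i C) - f (C - {i})"

lemma bdiff_insert [simp]: "bdiff i f (insert i C) = bdiff i f C"
  by (simp add: bdiff_def)

text \<open>A function that ignores coordinate \<open>i\<close> is independent of the event
  \<open>i \<in> C\<close>.\<close>

lemma bexp_of_bool_mem:
  assumes "finite X" "i \<in> X" and f: "\<And>C. f (insert i C) = f C"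
  shows "bexp q X (\<lambda>C. of_bool (i \<in> C) * f C) = q * bexp q X f"
proof -
  have "bexp q X (\<lambda>C. of_bool (i \<in> C) * f C) = bexp q (X - {i}) (\<lambda>C. q * f C)"
    unfolding bexp_remove[OF assms(1,2)] by (intro bexp_cong) (auto simp: f)
  moreover have "bexp q X f = bexp q (X - {i}) f"
    unfolding bexp_remove[OF assms(1,2)] by (intro bexp_cong) (auto simp: f algebra_simps)
  ultimately show ?thesis by (simp add: bexp_cmult)
qed

text \<open>The difference of the two functions is the average of \<open>f\<close> over coordinate
  \<open>i\<close>, which is orthogonal to every character containing \<open>i\<close>.\<close>

lemma bcoeff_bdiff:
  assumes "finite X" "S \<subseteq> X" "i \<in> S" and q: "0 < q" "q < 1"
  shows "bcoeff q X f S = bcoeff q X (\<lambda>C. (of_bool (i \<in> C) - q) * bdiff i f C) S"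
proof -
  have iX: "i \<in> X" using assms by auto
  have finS: "finite S" using assms finite_subset by auto
  let ?e = "\<lambda>C. q * f (insert i C) + (1 - q) * f (C - {i})"
  have "bcoeff q X f S - bcoeff q X (\<lambda>C. (of_bool (i \<in> C) - q) * bdiff i f C) S
      = bexp q X (\<lambda>C. f C * bchar q S C - (of_bool (i \<in> C) - q) * bdiff i f C * bchar q S C)"
    by (simp only: bcoeff_def bexp_diff)
  also have "\<dots> = bexp q X (\<lambda>C. ?e C * bchar q S C)"
  proof (rule bexp_cong)
    fix C
    have "f C - (of_bool (i \<in> C) - q) * bdiff i f C = ?e C"
      by (cases "i \<in> C") (auto simp: bdiff_def insert_absorb algebra_simps)
    then show "f C * bchar q S C - (of_bool (i \<in> C) - q) * bdiff i f C * bchar q S C = ?e C * bchar q S C"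
      by (simp flip: left_diff_distrib)
  qed
  also have "\<dots> = bexp q (X - {i}) (\<lambda>C. 0)"
    unfolding bexp_remove[OF assms(1) iX]
  proof (rule bexp_cong)
    fix C assume "C \<subseteq> X - {i}"
    then have iC: "i \<notin> C" by auto
    have S: "S = insert i (S - {i})" using assms(3) by auto
    have c: "bchar q S D = bfactor q (i \<in> D) * bchar q (S - {i}) D" for D
      unfolding bchar_def by (subst S, subst prod.insert) (use finS in auto)
    have "q * (?e (insert i C) * bchar q S (insert i C)) + (1 - q) * (?e C * bchar q S C)
       = ?e C * bchar q (S - {i}) C * (q * bfactor q True + (1 - q) * bfactor q False)"
      unfolding c using iC by (simp add: bchar_insert_same algebra_simps)
    then show "q * (?e (insert i C) * bchar q S (insert i C)) + (1 - q) * (?e C * bchar q S C) = 0"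
      using bfactor_mult(5)[OF q] by simp
  qed
  finally show ?thesis by (simp add: bexp_const assms(1))
qed

text \<open>A function bounded by \<open>M\<close> and supported on an event of probability \<beta>
  has squared norm at most \<open>M\<^sup>2 * \<beta>\<close>; hypercontractivity gains a further
  \<open>sqrt \<beta>\<close> for the part of degree at most \<open>d\<close>. This gain makes
  coordinates with rare large jumps negligible.\<close>

lemma level_inequality:
  assumes "finite X" and q: "0 < q" "q < 1"
    and \<rho>: "0 < \<rho>" "\<rho> \<le> sqrt (q * (1 - q)) / 2"
    and h: "\<And>C. C \<subseteq> X \<Longrightarrow> \<bar>h C\<bar> \<le> M * of_bool (P C)"
    and "0 \<le> M"
  defines "\<beta> \<equiv> bexp q X (\<lambda>C. of_bool (P C))"
  shows "(\<Sum>S | S \<subseteq> X \<and> card S \<le> d. (bcoeff q X h S)\<^sup>2) \<le> M\<^sup>2 * \<beta> * sqrt \<beta> / \<rho> ^ (2 * d)"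
proof -
  let ?\<S> = "{S. S \<subseteq> X \<and> card S \<le> d}"
  define N where "N = (\<Sum>S\<in>?\<S>. (bcoeff q X h S)\<^sup>2)"
  define p where "p C = (\<Sum>S\<in>?\<S>. bcoeff q X h S * bchar q S C)" for C
  have q': "0 \<le> q" "q \<le> 1" using q by auto
  have \<beta>: "0 \<le> \<beta>" unfolding \<beta>_def using q' by (intro bexp_nonneg) auto
  have N0: "0 \<le> N" unfolding N_def by (intro sum_nonneg) auto
  have "sqrt (q * (1 - q)) \<le> 1"
    using q by (simp add: mult_le_one)
  then have \<rho>1: "\<rho> \<le> 1" using \<rho> by linarith
  \<comment> \<open>Rescaled so that the truncation \<open>p\<close> has the shape required by
    \<open>hypercontractive_4_2\<close>; this inflates the squared norm by at most
    \<open>1 / \<rho> ^ (2 * d)\<close>.\<close>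
  define c where "c S = (if card S \<le> d then bcoeff q X h S / \<rho> ^ card S else 0)" for S
  have fin: "finite (Pow X)" using assms(1) by simp
  have sub: "?\<S> \<subseteq> Pow X" by auto
  have pc: "p C = (\<Sum>S\<in>Pow X. \<rho> ^ card S * c S * bchar q S C)" for C
    unfolding p_def using \<rho> fin sub
    by (intro sum.mono_neutral_cong_left) (auto simp: c_def)
  have "(\<Sum>S\<in>Pow X. (c S)\<^sup>2) = (\<Sum>S\<in>?\<S>. (c S)\<^sup>2)"
    using fin sub by (intro sum.mono_neutral_right) (auto simp: c_def)
  also have "\<dots> \<le> (\<Sum>S\<in>?\<S>. (bcoeff q X h S)\<^sup>2 / \<rho> ^ (2 * d))"
  proof (rule sum_mono)
    fix S assume S: "S \<in> ?\<S>"
    have "(c S)\<^sup>2 = (bcoeff q X h S)\<^sup>2 / \<rho> ^ (2 * card S)"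
      using S by (simp add: c_def power_divide power_mult mult.commute flip: power_mult)
    also have "\<dots> \<le> (bcoeff q X h S)\<^sup>2 / \<rho> ^ (2 * d)"
      using S \<rho> \<rho>1 by (intro divide_left_mono power_decreasing) auto
    finally show "(c S)\<^sup>2 \<le> (bcoeff q X h S)\<^sup>2 / \<rho> ^ (2 * d)" .
  qed
  also have "\<dots> = N / \<rho> ^ (2 * d)" by (simp add: N_def sum_divide_distrib)
  finally have cN: "(\<Sum>S\<in>Pow X. (c S)\<^sup>2) \<le> N / \<rho> ^ (2 * d)" .
  have "bexp q X (\<lambda>C. p C ^ 4) \<le> (\<Sum>S\<in>Pow X. (c S)\<^sup>2)\<^sup>2"
    unfolding pc using \<rho> by (intro hypercontractive_4_2 assms(1) q) auto
  also have "\<dots> \<le> (N / \<rho> ^ (2 * d))\<^sup>2"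
    by (intro power_mono cN sum_nonneg) auto
  finally have p4: "bexp q X (\<lambda>C. p C ^ 4) \<le> (N / \<rho> ^ (2 * d))\<^sup>2" .
  let ?P = "\<lambda>C. of_bool (P C) :: real"
  have "(bexp q X (\<lambda>C. ?P C * (p C)\<^sup>2))\<^sup>2 \<le> bexp q X (\<lambda>C. (?P C)\<^sup>2) * bexp q X (\<lambda>C. ((p C)\<^sup>2)\<^sup>2)"
    by (rule bexp_Cauchy_Schwarz[OF q'])
  also have "bexp q X (\<lambda>C. (?P C)\<^sup>2) = \<beta>"
    unfolding \<beta>_def by (intro bexp_cong) auto
  also have "bexp q X (\<lambda>C. ((p C)\<^sup>2)\<^sup>2) = bexp q X (\<lambda>C. p C ^ 4)"
    by (simp flip: power_mult)
  also have "\<beta> * \<dots> \<le> \<beta> * (N / \<rho> ^ (2 * d))\<^sup>2"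
    using \<beta> p4 by (rule mult_left_mono[rotated])
  also have "\<dots> = (sqrt \<beta> * (N / \<rho> ^ (2 * d)))\<^sup>2"
    using \<beta> by (simp only: power_mult_distrib real_sqrt_pow2)
  finally have Pp: "bexp q X (\<lambda>C. ?P C * (p C)\<^sup>2) \<le> sqrt \<beta> * (N / \<rho> ^ (2 * d))"
    by (rule power2_le_imp_le) (use \<beta> N0 \<rho> in auto)
  \<comment> \<open>Duality: \<open>N\<close> is the correlation of \<open>h\<close> with its own
    truncation. As \<open>h\<close> lives on \<open>P\<close>, Cauchy-Schwarz bounds
    \<open>N\<^sup>2\<close> by a multiple of \<open>N\<close>, and one factor \<open>N\<close>
    cancels.\<close>
  have "N = bexp q X (\<lambda>C. h C * p C)"
    unfolding N_def p_def bexp_mult_bchar_sum ..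
  also have "\<dots> = bexp q X (\<lambda>C. h C * (?P C * p C))"
  proof (rule bexp_cong)
    fix C assume "C \<subseteq> X"
    from h[OF this] show "h C * p C = h C * (?P C * p C)" by (cases "P C") auto
  qed
  finally have "N\<^sup>2 = (bexp q X (\<lambda>C. h C * (?P C * p C)))\<^sup>2" by simp
  also have "\<dots> \<le> bexp q X (\<lambda>C. (h C)\<^sup>2) * bexp q X (\<lambda>C. (?P C * p C)\<^sup>2)"
    by (rule bexp_Cauchy_Schwarz[OF q'])
  also have "bexp q X (\<lambda>C. (?P C * p C)\<^sup>2) = bexp q X (\<lambda>C. ?P C * (p C)\<^sup>2)"
    by (intro bexp_cong) (auto simp: power_mult_distrib)
  also have "bexp q X (\<lambda>C. (h C)\<^sup>2) * \<dots> \<le> (M\<^sup>2 * \<beta>) * (sqrt \<beta> * (N / \<rho> ^ (2 * d)))"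
  proof (rule mult_mono[OF _ Pp])
    have "bexp q X (\<lambda>C. (h C)\<^sup>2) \<le> bexp q X (\<lambda>C. M\<^sup>2 * ?P C)"
    proof (rule bexp_mono[OF q'])
      fix C assume "C \<subseteq> X"
      from h[OF this] have "\<bar>h C\<bar>\<^sup>2 \<le> (M * ?P C)\<^sup>2" by (intro power_mono) auto
      then show "(h C)\<^sup>2 \<le> M\<^sup>2 * ?P C" by (cases "P C") auto
    qed
    then show "bexp q X (\<lambda>C. (h C)\<^sup>2) \<le> M\<^sup>2 * \<beta>" by (simp add: bexp_cmult \<beta>_def)
    show "0 \<le> bexp q X (\<lambda>C. ?P C * (p C)\<^sup>2)" using q' by (intro bexp_nonneg) auto
  qed (use \<beta> in auto)
  also have "\<dots> = (M\<^sup>2 * \<beta> * sqrt \<beta> / \<rho> ^ (2 * d)) * N" by simp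
  finally have "N * N \<le> (M\<^sup>2 * \<beta> * sqrt \<beta> / \<rho> ^ (2 * d)) * N" by (simp add: power2_eq_square)
  moreover have "0 \<le> M\<^sup>2 * \<beta> * sqrt \<beta> / \<rho> ^ (2 * d)" using \<beta> \<rho> by auto
  ultimately have "N \<le> M\<^sup>2 * \<beta> * sqrt \<beta> / \<rho> ^ (2 * d)"
    using N0 mult_right_le_imp_le[of N N] by (cases "N = 0") (simp, metis order_le_less)
  then show ?thesis by (simp add: N_def)
qed

lemma of_bool_minus_sq_le_1: "0 < q \<Longrightarrow> q < 1 \<Longrightarrow> (of_bool b - q)\<^sup>2 \<le> (1 :: real)"
  by (cases b) (auto simp: abs_square_le_1)

text \<open>Friedgut's argument, with \<open>P\<close> marking the large jumps. The approximant is
  the part of the Fourier expansion inside \<open>J\<close>, that is, the conditional mean given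
  \<open>C \<inter> J\<close>. Omitted frequencies of degree above \<open>d\<close> are paid for by
  the total energy \<gamma>; every other omitted one contains a coordinate outside \<open>J\<close>
  and is charged to it.\<close>

lemma junta_approximation:
  assumes fin: "finite X" and q: "0 < q" "q < 1"
    and \<rho>: "0 < \<rho>" "\<rho> \<le> sqrt (q * (1 - q)) / 2"
    and bd: "\<And>i C. i \<in> X \<Longrightarrow> C \<subseteq> X \<Longrightarrow> \<bar>bdiff i f C\<bar> \<le> M"
    and small: "(\<Sum>i\<in>X. bexp q X (\<lambda>C. (bdiff i f C)\<^sup>2 * of_bool (\<not> P i C))) \<le> \<alpha>"
    and big: "(\<Sum>i\<in>X. bexp q X (\<lambda>C. of_bool (P i C))) \<le> \<beta>"
    and total: "(\<Sum>i\<in>X. bexp q X (\<lambda>C. (bdiff i f C)\<^sup>2)) \<le> \<gamma>"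
    and "0 \<le> M" "0 \<le> \<tau>"
    and J: "J \<subseteq> X" "\<And>i. i \<in> X - J \<Longrightarrow> bexp q X (\<lambda>C. of_bool (P i C)) \<le> \<tau>"
  shows "\<exists>g. bexp q X (\<lambda>C. (f C - g (C \<inter> J))\<^sup>2)
     \<le> \<gamma> / real (Suc d) + 2 * \<alpha> + 2 * M\<^sup>2 * sqrt \<tau> * \<beta> / \<rho> ^ (2 * d)"
proof -
  have q': "0 \<le> q" "q \<le> 1" using q by auto
  define c where "c = bcoeff q X f"
  define b where "b i = bexp q X (\<lambda>C. of_bool (P i C))" for i
  have b0: "0 \<le> b i" for i unfolding b_def using q' by (intro bexp_nonneg) auto
  let ?L = "{S. S \<subseteq> X \<and> card S \<le> d}"
  let ?h = "\<lambda>i C. (of_bool (i \<in> C) - q) * bdiff i f C"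
  define hs where "hs i C = ?h i C * of_bool (\<not> P i C)" for i C
  define hb where "hb i C = ?h i C * of_bool (P i C)" for i C
  have finL: "finite ?L" using fin by simp
  \<comment> \<open>The derivative is split by \<open>P\<close>: Bessel suffices for the small
    jumps, and the level inequality gains \<open>sqrt \<tau>\<close> on the large ones.\<close>
  have low: "(\<Sum>S\<in>?L. of_bool (i \<in> S) * (c S)\<^sup>2)
      \<le> 2 * bexp q X (\<lambda>C. (bdiff i f C)\<^sup>2 * of_bool (\<not> P i C)) + 2 * M\<^sup>2 * sqrt \<tau> / \<rho> ^ (2 * d) * b i"
    if i: "i \<in> X - J" for i
  proof -
    have "(\<Sum>S\<in>?L. of_bool (i \<in> S) * (c S)\<^sup>2)
        \<le> (\<Sum>S\<in>?L. 2 * (bcoeff q X (hs i) S)\<^sup>2 + 2 * (bcoeff q X (hb i) S)\<^sup>2)"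
    proof (rule sum_mono)
      fix S assume S: "S \<in> ?L"
      show "of_bool (i \<in> S) * (c S)\<^sup>2 \<le> 2 * (bcoeff q X (hs i) S)\<^sup>2 + 2 * (bcoeff q X (hb i) S)\<^sup>2"
      proof (cases "i \<in> S")
        case True
        have "c S = bcoeff q X (?h i) S"
          unfolding c_def using S True by (intro bcoeff_bdiff fin q) auto
        also have "?h i = (\<lambda>C. hs i C + hb i C)" by (auto simp: hs_def hb_def)
        also have "bcoeff q X \<dots> S = bcoeff q X (hs i) S + bcoeff q X (hb i) S"
          by (simp only: bcoeff_def distrib_right bexp_add)
        finally have "c S = bcoeff q X (hs i) S + bcoeff q X (hb i) S" .
        then have "(c S)\<^sup>2 \<le> 2 * (bcoeff q X (hs i) S)\<^sup>2 + 2 * (bcoeff q X (hb i) S)\<^sup>2"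
          using sum_squares_bound[of "bcoeff q X (hs i) S" "bcoeff q X (hb i) S"]
          by (simp add: power2_sum)
        then show ?thesis using True by simp
      qed auto
    qed
    also have "\<dots> = 2 * (\<Sum>S\<in>?L. (bcoeff q X (hs i) S)\<^sup>2) + 2 * (\<Sum>S\<in>?L. (bcoeff q X (hb i) S)\<^sup>2)"
      by (simp add: sum.distrib sum_distrib_left)
    also have "(\<Sum>S\<in>?L. (bcoeff q X (hs i) S)\<^sup>2) \<le> bexp q X (\<lambda>C. (hs i C)\<^sup>2)"
      by (rule Bessel_bcoeff[OF fin _ q]) auto
    also have "\<dots> \<le> bexp q X (\<lambda>C. (bdiff i f C)\<^sup>2 * of_bool (\<not> P i C))"
    proof (rule bexp_mono[OF q'])
      fix C
      have "(hs i C)\<^sup>2 = (of_bool (i \<in> C) - q)\<^sup>2 * ((bdiff i f C)\<^sup>2 * of_bool (\<not> P i C))"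
        by (simp add: hs_def power_mult_distrib)
      also have "\<dots> \<le> 1 * ((bdiff i f C)\<^sup>2 * of_bool (\<not> P i C))"
        using q by (intro mult_right_mono of_bool_minus_sq_le_1) auto
      finally show "(hs i C)\<^sup>2 \<le> (bdiff i f C)\<^sup>2 * of_bool (\<not> P i C)" by simp
    qed
    also have "(\<Sum>S\<in>?L. (bcoeff q X (hb i) S)\<^sup>2) \<le> M\<^sup>2 * b i * sqrt (b i) / \<rho> ^ (2 * d)"
      unfolding b_def
    proof (rule level_inequality[OF fin q \<rho> _ \<open>0 \<le> M\<close>])
      fix C assume C: "C \<subseteq> X"
      have "\<bar>of_bool (i \<in> C) - q\<bar> \<le> 1" using q by auto
      then have "\<bar>of_bool (i \<in> C) - q\<bar> * \<bar>bdiff i f C\<bar> \<le> 1 * M"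
        using bd[of i C] i C by (intro mult_mono) auto
      then show "\<bar>hb i C\<bar> \<le> M * of_bool (P i C)" by (simp add: hb_def abs_mult)
    qed
    also have "M\<^sup>2 * b i * sqrt (b i) / \<rho> ^ (2 * d) \<le> M\<^sup>2 * b i * sqrt \<tau> / \<rho> ^ (2 * d)"
      using J(2)[OF i] b0[of i] \<rho> by (intro divide_right_mono mult_left_mono) (auto simp: b_def)
    finally show ?thesis by (simp add: mult_ac)
  qed
  \<comment> \<open>Spectral form of the energy bound: each \<open>S\<close> is counted once for
    every coordinate it contains.\<close>
  have high: "(\<Sum>S\<in>Pow X. real (card S) * (c S)\<^sup>2) \<le> \<gamma>"
  proof -
    have "(\<Sum>S\<in>Pow X. real (card S) * (c S)\<^sup>2) = (\<Sum>S\<in>Pow X. \<Sum>i\<in>X. of_bool (i \<in> S) * (c S)\<^sup>2)"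
    proof (rule sum.cong[OF refl])
      fix S assume "S \<in> Pow X"
      then have "X \<inter> S = S" by auto
      then show "real (card S) * (c S)\<^sup>2 = (\<Sum>i\<in>X. of_bool (i \<in> S) * (c S)\<^sup>2)"
        using fin by (simp add: sum_distrib_right[symmetric] of_bool_def sum.If_cases)
    qed
    also have "\<dots> = (\<Sum>i\<in>X. \<Sum>S\<in>Pow X. of_bool (i \<in> S) * (c S)\<^sup>2)" by (rule sum.swap)
    also have "\<dots> \<le> (\<Sum>i\<in>X. bexp q X (\<lambda>C. (bdiff i f C)\<^sup>2))"
    proof (rule sum_mono)
      fix i assume i: "i \<in> X"
      have "(\<Sum>S\<in>Pow X. of_bool (i \<in> S) * (c S)\<^sup>2) \<le> (\<Sum>S\<in>Pow X. (bcoeff q X (?h i) S)\<^sup>2)"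
        unfolding c_def using bcoeff_bdiff[OF fin _ _ q, of _ i f] by (intro sum_mono) auto
      also have "\<dots> \<le> bexp q X (\<lambda>C. (?h i C)\<^sup>2)" by (rule Bessel_bcoeff[OF fin _ q]) auto
      also have "\<dots> \<le> bexp q X (\<lambda>C. (bdiff i f C)\<^sup>2)"
      proof (rule bexp_mono[OF q'])
        fix C
        have "(?h i C)\<^sup>2 \<le> 1 * (bdiff i f C)\<^sup>2" unfolding power_mult_distrib
          using q by (intro mult_right_mono of_bool_minus_sq_le_1) auto
        then show "(?h i C)\<^sup>2 \<le> (bdiff i f C)\<^sup>2" by simp
      qed
      finally show "(\<Sum>S\<in>Pow X. of_bool (i \<in> S) * (c S)\<^sup>2) \<le> bexp q X (\<lambda>C. (bdiff i f C)\<^sup>2)" .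
    qed
    finally show ?thesis using total by linarith
  qed
  define g where "g B = (\<Sum>S\<in>Pow J. c S * bchar q S B)" for B
  let ?N = "{S. S \<subseteq> X \<and> \<not> S \<subseteq> J}"
  have "bexp q X (\<lambda>C. (f C - g (C \<inter> J))\<^sup>2) = bexp q X (\<lambda>C. (\<Sum>S\<in>?N. c S * bchar q S C)\<^sup>2)"
  proof (rule bexp_cong)
    fix C assume C: "C \<subseteq> X"
    have "Pow X = Pow J \<union> ?N" using J(1) by auto
    then have "f C = (\<Sum>S\<in>Pow J \<union> ?N. c S * bchar q S C)"
      using bchar_expansion[OF fin C q, of f] by (simp add: c_def)
    also have "\<dots> = (\<Sum>S\<in>Pow J. c S * bchar q S C) + (\<Sum>S\<in>?N. c S * bchar q S C)"
      using fin J(1) finite_subset by (intro sum.union_disjoint) auto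
    also have "(\<Sum>S\<in>Pow J. c S * bchar q S C) = g (C \<inter> J)"
      unfolding g_def by (intro sum.cong refl) (auto simp: bchar_Int)
    finally show "(f C - g (C \<inter> J))\<^sup>2 = (\<Sum>S\<in>?N. c S * bchar q S C)\<^sup>2" by simp
  qed
  also have "\<dots> = (\<Sum>S\<in>?N. (c S)\<^sup>2)" by (rule bexp_bchar_sum_sq[OF fin _ q]) auto
  also have "\<dots> \<le> (\<Sum>S\<in>?N. real (card S) * (c S)\<^sup>2 / real (Suc d) + (\<Sum>i\<in>X - J. of_bool (card S \<le> d) * (of_bool (i \<in> S) * (c S)\<^sup>2)))"
  proof (rule sum_mono)
    fix S assume S: "S \<in> ?N"
    show "(c S)\<^sup>2 \<le> real (card S) * (c S)\<^sup>2 / real (Suc d) + (\<Sum>i\<in>X - J. of_bool (card S \<le> d) * (of_bool (i \<in> S) * (c S)\<^sup>2))"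
    proof (cases "card S \<le> d")
      case True
      obtain i where i: "i \<in> X - J" "i \<in> S" using S by auto
      have "(c S)\<^sup>2 = of_bool (card S \<le> d) * (of_bool (i \<in> S) * (c S)\<^sup>2)" using True i by simp
      also have "\<dots> \<le> (\<Sum>i\<in>X - J. of_bool (card S \<le> d) * (of_bool (i \<in> S) * (c S)\<^sup>2))"
        using fin i by (intro member_le_sum) auto
      finally show ?thesis by (simp add: add_increasing)
    next
      case False
      then have "real (Suc d) * (c S)\<^sup>2 \<le> real (card S) * (c S)\<^sup>2" by (intro mult_right_mono) auto
      then have "(c S)\<^sup>2 \<le> real (card S) * (c S)\<^sup>2 / real (Suc d)" by (simp add: field_simps)
      then show ?thesis using False by simp
    qed
  qed
  also have "\<dots> = (\<Sum>S\<in>?N. real (card S) * (c S)\<^sup>2) / real (Suc d)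
      + (\<Sum>i\<in>X - J. \<Sum>S\<in>?N. of_bool (card S \<le> d) * (of_bool (i \<in> S) * (c S)\<^sup>2))"
    unfolding sum.distrib sum_divide_distrib by (subst sum.swap) simp
  also have "(\<Sum>S\<in>?N. real (card S) * (c S)\<^sup>2) \<le> \<gamma>"
    using fin by (intro order.trans[OF sum_mono2 high]) auto
  also have "(\<Sum>i\<in>X - J. \<Sum>S\<in>?N. of_bool (card S \<le> d) * (of_bool (i \<in> S) * (c S)\<^sup>2))
     \<le> (\<Sum>i\<in>X - J. 2 * bexp q X (\<lambda>C. (bdiff i f C)\<^sup>2 * of_bool (\<not> P i C)) + 2 * M\<^sup>2 * sqrt \<tau> / \<rho> ^ (2 * d) * b i)"
  proof (rule sum_mono)
    fix i assume i: "i \<in> X - J"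
    have "(\<Sum>S\<in>?N. of_bool (card S \<le> d) * (of_bool (i \<in> S) * (c S)\<^sup>2))
       \<le> (\<Sum>S\<in>Pow X. of_bool (card S \<le> d) * (of_bool (i \<in> S) * (c S)\<^sup>2))"
      using fin by (intro sum_mono2) auto
    also have "\<dots> = (\<Sum>S\<in>?L. of_bool (i \<in> S) * (c S)\<^sup>2)"
      using fin by (intro sum.mono_neutral_cong_right) auto
    also note low[OF i]
    finally show "(\<Sum>S\<in>?N. of_bool (card S \<le> d) * (of_bool (i \<in> S) * (c S)\<^sup>2))
      \<le> 2 * bexp q X (\<lambda>C. (bdiff i f C)\<^sup>2 * of_bool (\<not> P i C)) + 2 * M\<^sup>2 * sqrt \<tau> / \<rho> ^ (2 * d) * b i" .
  qed
  also have "\<dots> \<le> (\<Sum>i\<in>X. 2 * bexp q X (\<lambda>C. (bdiff i f C)\<^sup>2 * of_bool (\<not> P i C)) + 2 * M\<^sup>2 * sqrt \<tau> / \<rho> ^ (2 * d) * b i)"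
    using fin q' b0 \<rho> \<open>0 \<le> \<tau>\<close>
    by (intro sum_mono2 add_nonneg_nonneg mult_nonneg_nonneg bexp_nonneg) auto
  also have "\<dots> = 2 * (\<Sum>i\<in>X. bexp q X (\<lambda>C. (bdiff i f C)\<^sup>2 * of_bool (\<not> P i C)))
       + 2 * M\<^sup>2 * sqrt \<tau> / \<rho> ^ (2 * d) * (\<Sum>i\<in>X. b i)"
    by (simp only: sum.distrib sum_distrib_left)
  also have "\<dots> \<le> 2 * \<alpha> + 2 * M\<^sup>2 * sqrt \<tau> / \<rho> ^ (2 * d) * \<beta>"
    using small big \<rho> \<open>0 \<le> \<tau>\<close> by (intro add_mono mult_left_mono) (auto simp: b_def)
  finally show ?thesis by (intro exI[of _ g]) (simp add: divide_right_mono add.assoc)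
qed

section \<open>The logarithmic potential\<close>

text \<open>The Margulis-Russo formula, for real-valued functions on the cube.\<close>

lemma bexp_has_real_derivative:
  assumes "finite X"
  shows "((\<lambda>q. bexp q X f) has_real_derivative (\<Sum>i\<in>X. bexp q X (bdiff i f))) (at q)"
  using assms
proof (induction X arbitrary: f rule: finite_induct)
  case (insert j X)
  let ?f = "\<lambda>C. f (insert j C)"
  have split: "bexp q (insert j X) h = q * bexp q X (\<lambda>C. h (insert j C)) + (1 - q) * bexp q X h" for q h
    by (simp only: bexp_insert[OF insert.hyps] bexp_add bexp_cmult)
  have j: "bexp q (insert j X) (bdiff j f) = bexp q X ?f - bexp q X f"
  proof -
    have "bexp q (insert j X) (bdiff j f) = bexp q X (bdiff j f)"
      unfolding split by (simp add: algebra_simps)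
    also have "\<dots> = bexp q X (\<lambda>C. ?f C - f C)"
      using insert.hyps(2) by (intro bexp_cong) (auto simp: bdiff_def subset_iff intro!: arg_cong[of _ _ f])
    finally show ?thesis by (simp only: bexp_diff)
  qed
  have i: "bexp q (insert j X) (bdiff i f) = q * bexp q X (bdiff i ?f) + (1 - q) * bexp q X (bdiff i f)"
    if "i \<in> X" for i
  proof -
    have "i \<noteq> j" using that insert.hyps by auto
    then have "(\<lambda>C. bdiff i f (insert j C)) = bdiff i ?f"
      by (auto simp: bdiff_def insert_commute insert_Diff_if fun_eq_iff)
    then show ?thesis unfolding split by simp
  qed
  have "((\<lambda>q. q * bexp q X ?f + (1 - q) * bexp q X f) has_real_derivative
      (1 * bexp q X ?f + (\<Sum>i\<in>X. bexp q X (bdiff i ?f)) * q)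
      + ((0 - 1) * bexp q X f + (\<Sum>i\<in>X. bexp q X (bdiff i f)) * (1 - q))) (at q)"
    by (intro derivative_intros insert.IH)
  moreover have "(1 * bexp q X ?f + (\<Sum>i\<in>X. bexp q X (bdiff i ?f)) * q)
      + ((0 - 1) * bexp q X f + (\<Sum>i\<in>X. bexp q X (bdiff i f)) * (1 - q))
     = (\<Sum>i\<in>insert j X. bexp q (insert j X) (bdiff i f))"
    using insert.hyps by (simp add: j i sum.distrib sum_distrib_left mult_ac cong: sum.cong)
  ultimately show ?case unfolding split by simp
qed simp

lemma bexp_minus: "bexp q X (\<lambda>C. - f C) = - bexp q X f"
  by (simp add: bexp_def sum_negf)

text \<open>Turns the Russo derivative into a drift under deletion of points:
  \<open>bdiff i f\<close> ignores coordinate \<open>i\<close>, so restricting it to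
  \<open>i \<in> C\<close> costs exactly the factor \<open>q\<close>.\<close>

lemma sum_bexp_bdiff:
  assumes "finite X"
  shows "q * (\<Sum>i\<in>X. bexp q X (bdiff i f)) = - bexp q X (\<lambda>C. \<Sum>i\<in>C. f (C - {i}) - f C)"
proof -
  have "bexp q X (\<lambda>C. \<Sum>i\<in>C. f (C - {i}) - f C) = bexp q X (\<lambda>C. \<Sum>i\<in>X. of_bool (i \<in> C) * (- bdiff i f C))"
  proof (rule bexp_cong)
    fix C assume "C \<subseteq> X"
    then have "(\<Sum>i\<in>X. of_bool (i \<in> C) * (- bdiff i f C)) = (\<Sum>i\<in>C. of_bool (i \<in> C) * (- bdiff i f C))"
      using assms by (intro sum.mono_neutral_right) auto
    also have "\<dots> = (\<Sum>i\<in>C. f (C - {i}) - f C)"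
      by (intro sum.cong) (auto simp: bdiff_def insert_absorb)
    finally show "(\<Sum>i\<in>C. f (C - {i}) - f C) = (\<Sum>i\<in>X. of_bool (i \<in> C) * (- bdiff i f C))" by simp
  qed
  also have "\<dots> = (\<Sum>i\<in>X. q * (- bexp q X (bdiff i f)))"
    unfolding bexp_sum using assms
    by (intro sum.cong refl, subst bexp_of_bool_mem) (auto simp: bexp_minus)
  finally show ?thesis by (simp add: sum_distrib_left sum_negf)
qed

text \<open>One expression for both regimes: quadratic for small \<open>v\<close> and linear for
  large \<open>v\<close> of either sign. The linear regime is what separates small from large jumps
  later.\<close>

lemma exp_minus_linear_ge:
  fixes v :: real
  shows "v\<^sup>2 / (2 * (1 + \<bar>v\<bar>)) \<le> exp v - 1 - v"
proof (cases "0 \<le> v")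
  case True
  have "v\<^sup>2 / (2 * (1 + \<bar>v\<bar>)) \<le> v\<^sup>2 / 2"
    using True by (intro divide_left_mono) auto
  also have "\<dots> \<le> exp v - 1 - v" using exp_lower_Taylor_quadratic[OF True] by simp
  finally show ?thesis .
next
  case False
  define u where "u = - v"
  have u: "0 \<le> u" using False by (simp add: u_def)
  let ?G = "\<lambda>u::real. exp (- u) - 1 + u - u\<^sup>2 / (2 * (1 + u))"
  have "?G 0 \<le> ?G u"
  proof (rule DERIV_nonneg_imp_nondecreasing[OF u])
    fix x :: real assume x: "0 \<le> x" "x \<le> u"
    have "(?G has_real_derivative (- exp (- x) + 1 - (2 * x * (2 * (1 + x)) - x\<^sup>2 * 2) / (2 * (1 + x))\<^sup>2)) (at x)"
      using x by (auto intro!: derivative_eq_intros simp: power2_eq_square)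
    moreover have "0 \<le> - exp (- x) + 1 - (2 * x * (2 * (1 + x)) - x\<^sup>2 * 2) / (2 * (1 + x))\<^sup>2"
    proof -
      \<comment> \<open>Since \<open>exp (- x) \<le> t\<close>, the derivative is at least
        \<open>(1 - t)\<^sup>2 / 2\<close>.\<close>
      define t where "t = 1 / (1 + x)"
      have 1: "exp (- x) \<le> t"
        using exp_ge_add_one_self[of x] x by (simp add: t_def exp_minus field_simps)
      have 2: "(2 * x * (2 * (1 + x)) - x\<^sup>2 * 2) / (2 * (1 + x))\<^sup>2 = (1 - t\<^sup>2) / 2"
      proof -
        define y where "y = 1 + x"
        have y: "y \<noteq> 0" "x = y - 1" using x by (auto simp: y_def)
        have "2 * x * (2 * y) - x\<^sup>2 * 2 = 2 * y\<^sup>2 - 2"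
          unfolding y(2) by (simp add: power2_eq_square algebra_simps)
        moreover have "(2 * y\<^sup>2 - 2) / (2 * y)\<^sup>2 = (1 - (1 / y)\<^sup>2) / 2"
          using y(1) by (simp add: power2_eq_square field_simps)
        ultimately show ?thesis unfolding t_def y_def[symmetric] by simp
      qed
      have "0 \<le> (1 - t)\<^sup>2" by simp
      then have "2 * t \<le> 1 + t\<^sup>2" by (simp add: power2_diff)
      with 1 show ?thesis unfolding 2 by (simp add: field_simps)
    qed
    ultimately show "\<exists>y. (?G has_real_derivative y) (at x) \<and> 0 \<le> y" by blast
  qed
  then show ?thesis using u by (simp add: u_def)
qed

text \<open>The summand \<open>exp (- L)\<close> keeps the logarithm finite where \<open>g\<close>
  vanishes; division by \<open>L\<close> brings the range into \<open>[- ln 2 / L, 1]\<close> when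
  \<open>g\<close> is between 0 and 1. For large \<open>L\<close> the value is near 1 where
  \<open>g < exp (- L)\<close> and near 0 where \<open>g\<close> is bounded below.\<close>

definition log_potential :: "real \<Rightarrow> ('a set \<Rightarrow> real) \<Rightarrow> 'a set \<Rightarrow> real" where
  "log_potential L g C = - ln (g C + exp (- L)) / L"

context
  fixes X :: "'a set" and g :: "'a set \<Rightarrow> real" and L :: real
  assumes fin: "finite X" and L: "1 \<le> L"
    and g01: "\<And>C. C \<subseteq> X \<Longrightarrow> 0 \<le> g C" "\<And>C. C \<subseteq> X \<Longrightarrow> g C \<le> 1"
    and super: "\<And>C. C \<subseteq> X \<Longrightarrow> (\<Sum>i\<in>C. g (C - {i})) \<le> real (card C) * g C"
begin

lemma log_potential_le_1: "C \<subseteq> X \<Longrightarrow> log_potential L g C \<le> 1"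
proof -
  assume C: "C \<subseteq> X"
  have "ln (exp (- L)) \<le> ln (g C + exp (- L))"
    using g01[OF C] by (subst ln_le_cancel_iff) (auto simp: add_nonneg_pos)
  then have "- ln (g C + exp (- L)) \<le> 1 * L" by simp
  then show ?thesis using L by (simp only: log_potential_def pos_divide_le_eq)
qed

lemma log_potential_ge:
  assumes C: "C \<subseteq> X"
  shows "of_bool (g C < exp (- L)) - ln 2 / L \<le> log_potential L g C"
proof -
  have "ln (g C + exp (- L)) \<le> ln 2 - L * of_bool (g C < exp (- L))"
  proof (cases "g C < exp (- L)")
    case True
    have "ln (g C + exp (- L)) \<le> ln (2 * exp (- L))"
      using True g01(1)[OF C] by (subst ln_le_cancel_iff) (auto simp: add_nonneg_pos)
    then show ?thesis using True by (simp add: ln_mult)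
  next
    case False
    have "exp (- L) \<le> 1" using L by simp
    with g01(2)[OF C] have "g C + exp (- L) \<le> 2" by linarith
    then have "ln (g C + exp (- L)) \<le> ln 2"
      using g01[OF C] by (subst ln_le_cancel_iff) (auto simp: add_nonneg_pos)
    then show ?thesis using False by simp
  qed
  then have "(L * of_bool (g C < exp (- L)) - ln 2) / L \<le> - ln (g C + exp (- L)) / L"
    using L by (intro divide_right_mono) auto
  then show ?thesis using L by (simp add: log_potential_def diff_divide_distrib)
qed

lemma ln_2_div_le_1: "ln 2 / L \<le> 1"
  using L ln_2_less_1 by (simp add: divide_le_eq)

lemma bdiff_log_potential_le:
  assumes "i \<in> X" "C \<subseteq> X"
  shows "\<bar>bdiff i (log_potential L g) C\<bar> \<le> 2"
proof -
  have "insert i C \<subseteq> X" "C - {i} \<subseteq> X" using assms by auto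
  from this[THEN log_potential_le_1] this[THEN log_potential_ge] ln_2_div_le_1
  show ?thesis by (auto simp: bdiff_def abs_le_iff of_bool_def split: if_splits)
qed

text \<open>For \<open>i \<in> C\<close> the exponential is the ratio of
  \<open>g + exp (- L)\<close> after and before deleting \<open>i\<close>. Superharmonicity makes
  these ratios at most 1 on average, so the terms \<open>exp v - 1\<close> have a nonpositive sum;
  what remains is the linear part, which is the drift.\<close>

lemma log_potential_drift:
  assumes C: "C \<subseteq> X"
  shows "(\<Sum>i\<in>C. exp (L * bdiff i (log_potential L g) C) - 1 - L * bdiff i (log_potential L g) C)
    \<le> L * (\<Sum>i\<in>C. log_potential L g (C - {i}) - log_potential L g C)"
proof -
  let ?w = "log_potential L g"
  have pos: "0 < g D + exp (- L)" if "D \<subseteq> X" for D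
    using g01(1)[OF that] by (simp add: add_nonneg_pos)
  have finC: "finite C" using C fin finite_subset by auto
  have b: "bdiff i ?w C = ?w C - ?w (C - {i})" if "i \<in> C" for i
    using that by (simp add: bdiff_def insert_absorb)
  have e: "exp (L * bdiff i ?w C) = (g (C - {i}) + exp (- L)) / (g C + exp (- L))" if i: "i \<in> C" for i
  proof -
    have D: "C - {i} \<subseteq> X" using C by auto
    have "L * bdiff i ?w C = ln (g (C - {i}) + exp (- L)) - ln (g C + exp (- L))"
      using L by (simp add: b[OF i] log_potential_def right_diff_distrib)
    then show ?thesis using pos[OF C] pos[OF D] by (simp add: exp_diff)
  qed
  have "(\<Sum>i\<in>C. exp (L * bdiff i ?w C) - 1) = (\<Sum>i\<in>C. (g (C - {i}) - g C) / (g C + exp (- L)))"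
    using pos[OF C] by (intro sum.cong refl) (simp add: e field_simps)
  also have "\<dots> = ((\<Sum>i\<in>C. g (C - {i})) - real (card C) * g C) / (g C + exp (- L))"
    by (simp add: sum_divide_distrib[symmetric] sum_subtractf)
  also have "\<dots> \<le> 0"
    using super[OF C] pos[OF C] by (intro divide_nonpos_pos) auto
  finally have 1: "(\<Sum>i\<in>C. exp (L * bdiff i ?w C) - 1) \<le> 0" .
  have 2: "L * (\<Sum>i\<in>C. ?w (C - {i}) - ?w C) = - (\<Sum>i\<in>C. L * bdiff i ?w C)"
    unfolding sum_distrib_left sum_negf[symmetric] by (intro sum.cong refl) (simp add: b algebra_simps)
  show ?thesis unfolding 2 sum_subtractf[of "\<lambda>i. exp (L * bdiff i ?w C) - 1"] using 1 by simp
qed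

lemma log_potential_drift_nonneg:
  assumes C: "C \<subseteq> X"
  shows "0 \<le> (\<Sum>i\<in>C. log_potential L g (C - {i}) - log_potential L g C)"
proof -
  have "0 \<le> exp v - 1 - v" for v :: real using exp_ge_add_one_self[of v] by linarith
  then have "0 \<le> (\<Sum>i\<in>C. exp (L * bdiff i (log_potential L g) C) - 1 - L * bdiff i (log_potential L g) C)"
    by (intro sum_nonneg) blast
  with log_potential_drift[OF C] have "0 \<le> L * (\<Sum>i\<in>C. log_potential L g (C - {i}) - log_potential L g C)"
    by linarith
  then show ?thesis using L by (simp add: zero_le_mult_iff)
qed

text \<open>By Russo the derivative is the negative of a nonnegative drift. This carries a large
  mean at \<open>Q\<close> down to the smaller density where the gradient is controlled.\<close>

lemma bexp_log_potential_antimono: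
  assumes "0 < q" "q \<le> Q" "Q \<le> 1"
  shows "bexp Q X (log_potential L g) \<le> bexp q X (log_potential L g)"
proof (rule DERIV_nonpos_imp_nonincreasing[OF assms(2)])
  fix x assume x: "q \<le> x" "x \<le> Q"
  let ?D = "\<Sum>i\<in>X. bexp x X (bdiff i (log_potential L g))"
  have "0 \<le> bexp x X (\<lambda>C. \<Sum>i\<in>C. log_potential L g (C - {i}) - log_potential L g C)"
    using x assms by (intro bexp_nonneg log_potential_drift_nonneg) auto
  then have "x * ?D \<le> 0" unfolding sum_bexp_bdiff[OF fin] by simp
  then have "?D \<le> 0" using x assms by (simp add: mult_le_0_iff)
  then show "\<exists>y. ((\<lambda>q. bexp q X (log_potential L g)) has_real_derivative y) (at x) \<and> y \<le> 0"
    using bexp_has_real_derivative[OF fin] by blast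
qed

text \<open>\<open>V\<close> is minus the derivative of the mean, and \<open>q * V\<close> is the
  expected drift that pays for the jumps. Because \<open>1 \<le> L * \<kappa>\<close>, the penalty
  of a jump \<open>x\<close> is at least \<open>L * x\<^sup>2 / (4 * \<kappa>)\<close> up to size
  \<kappa> and at least \<open>L * |x| / 4\<close> beyond; the three bounds follow from these
  two.\<close>

lemma log_potential_energy:
  fixes \<kappa> q :: real
  assumes \<kappa>: "0 < \<kappa>" "\<kappa> \<le> 1" "1 \<le> L * \<kappa>" and q: "0 < q" "q \<le> 1"
  defines "d \<equiv> \<lambda>i. bdiff i (log_potential L g)"
  defines "V \<equiv> - (\<Sum>i\<in>X. bexp q X (d i))"
  shows "(\<Sum>i\<in>X. bexp q X (\<lambda>C. (d i C)\<^sup>2 * of_bool (\<not> \<kappa> < \<bar>d i C\<bar>))) \<le> 4 * \<kappa> * V"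
    and "(\<Sum>i\<in>X. bexp q X (\<lambda>C. of_bool (\<kappa> < \<bar>d i C\<bar>))) \<le> 4 / \<kappa> * V"
    and "(\<Sum>i\<in>X. bexp q X (\<lambda>C. (d i C)\<^sup>2)) \<le> 12 * V"
proof -
  have d_ins: "d i (insert i C) = d i C" for i C by (simp add: d_def)
  let ?D = "\<lambda>C. \<Sum>i\<in>C. log_potential L g (C - {i}) - log_potential L g C"
  have q': "0 \<le> q" using q by simp
  \<comment> \<open>Common principle: a function of the jumps lying below \<open>K / L\<close> times
    the penalty has total expectation at most \<open>K * V\<close>. Checking
    \<open>|x| \<le> 2\<close> is enough, since no jump of the potential is larger.\<close>
  have transfer: "(\<Sum>i\<in>X. bexp q X (\<lambda>C. F (d i C))) \<le> K * V"
    if K: "0 < K" and F: "\<And>x. \<bar>x\<bar> \<le> 2 \<Longrightarrow> F x \<le> K / L * (exp (L * x) - 1 - L * x)" for F K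
  proof -
    have "q * (\<Sum>i\<in>X. bexp q X (\<lambda>C. F (d i C))) = (\<Sum>i\<in>X. bexp q X (\<lambda>C. of_bool (i \<in> C) * F (d i C)))"
      unfolding sum_distrib_left
      by (intro sum.cong refl bexp_of_bool_mem[symmetric] fin) (auto simp: d_ins)
    also have "\<dots> = bexp q X (\<lambda>C. \<Sum>i\<in>X. of_bool (i \<in> C) * F (d i C))" by (simp only: bexp_sum)
    also have "\<dots> \<le> bexp q X (\<lambda>C. K * ?D C)"
    proof (rule bexp_mono[OF q' q(2)])
      fix C assume C: "C \<subseteq> X"
      have "(\<Sum>i\<in>X. of_bool (i \<in> C) * F (d i C)) = (\<Sum>i\<in>C. of_bool (i \<in> C) * F (d i C))"
        using C fin by (intro sum.mono_neutral_right) auto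
      also have "\<dots> \<le> (\<Sum>i\<in>C. K / L * (exp (L * d i C) - 1 - L * d i C))"
      proof (rule sum_mono)
        fix i assume i: "i \<in> C"
        then have "\<bar>d i C\<bar> \<le> 2" using bdiff_log_potential_le[of i C] C by (auto simp: d_def)
        from F[OF this] show "of_bool (i \<in> C) * F (d i C) \<le> K / L * (exp (L * d i C) - 1 - L * d i C)"
          using i by simp
      qed
      also have "\<dots> = K / L * (\<Sum>i\<in>C. exp (L * d i C) - 1 - L * d i C)"
        by (simp only: sum_distrib_left)
      also have "\<dots> \<le> K / L * (L * ?D C)"
        using log_potential_drift[OF C] K L by (intro mult_left_mono) (auto simp: d_def)
      also have "\<dots> = K * ?D C" using L by simp
      finally show "(\<Sum>i\<in>X. of_bool (i \<in> C) * F (d i C)) \<le> K * ?D C" .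
    qed
    also have "\<dots> = K * bexp q X ?D" by (rule bexp_cmult)
    also have "bexp q X ?D = q * V"
      using sum_bexp_bdiff[OF fin, of q "log_potential L g"] by (simp add: V_def d_def)
    finally have "q * (\<Sum>i\<in>X. bexp q X (\<lambda>C. F (d i C))) \<le> q * (K * V)" by (simp add: mult_ac)
    then show ?thesis using q by simp
  qed
  define Bf where "Bf x = exp (L * x) - 1 - L * x" for x
  have Bf: "(L * x)\<^sup>2 / (2 * (1 + L * \<bar>x\<bar>)) \<le> Bf x" for x
    using exp_minus_linear_ge[of "L * x"] L by (simp add: Bf_def abs_mult)
  have Bf0: "0 \<le> Bf x" for x
    using exp_ge_add_one_self[of "L * x"] unfolding Bf_def by linarith
  have dbl: "2 * (1 + y) \<le> 4 * z" if "y \<le> z" "1 \<le> z" for y z :: real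
    using add_mono[OF that(2,1)] by simp
  have s: "x\<^sup>2 \<le> 4 * \<kappa> / L * Bf x" if "\<bar>x\<bar> \<le> \<kappa>" for x
  proof -
    have "L * \<bar>x\<bar> \<le> L * \<kappa>" using that L by (intro mult_left_mono) auto
    then have "2 * (1 + L * \<bar>x\<bar>) \<le> 4 * (L * \<kappa>)" using \<kappa>(3) by (intro dbl) auto
    then have "(L * x)\<^sup>2 / (4 * (L * \<kappa>)) \<le> (L * x)\<^sup>2 / (2 * (1 + L * \<bar>x\<bar>))"
      using \<kappa> L by (intro divide_left_mono) (auto intro!: mult_pos_pos add_pos_nonneg)
    with Bf[of x] have "(L * x)\<^sup>2 / (4 * (L * \<kappa>)) \<le> Bf x" by linarith
    then show ?thesis using L \<kappa> by (simp add: field_simps power2_eq_square)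
  qed
  have b: "\<bar>x\<bar> \<le> 4 / L * Bf x" if "\<kappa> < \<bar>x\<bar>" for x
  proof -
    have "L * \<kappa> \<le> L * \<bar>x\<bar>" using that L by (intro mult_left_mono) auto
    then have "2 * (1 + L * \<bar>x\<bar>) \<le> 4 * (L * \<bar>x\<bar>)" using \<kappa>(3) by (intro dbl) linarith+
    then have "(L * x)\<^sup>2 / (4 * (L * \<bar>x\<bar>)) \<le> (L * x)\<^sup>2 / (2 * (1 + L * \<bar>x\<bar>))"
      using \<kappa> L that by (intro divide_left_mono) (auto intro!: mult_pos_pos add_pos_nonneg)
    moreover have "(L * x)\<^sup>2 / (4 * (L * \<bar>x\<bar>)) = L * \<bar>x\<bar> / 4"
    proof -
      have "(L * x)\<^sup>2 = (L * \<bar>x\<bar>) * (L * \<bar>x\<bar>)" by (simp add: power2_eq_square mult_ac flip: abs_mult)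
      then show ?thesis using L that \<kappa> by simp
    qed
    ultimately have "L * \<bar>x\<bar> / 4 \<le> Bf x" using Bf[of x] by linarith
    then show ?thesis using L by (simp add: field_simps)
  qed
  show "(\<Sum>i\<in>X. bexp q X (\<lambda>C. (d i C)\<^sup>2 * of_bool (\<not> \<kappa> < \<bar>d i C\<bar>))) \<le> 4 * \<kappa> * V"
  proof (rule transfer)
    fix x show "x\<^sup>2 * of_bool (\<not> \<kappa> < \<bar>x\<bar>) \<le> 4 * \<kappa> / L * (exp (L * x) - 1 - L * x)"
      using s[of x] Bf0[of x] \<kappa> L by (cases "\<kappa> < \<bar>x\<bar>") (auto simp: Bf_def)
  qed (use \<kappa> in auto)
  show "(\<Sum>i\<in>X. bexp q X (\<lambda>C. of_bool (\<kappa> < \<bar>d i C\<bar>))) \<le> 4 / \<kappa> * V"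
  proof (rule transfer)
    fix x show "of_bool (\<kappa> < \<bar>x\<bar>) \<le> 4 / \<kappa> / L * (exp (L * x) - 1 - L * x)"
    proof (cases "\<kappa> < \<bar>x\<bar>")
      case True
      with b[OF True] have "\<kappa> \<le> 4 / L * Bf x" by linarith
      then show ?thesis using True \<kappa> L by (simp add: Bf_def field_simps)
    next
      case False
      then show ?thesis using Bf0[of x] \<kappa> L by (simp add: Bf_def)
    qed
  qed (use \<kappa> in auto)
  show "(\<Sum>i\<in>X. bexp q X (\<lambda>C. (d i C)\<^sup>2)) \<le> 12 * V"
  proof (rule transfer)
    fix x :: real assume x: "\<bar>x\<bar> \<le> 2"
    have "x\<^sup>2 \<le> 8 / L * Bf x"
    proof (cases "\<kappa> < \<bar>x\<bar>")
      case True
      have "x\<^sup>2 = \<bar>x\<bar> * \<bar>x\<bar>" by (simp add: power2_eq_square)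
      also have "\<dots> \<le> 2 * \<bar>x\<bar>" using x by (intro mult_right_mono) auto
      finally show ?thesis using b[OF True] by simp
    next
      case False
      then have "x\<^sup>2 \<le> 4 * \<kappa> / L * Bf x" using s by simp
      also have "\<dots> \<le> 8 / L * Bf x" using \<kappa> L Bf0[of x] by (intro mult_right_mono divide_right_mono) auto
      finally show ?thesis .
    qed
    also have "\<dots> \<le> 12 / L * Bf x" using L Bf0[of x] by (intro mult_right_mono divide_right_mono) auto
    finally show "x\<^sup>2 \<le> 12 / L * (exp (L * x) - 1 - L * x)" by (simp add: Bf_def)
  qed auto
qed

end

section \<open>Lower tails of superharmonic functions\<close>

lemma bexp_fibres:
  assumes "finite J"
  shows "bexp q X f = (\<Sum>B\<in>Pow J. bexp q X (\<lambda>C. of_bool (C \<inter> J = B) * f C))"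
proof -
  have "(\<Sum>B\<in>Pow J. of_bool (C \<inter> J = B) * f C) = f C" for C
  proof -
    have "(\<Sum>B\<in>Pow J. of_bool (C \<inter> J = B) * f C) = (\<Sum>B\<in>Pow J. if B = C \<inter> J then f C else 0)"
      by (intro sum.cong) auto
    then show ?thesis using assms by simp
  qed
  then show ?thesis by (simp flip: bexp_sum)
qed

text \<open>A function that is close in \<open>L\<^sup>2\<close> to a junta and has mean at least \<open>\<eta>/2\<close> must be
  large almost everywhere on one of the subcubes on which that junta is constant.\<close>

lemma junta_obstruction:
  fixes u w g :: "'a set \<Rightarrow> real"
  assumes fin: "finite X" and q: "0 < q" "q < 1" and J: "J \<subseteq> X"
    and \<eta>: "0 < \<eta>" and l: "0 < l" "l \<le> 1/2"
    and w1: "\<And>C. C \<subseteq> X \<Longrightarrow> w C \<le> 1"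
    and mean: "\<eta> / 2 \<le> bexp q X w"
    and approx: "bexp q X (\<lambda>C. (w C - u (C \<inter> J))\<^sup>2) \<le> \<eta> ^ 3 * l / 1024"
    and g1: "\<And>C. C \<subseteq> X \<Longrightarrow> g C \<le> 1"
    and gw: "\<And>C. C \<subseteq> X \<Longrightarrow> l / 2 \<le> g C \<Longrightarrow> w C \<le> \<eta> / 16"
    and dense: "\<And>B. B \<subseteq> J \<Longrightarrow> l * bexp q X (\<lambda>C. of_bool (C \<inter> J = B)) \<le> bexp q X (\<lambda>C. of_bool (C \<inter> J = B) * g C)"
  shows False
proof -
  define E where "E B f = bexp q X (\<lambda>C. of_bool (C \<inter> J = B) * f C)" for B and f :: "'a set \<Rightarrow> real"
  have q': "0 \<le> q" "q \<le> 1" using q by auto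
  have finJ: "finite J" using fin J finite_subset by auto
  have E_add: "E B (\<lambda>C. f C + h C) = E B f + E B h" for B f h
    by (simp only: E_def distrib_left bexp_add)
  have E_cmult: "E B (\<lambda>C. k * f C) = k * E B f" for B f k
    unfolding E_def by (simp only: mult.left_commute[of _ k] bexp_cmult)
  have E_mono: "E B f \<le> E B h" if "\<And>C. C \<subseteq> X \<Longrightarrow> C \<inter> J = B \<Longrightarrow> f C \<le> h C" for B f h
    unfolding E_def using that by (intro bexp_mono q') auto
  have tot: "(\<Sum>B\<in>Pow J. E B f) = bexp q X f" for f
    unfolding E_def using bexp_fibres[OF finJ] by metis
  define m where "m B = E B (\<lambda>_. 1)" for B
  have E_const: "E B (\<lambda>_. k) = k * m B" for B k
    using E_cmult[of B k "\<lambda>_. 1"] by (simp add: m_def)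
  have mpos: "0 < m B" if B: "B \<subseteq> J" for B
  proof -
    have "0 < bweight q X B * (of_bool (B \<inter> J = B) * 1)" using B q by (simp add: bweight_pos Int_absorb2)
    also have "\<dots> \<le> m B"
      unfolding m_def E_def bexp_def using B J fin
      by (intro member_le_sum) (auto simp: bweight_nonneg[OF q'])
    finally show ?thesis .
  qed
  define e where "e C = (w C - u (C \<inter> J))\<^sup>2" for C
  \<comment> \<open>\<open>K\<close> turns the allowed total error into \<open>\<eta> / 4\<close>.
    Averaging \<open>E B w - K * E B e - \<eta> / 4 * m B\<close> over the fibres then gives at
    least 0, so a single fibre has both large mean and small error.\<close>
  define K where "K = 256 / (\<eta>\<^sup>2 * l)"
  have Kpos: "0 < K" using \<eta> l by (simp add: K_def)
  have "(\<Sum>B\<in>Pow J. E B w - K * E B e - \<eta> / 4 * m B) = bexp q X w - K * bexp q X e - \<eta> / 4"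
    unfolding sum_subtractf sum_distrib_left[symmetric] tot m_def using fin by (simp add: bexp_const)
  moreover have "K * bexp q X e \<le> \<eta> / 4"
  proof -
    have "K * bexp q X e \<le> K * (\<eta> ^ 3 * l / 1024)"
      using approx Kpos unfolding e_def by (intro mult_left_mono) auto
    then show ?thesis using \<eta> l by (simp add: K_def power2_eq_square power3_eq_cube)
  qed
  ultimately have "0 \<le> (\<Sum>B\<in>Pow J. E B w - K * E B e - \<eta> / 4 * m B)"
    using mean by linarith
  then have "\<exists>B\<in>Pow J. 0 \<le> E B w - K * E B e - \<eta> / 4 * m B"
    using finJ sum_strict_mono[of "Pow J" "\<lambda>B. E B w - K * E B e - \<eta> / 4 * m B" "\<lambda>_. 0"]
    by (auto simp: Pow_not_empty not_le[symmetric])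
  then obtain B where B: "B \<subseteq> J" and ineq: "K * E B e + \<eta> / 4 * m B \<le> E B w" by auto
  have e0: "0 \<le> e C" for C by (simp add: e_def)
  have Ee0: "0 \<le> E B e" using E_mono[of B "\<lambda>_. 0" e] e0 E_const[of B 0] by simp
  have "E B w \<le> m B" unfolding m_def using w1 by (intro E_mono)
  with ineq have "K * E B e \<le> m B" using mpos[OF B] \<eta> by (smt (verit) mult_nonneg_nonneg divide_nonneg_nonneg)
  then have eB: "E B e \<le> \<eta>\<^sup>2 * l / 256 * m B"
    using \<eta> l by (simp add: K_def field_simps)
  define c where "c = u B"
  \<comment> \<open>AM-GM linearises the square, so that the squared error bounds the mean of
    \<open>w\<close> on the fibre; this forces the junta value \<open>c\<close> there to be at least
    \<open>3 * \<eta> / 16\<close>.\<close>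
  have wc: "w C \<le> 8 / \<eta> * e C + (\<eta> / 32 + c)" if "C \<inter> J = B" for C
  proof -
    have "\<eta> / 8 * x \<le> x\<^sup>2 + \<eta>\<^sup>2 / 256" for x
      using zero_le_power2[of "x - \<eta> / 16"] by (simp add: power2_diff power_divide field_simps)
    from this[of "w C - c"]
    have "\<eta> / 8 * (w C - c) \<le> (w C - c)\<^sup>2 + \<eta>\<^sup>2 / 256" .
    then have "8 / \<eta> * (\<eta> / 8 * (w C - c)) \<le> 8 / \<eta> * ((w C - c)\<^sup>2 + \<eta>\<^sup>2 / 256)"
      using \<eta> by (intro mult_left_mono) auto
    moreover have "8 / \<eta> * (\<eta> / 8 * (w C - c)) = w C - c" using \<eta> by simp
    moreover have "8 / \<eta> * ((w C - c)\<^sup>2 + \<eta>\<^sup>2 / 256) = 8 / \<eta> * (w C - c)\<^sup>2 + \<eta> / 32"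
      using \<eta> by (simp add: distrib_left power2_eq_square)
    ultimately have "w C - c \<le> 8 / \<eta> * (w C - c)\<^sup>2 + \<eta> / 32" by linarith
    then show ?thesis using that by (simp add: e_def c_def)
  qed
  have "E B w \<le> E B (\<lambda>C. 8 / \<eta> * e C + (\<eta> / 32 + c))" using wc by (intro E_mono) auto
  also have "\<dots> = 8 / \<eta> * E B e + (\<eta> / 32 + c) * m B" by (simp only: E_add E_cmult E_const distrib_right)
  also have "8 / \<eta> * E B e \<le> 8 / \<eta> * (\<eta>\<^sup>2 * l / 256 * m B)"
    using eB \<eta> by (intro mult_left_mono) auto
  also have "\<dots> = \<eta> * l / 32 * m B" using \<eta> by (simp add: power2_eq_square)
  also have "\<dots> \<le> \<eta> / 32 * m B" using \<eta> l mpos[OF B] by (intro mult_right_mono) auto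
  finally have "E B w \<le> (\<eta> / 16 + c) * m B" by (simp add: algebra_simps)
  moreover have "\<eta> / 4 * m B \<le> E B w" using ineq Ee0 Kpos by (smt (verit) mult_nonneg_nonneg)
  ultimately have "\<eta> / 4 * m B \<le> (\<eta> / 16 + c) * m B" by linarith
  then have c: "3 * \<eta> / 16 \<le> c" using mpos[OF B] by simp
  \<comment> \<open>Since \<open>g \<le> 1\<close>, the set \<open>l / 2 \<le> g\<close> fills a
    fraction \<open>l / 2\<close> of the fibre. There \<open>w\<close> is at least
    \<open>\<eta> / 8\<close> below \<open>c\<close>, which gives error
    \<open>\<eta>\<^sup>2 * l / 128\<close> per unit of mass, twice what \<open>eB\<close>
    permits.\<close>
  define A where "A C = (of_bool (l / 2 \<le> g C) :: real)" for C
  have "l * m B \<le> E B g" using dense[OF B] by (simp add: m_def E_def)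
  also have "\<dots> \<le> E B (\<lambda>C. A C + l / 2)"
  proof (rule E_mono)
    fix C assume "C \<subseteq> X"
    from g1[OF this] l(1) show "g C \<le> A C + l / 2" by (auto simp: A_def of_bool_def)
  qed
  also have "\<dots> = E B A + l / 2 * m B" by (simp only: E_add E_const)
  finally have A: "l / 2 * m B \<le> E B A" by simp
  have "\<eta>\<^sup>2 / 64 * (l / 2 * m B) \<le> \<eta>\<^sup>2 / 64 * E B A" using A by (intro mult_left_mono) auto
  also have "\<dots> = E B (\<lambda>C. \<eta>\<^sup>2 / 64 * A C)" by (simp only: E_cmult)
  also have "\<dots> \<le> E B e"
  proof (rule E_mono)
    fix C assume C: "C \<subseteq> X" "C \<inter> J = B"
    show "\<eta>\<^sup>2 / 64 * A C \<le> e C"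
    proof (cases "l / 2 \<le> g C")
      case True
      then have "\<eta> / 8 \<le> c - w C" using gw[OF C(1)] c by simp
      then have "(\<eta> / 8)\<^sup>2 \<le> (c - w C)\<^sup>2" using \<eta> by (intro power_mono) auto
      then show ?thesis using True C(2) by (simp add: A_def e_def c_def power2_commute power_divide)
    qed (simp add: A_def e0)
  qed
  also note eB
  finally have "\<eta>\<^sup>2 * l * m B \<le> 0" by (simp add: algebra_simps)
  then show False using \<eta> l mpos[OF B] by (simp add: mult_le_0_iff)
qed

text \<open>The analytic core, for any superharmonic \<open>g\<close> with values in
  \<open>[0, 1]\<close>; families enter only later. The fibre condition ranges over all densities
  from \<open>a\<close> to \<open>b\<close> because the mean value theorem does not say which one it
  delivers.\<close>

lemma lower_tail:
  fixes l \<eta> :: real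
  assumes l: "0 < l" "l \<le> 1/2" and \<eta>: "0 < \<eta>"
  shows "\<exists>(r::nat) \<theta>. 0 < \<theta> \<and> \<theta> < 1 \<and> (\<forall>(X :: 'a set) g a b Q. finite X \<longrightarrow>
    (\<forall>C\<subseteq>X. 0 \<le> g C \<and> g C \<le> 1 \<and> (\<Sum>i\<in>C. g (C - {i})) \<le> real (card C) * g C) \<longrightarrow>
    l \<le> a \<longrightarrow> b \<le> 1 - l \<longrightarrow> a + l \<le> b \<longrightarrow> b \<le> Q \<longrightarrow> Q \<le> 1 \<longrightarrow>
    (\<forall>q J B. a \<le> q \<longrightarrow> q \<le> b \<longrightarrow> J \<subseteq> X \<longrightarrow> card J \<le> r \<longrightarrow> B \<subseteq> J \<longrightarrow>
      l * bexp q X (\<lambda>C. of_bool (C \<inter> J = B)) \<le> bexp q X (\<lambda>C. of_bool (C \<inter> J = B) * g C)) \<longrightarrow>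
    bexp Q X (\<lambda>C. of_bool (g C < \<theta>)) < \<eta>)"
proof -
  \<comment> \<open>\<zeta> is the error tolerated by \<open>junta_obstruction\<close>;
    \<open>\<kappa>\<close>, \<open>d\<close> and \<open>t\<close> each make one of the three terms
    in \<open>junta_approximation\<close> at most \<open>\<zeta> / 3\<close>. \<beta> bounds the
    summed probabilities of large jumps, \<rho> is admissible because \<open>q\<close> and
    \<open>1 - q\<close> are at least \<open>l\<close>, and at most
    \<open>\<beta> / t\<^sup>2\<close> coordinates have large-jump probability
    \<open>t\<^sup>2\<close> or more.\<close>
  define \<zeta> where "\<zeta> = \<eta> ^ 3 * l / 1024"
  have \<zeta>: "0 < \<zeta>" using \<eta> l by (simp add: \<zeta>_def)
  define \<kappa> where "\<kappa> = min 1 (\<zeta> * l / 48)"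
  have \<kappa>: "0 < \<kappa>" "\<kappa> \<le> 1" "\<kappa> \<le> \<zeta> * l / 48" using \<zeta> l by (auto simp: \<kappa>_def)
  define d where "d = nat \<lceil>72 / (l * \<zeta>)\<rceil>"
  define \<beta> where "\<beta> = 8 / (l * \<kappa>)"
  have \<beta>: "0 < \<beta>" using l \<kappa> by (simp add: \<beta>_def)
  define \<rho> where "\<rho> = l / 2"
  have \<rho>: "0 < \<rho>" using l by (simp add: \<rho>_def)
  define t where "t = \<zeta> * \<rho> ^ (2 * d) / (24 * \<beta>)"
  have t: "0 < t" using \<zeta> \<rho> \<beta> by (simp add: t_def)
  define r where "r = nat \<lceil>\<beta> / t\<^sup>2\<rceil>"
  \<comment> \<open>In order: a valid potential, \<open>1 \<le> L * \<kappa>\<close>, a loss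
    \<open>ln 2 / L\<close> of at most \<open>\<eta> / 2\<close> in the mean, and
    \<open>w \<le> \<eta> / 16\<close> wherever \<open>l / 2 \<le> g\<close>.\<close>
  define L where "L = max (max 1 (1 / \<kappa>)) (max (2 / \<eta>) (16 * ln (2 / l) / \<eta>))"
  have L: "1 \<le> L" "1 / \<kappa> \<le> L" "2 / \<eta> \<le> L" "16 * ln (2 / l) / \<eta> \<le> L"
    unfolding L_def by linarith+
  have L\<kappa>: "1 \<le> L * \<kappa>" using L(2) \<kappa> by (simp add: field_simps)
  have err: "24 / l / real (Suc d) + 2 * (8 * \<kappa> / l) + 2 * 2\<^sup>2 * sqrt (t\<^sup>2) * \<beta> / \<rho> ^ (2 * d) \<le> \<zeta>"
  proof -
    have "72 / (l * \<zeta>) \<le> real (Suc d)" unfolding d_def by linarith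
    then have "72 \<le> real (Suc d) * (l * \<zeta>)" using l \<zeta> by (simp add: divide_le_eq)
    then have "24 / l / real (Suc d) \<le> \<zeta> / 3"
      using l by (simp add: pos_divide_le_eq mult_ac del: of_nat_Suc)
    moreover have "2 * (8 * \<kappa> / l) \<le> \<zeta> / 3" using \<kappa>(3) l by (simp add: field_simps)
    moreover have "2 * 2\<^sup>2 * sqrt (t\<^sup>2) * \<beta> / \<rho> ^ (2 * d) \<le> \<zeta> / 3"
    proof -
      have "sqrt (t\<^sup>2) = t" using t by simp
      then show ?thesis using \<beta> \<rho> by (simp add: t_def)
    qed
    ultimately show ?thesis by linarith
  qed
  have main: "bexp Q X (\<lambda>C. of_bool (g C < exp (- L))) < \<eta>"
    if fin: "finite X"
      and g: "\<forall>C\<subseteq>X. 0 \<le> g C \<and> g C \<le> 1 \<and> (\<Sum>i\<in>C. g (C - {i})) \<le> real (card C) * g C"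
      and ab: "l \<le> a" "b \<le> 1 - l" "a + l \<le> b" "b \<le> Q" "Q \<le> 1"
      and R: "\<forall>q J B. a \<le> q \<longrightarrow> q \<le> b \<longrightarrow> J \<subseteq> X \<longrightarrow> card J \<le> r \<longrightarrow> B \<subseteq> J \<longrightarrow>
        l * bexp q X (\<lambda>C. of_bool (C \<inter> J = B)) \<le> bexp q X (\<lambda>C. of_bool (C \<inter> J = B) * g C)"
    for X :: "'a set" and g a b Q
  proof (rule ccontr)
    assume "\<not> ?thesis"
    then have large: "\<eta> \<le> bexp Q X (\<lambda>C. of_bool (g C < exp (- L)))" by simp
    have g01: "\<And>C. C \<subseteq> X \<Longrightarrow> 0 \<le> g C" "\<And>C. C \<subseteq> X \<Longrightarrow> g C \<le> 1"
      and super: "\<And>C. C \<subseteq> X \<Longrightarrow> (\<Sum>i\<in>C. g (C - {i})) \<le> real (card C) * g C"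
      using g by auto
    note lp = fin L(1) g01 super
    let ?w = "log_potential L g"
    let ?W = "\<lambda>q. bexp q X ?w"
    have w1: "?w C \<le> 1" if "C \<subseteq> X" for C
      by (rule log_potential_le_1[OF lp that])
    \<comment> \<open>The mean stays in \<open>[-1, 1]\<close> and the interval has length at least
      \<open>l\<close>, so at some interior density it falls at rate at most
      \<open>2 / l\<close>.\<close>
    have "\<exists>\<xi>. a < \<xi> \<and> \<xi> < b \<and> ?W b - ?W a = (b - a) * (\<Sum>i\<in>X. bexp \<xi> X (bdiff i ?w))"
      using ab l by (intro MVT2 bexp_has_real_derivative fin) auto
    then obtain q where q: "a < q" "q < b"
      and mvt: "?W b - ?W a = (b - a) * (\<Sum>i\<in>X. bexp q X (bdiff i ?w))" by blast
    have q01: "0 < q" "q < 1" "q \<le> 1" "l \<le> q" "l \<le> 1 - q" using q ab l by auto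
    define V where "V = - (\<Sum>i\<in>X. bexp q X (bdiff i ?w))"
    have V: "V \<le> 2 / l"
    proof -
      have "?W a \<le> bexp a X (\<lambda>_. 1)" using ab l w1 by (intro bexp_mono) auto
      then have Wa: "?W a \<le> 1" by (simp add: bexp_const fin)
      have "bexp b X (\<lambda>_. -1) \<le> ?W b"
      proof (rule bexp_mono)
        fix C assume "C \<subseteq> X"
        from log_potential_ge[OF lp this] ln_2_div_le_1[OF lp]
        show "-1 \<le> ?w C" by (auto simp: of_bool_def split: if_splits)
      qed (use ab l in auto)
      then have "-1 \<le> ?W b" by (simp add: bexp_const fin)
      with Wa mvt have "(b - a) * V \<le> 2" by (simp add: V_def)
      moreover have "l * V \<le> (b - a) * V" if "0 \<le> V" using that ab by (intro mult_right_mono) auto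
      ultimately have "l * V \<le> 2" by (cases "0 \<le> V") (use l in \<open>auto simp: mult_le_0_iff intro: order.trans[of _ 0]\<close>)
      then show ?thesis using l by (simp add: field_simps)
    qed
    define P where "P i C \<longleftrightarrow> \<kappa> < \<bar>bdiff i ?w C\<bar>" for i C
    note en = log_potential_energy[OF lp \<kappa>(1,2) L\<kappa> q01(1,3), folded V_def P_def]
    have en1: "(\<Sum>i\<in>X. bexp q X (\<lambda>C. (bdiff i ?w C)\<^sup>2 * of_bool (\<not> P i C))) \<le> 8 * \<kappa> / l"
    proof -
      have "4 * \<kappa> * V \<le> 4 * \<kappa> * (2 / l)" using V \<kappa> by (intro mult_left_mono) auto
      with en(1) show ?thesis by simp
    qed
    have en2: "(\<Sum>i\<in>X. bexp q X (\<lambda>C. of_bool (P i C))) \<le> \<beta>"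
    proof -
      have "4 / \<kappa> * V \<le> 4 / \<kappa> * (2 / l)" using V \<kappa> by (intro mult_left_mono) auto
      with en(2) show ?thesis by (simp add: \<beta>_def mult.commute)
    qed
    have en3: "(\<Sum>i\<in>X. bexp q X (\<lambda>C. (bdiff i ?w C)\<^sup>2)) \<le> 24 / l"
      using en(3) V by simp
    \<comment> \<open>Coordinates are selected by the probability of a large jump, not by their
      energy; only the former has the level gain.\<close>
    define J where "J = {i \<in> X. t\<^sup>2 \<le> bexp q X (\<lambda>C. of_bool (P i C))}"
    have J: "J \<subseteq> X" by (auto simp: J_def)
    have Jtau: "bexp q X (\<lambda>C. of_bool (P i C)) \<le> t\<^sup>2" if "i \<in> X - J" for i
      using that by (auto simp: J_def)
    have cardJ: "card J \<le> r"
    proof -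
      have "real (card J) * t\<^sup>2 = (\<Sum>i\<in>J. t\<^sup>2)" by simp
      also have "\<dots> \<le> (\<Sum>i\<in>J. bexp q X (\<lambda>C. of_bool (P i C)))"
        by (intro sum_mono) (auto simp: J_def)
      also have "\<dots> \<le> (\<Sum>i\<in>X. bexp q X (\<lambda>C. of_bool (P i C)))"
        using fin J q01 by (intro sum_mono2 bexp_nonneg) auto
      finally have "real (card J) * t\<^sup>2 \<le> \<beta>" using en2 by linarith
      then have "real (card J) \<le> \<beta> / t\<^sup>2" using t by (simp add: field_simps)
      then show ?thesis unfolding r_def by linarith
    qed
    have \<rho>q: "\<rho> \<le> sqrt (q * (1 - q)) / 2"
    proof -
      have "l * l \<le> q * (1 - q)" using q01 l by (intro mult_mono) auto
      then have "l \<le> sqrt (q * (1 - q))" using l by (intro real_le_rsqrt) (simp add: power2_eq_square)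
      then show ?thesis by (simp add: \<rho>_def)
    qed
    have "\<exists>u. bexp q X (\<lambda>C. (?w C - u (C \<inter> J))\<^sup>2)
        \<le> 24 / l / real (Suc d) + 2 * (8 * \<kappa> / l) + 2 * 2\<^sup>2 * sqrt (t\<^sup>2) * \<beta> / \<rho> ^ (2 * d)"
      by (rule junta_approximation[OF fin q01(1,2) \<rho> \<rho>q bdiff_log_potential_le[OF lp] en1 en2 en3 _ _ J Jtau]) auto
    then obtain u where u: "bexp q X (\<lambda>C. (?w C - u (C \<inter> J))\<^sup>2) \<le> \<zeta>" using err by (meson order.trans)
    have mean: "\<eta> / 2 \<le> ?W q"
    proof -
      have "\<eta> - ln 2 / L \<le> bexp Q X (\<lambda>C. of_bool (g C < exp (- L)) - ln 2 / L)"
        unfolding bexp_diff using large fin by (simp add: bexp_const)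
      also have "\<dots> \<le> ?W Q"
        using ab l q by (intro bexp_mono log_potential_ge[OF lp]) auto
      also have "\<dots> \<le> ?W q"
        using ab l q by (intro bexp_log_potential_antimono[OF lp]) auto
      finally have "\<eta> - ln 2 / L \<le> ?W q" .
      moreover have "ln 2 / L \<le> \<eta> / 2"
      proof -
        have "ln 2 \<le> (1 :: real)" using ln_2_less_1 by simp
        moreover have "1 \<le> L * \<eta> / 2" using L(3) \<eta> by (simp add: field_simps)
        ultimately show ?thesis using L(1) by (simp add: field_simps)
      qed
      ultimately show ?thesis by linarith
    qed
    show False
    proof (rule junta_obstruction[OF fin q01(1,2) J \<eta> l w1 mean u[unfolded \<zeta>_def] g01(2)])
      fix C assume C: "C \<subseteq> X" "l / 2 \<le> g C"
      have "ln (l / 2) \<le> ln (g C + exp (- L))"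
        using C l by (subst ln_le_cancel_iff) (auto intro: add_pos_pos add_increasing2)
      moreover have "ln (l / 2) = - ln (2 / l)" using l by (simp add: ln_div)
      ultimately have "- ln (g C + exp (- L)) \<le> ln (2 / l)" by simp
      also have "\<dots> \<le> \<eta> / 16 * L" using L(4) \<eta> by (simp add: field_simps)
      finally show "?w C \<le> \<eta> / 16" using L(1) by (simp only: log_potential_def pos_divide_le_eq)
    next
      fix B assume "B \<subseteq> J"
      then show "l * bexp q X (\<lambda>C. of_bool (C \<inter> J = B)) \<le> bexp q X (\<lambda>C. of_bool (C \<inter> J = B) * g C)"
        using R q J cardJ by auto
    qed
  qed
  show ?thesis
    using main L(1) by (intro exI[of _ r] exI[of _ "exp (- L)"]) auto
qed

section \<open>Densities of a family inside random sets\<close>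

lemma sum_of_bool_card: "finite A \<Longrightarrow> (\<Sum>x\<in>A. of_bool (P x)) = real (card {x \<in> A. P x})"
  by (simp add: sum_of_bool_eq Int_def)

lemma bexp_card:
  fixes q :: real
  assumes "finite X"
  shows "bexp q X (\<lambda>C. real (card C)) = q * card X"
    and "bexp q X (\<lambda>C. (real (card C))\<^sup>2) = card X * (q * (1 - q)) + (q * card X)\<^sup>2"
proof -
  have "bexp q X (\<lambda>C. real (card C)) = q * card X \<and>
    bexp q X (\<lambda>C. (real (card C))\<^sup>2) = card X * (q * (1 - q)) + (q * card X)\<^sup>2"
    using assms
  proof (induction X rule: finite_induct)
    case (insert i X)
    have c: "real (card (insert i C)) = 1 + real (card C)" if "C \<subseteq> X" for C
      using that insert.hyps by (subst card_insert_disjoint) (auto intro: finite_subset)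
    have "bexp q (insert i X) (\<lambda>C. real (card C)) = bexp q X (\<lambda>C. q + real (card C))"
      unfolding bexp_insert[OF insert.hyps] by (intro bexp_cong) (simp add: c algebra_simps)
    moreover have "bexp q (insert i X) (\<lambda>C. (real (card C))\<^sup>2)
        = bexp q X (\<lambda>C. q + 2 * q * real (card C) + (real (card C))\<^sup>2)"
      unfolding bexp_insert[OF insert.hyps]
      by (intro bexp_cong) (simp add: c power2_eq_square algebra_simps)
    moreover have "bexp q X (\<lambda>C. q + real (card C)) = q + bexp q X (\<lambda>C. real (card C))"
      using insert.hyps by (simp only: bexp_add bexp_const)
    moreover have "bexp q X (\<lambda>C. q + 2 * q * real (card C) + (real (card C))\<^sup>2)
       = q + 2 * q * bexp q X (\<lambda>C. real (card C)) + bexp q X (\<lambda>C. (real (card C))\<^sup>2)"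
      using insert.hyps by (simp only: bexp_add bexp_cmult bexp_const)
    ultimately show ?case using insert
      by (simp add: power2_eq_square algebra_simps)
  qed simp
  then show "bexp q X (\<lambda>C. real (card C)) = q * card X"
    and "bexp q X (\<lambda>C. (real (card C))\<^sup>2) = card X * (q * (1 - q)) + (q * card X)\<^sup>2" by auto
qed

text \<open>Chebyshev's inequality, with the binomial variance bounded by
  \<open>card X\<close>.\<close>

lemma bexp_card_ge:
  fixes q s t :: real
  assumes "finite X" and q: "0 \<le> q" "q \<le> 1" and t: "0 < t" and s: "s \<le> q * card X - t"
  shows "1 - card X / t\<^sup>2 \<le> bexp q X (\<lambda>C. of_bool (s \<le> real (card C)))"
proof -
  let ?m = "q * card X"
  have "bexp q X (\<lambda>C. (real (card C) - ?m)\<^sup>2)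
      = bexp q X (\<lambda>C. (real (card C))\<^sup>2 - 2 * ?m * real (card C) + ?m\<^sup>2)"
    by (intro bexp_cong) (simp add: power2_diff algebra_simps)
  also have "\<dots> = card X * (q * (1 - q))"
    unfolding bexp_add bexp_diff bexp_cmult bexp_const[OF assms(1)] bexp_card[OF assms(1)]
    by (simp add: power2_eq_square)
  also have "\<dots> \<le> real (card X) * 1"
    using q by (intro mult_left_mono) (auto simp: mult_le_one)
  finally have v: "bexp q X (\<lambda>C. (real (card C) - ?m)\<^sup>2) \<le> card X" by simp
  have "1 - card X / t\<^sup>2 \<le> bexp q X (\<lambda>C. 1 - (real (card C) - ?m)\<^sup>2 / t\<^sup>2)"
    using v t unfolding bexp_diff bexp_const[OF assms(1)]
    using bexp_cmult[of q X "1 / t\<^sup>2" "\<lambda>C. (real (card C) - ?m)\<^sup>2"]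
    by (simp add: divide_right_mono)
  also have "\<dots> \<le> bexp q X (\<lambda>C. of_bool (s \<le> real (card C)))"
  proof (rule bexp_mono[OF q])
    fix C
    show "1 - (real (card C) - ?m)\<^sup>2 / t\<^sup>2 \<le> of_bool (s \<le> real (card C))"
    proof (cases "s \<le> real (card C)")
      case False
      then have "t \<le> ?m - real (card C)" using s by linarith
      then have "t\<^sup>2 \<le> (?m - real (card C))\<^sup>2" using t by (intro power_mono) auto
      then show ?thesis using t False by (simp add: power2_commute field_simps)
    qed (use t in auto)
  qed
  finally show ?thesis .
qed

text \<open>The traces on \<open>J\<close> and on \<open>X - J\<close> are independent: given
  \<open>C \<inter> J = B\<close>, the rest of \<open>C\<close> is a random subset of
  \<open>X - J\<close> of the same density.\<close>

lemma bexp_restrict: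
  assumes "finite X" "J \<subseteq> X" "B \<subseteq> J"
  shows "bexp q X (\<lambda>C. of_bool (C \<inter> J = B) * f C) = bweight q J B * bexp q (X - J) (\<lambda>D. f (B \<union> D))"
proof -
  have fin: "finite J" "finite B"
    using finite_subset[OF assms(2,1)] finite_subset[OF assms(3)] by auto
  have w: "bweight q X (B \<union> D) = bweight q J B * bweight q (X - J) D" if D: "D \<subseteq> X - J" for D
  proof -
    have finD: "finite D" using D assms(1) finite_subset by blast
    have "card (B \<union> D) = card B + card D" using D assms fin finD by (intro card_Un_disjoint) auto
    moreover have "X - (B \<union> D) = (J - B) \<union> (X - J - D)" using D assms by auto
    then have "card (X - (B \<union> D)) = card (J - B) + card (X - J - D)"
      using D assms fin by (simp only:) (intro card_Un_disjoint, auto)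
    ultimately show ?thesis by (simp add: bweight_def power_add)
  qed
  have inj: "inj_on (\<lambda>D. B \<union> D) (Pow (X - J))"
    using assms(3) by (intro inj_onI) blast
  have img: "(\<lambda>D. B \<union> D) ` Pow (X - J) = {C \<in> Pow X. C \<inter> J = B}"
  proof (intro equalityI subsetI)
    fix C assume "C \<in> {C \<in> Pow X. C \<inter> J = B}"
    then have "C = B \<union> (C - J)" "C - J \<in> Pow (X - J)" by auto
    then show "C \<in> (\<lambda>D. B \<union> D) ` Pow (X - J)" by blast
  qed (use assms in auto)
  have "bexp q X (\<lambda>C. of_bool (C \<inter> J = B) * f C) = (\<Sum>C | C \<in> Pow X \<and> C \<inter> J = B. bweight q X C * f C)"
    unfolding bexp_def using assms(1) by (intro sum.mono_neutral_cong_right) auto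
  also have "\<dots> = (\<Sum>D\<in>Pow (X - J). bweight q X (B \<union> D) * f (B \<union> D))"
    unfolding img[symmetric] by (simp add: sum.reindex[OF inj])
  also have "\<dots> = bweight q J B * bexp q (X - J) (\<lambda>D. f (B \<union> D))"
    unfolding bexp_def sum_distrib_left by (intro sum.cong) (auto simp: w)
  finally show ?thesis .
qed

text \<open>The biased measure is a mixture of the uniform measures on layers, so layer sums can be
  compared one by one.\<close>

lemma bexp_mono_levels:
  assumes "finite X" "0 \<le> q" "q \<le> 1" and le: "\<And>s. s \<le> card X \<Longrightarrow> (\<Sum>C\<in>nsets X s. f C) \<le> (\<Sum>C\<in>nsets X s. g C)"
  shows "bexp q X f \<le> bexp q X g"
proof -
  have lev: "bexp q X h = (\<Sum>s\<le>card X. q ^ s * (1 - q) ^ (card X - s) * (\<Sum>C\<in>nsets X s. h C))" for h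
  proof -
    have "bexp q X h = (\<Sum>s\<le>card X. \<Sum>C | C \<in> Pow X \<and> card C = s. bweight q X C * h C)"
      unfolding bexp_def using assms(1) by (intro sum.group[symmetric]) (auto intro: card_mono)
    also have "\<dots> = (\<Sum>s\<le>card X. \<Sum>C\<in>nsets X s. q ^ s * (1 - q) ^ (card X - s) * h C)"
    proof (intro sum.cong refl)
      fix s
      show "{C \<in> Pow X. card C = s} = nsets X s"
        using assms(1) finite_subset by (auto simp: nsets_def)
    next
      fix s C assume "C \<in> nsets X s"
      then have "C \<subseteq> X" "finite C" "card C = s" by (auto simp: nsets_def)
      then show "bweight q X C * h C = q ^ s * (1 - q) ^ (card X - s) * h C"
        by (simp add: bweight_def card_Diff_subset)
    qed
    finally show ?thesis by (simp only: sum_distrib_left)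
  qed
  show ?thesis unfolding lev using assms by (intro sum_mono mult_left_mono le) auto
qed

section \<open>Layer averages of the containment density and its restrictions\<close>

lemma card_nsets_member:
  assumes "finite X" "x \<in> X"
  shows "card X * card {A \<in> nsets X k. x \<in> A} = k * (card X choose k)"
proof -
  have "{A \<in> nsets X k. x \<in> A} = nsets X k - nsets (X - {x}) k" by (auto simp: nsets_def)
  moreover have "nsets (X - {x}) k \<subseteq> nsets X k" by (intro nsets_mono) auto
  ultimately have "card {A \<in> nsets X k. x \<in> A} = (card X choose k) - ((card X - 1) choose k)"
    using assms by (simp add: card_Diff_subset finite_imp_finite_nsets)
  then have "card X * card {A \<in> nsets X k. x \<in> A} = card X * (card X choose k) - (card X - k) * (card X choose k)"
    by (simp only: diff_mult_distrib2 binomial_absorb_comp)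
  also have "\<dots> = k * (card X choose k)"
    by (cases "k \<le> card X") (auto simp: binomial_eq_0 simp flip: diff_mult_distrib)
  finally show ?thesis .
qed

text \<open>Union bound over \<open>J\<close>, written without division. It is the source of the
  free lower bound for small \<open>k\<close>: most \<open>k\<close>-sets then avoid
  \<open>J\<close>.\<close>

lemma card_nsets_meeting:
  assumes "finite X" "J \<subseteq> X"
  shows "card X * card {A \<in> nsets X k. A \<inter> J \<noteq> {}} \<le> card J * k * (card X choose k)"
proof -
  have "finite J" using assms finite_subset by auto
  have "{A \<in> nsets X k. A \<inter> J \<noteq> {}} = (\<Union>x\<in>J. {A \<in> nsets X k. x \<in> A})" by auto
  then have "card {A \<in> nsets X k. A \<inter> J \<noteq> {}} \<le> (\<Sum>x\<in>J. card {A \<in> nsets X k. x \<in> A})"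
    using \<open>finite J\<close> by (simp add: card_UN_le)
  then have "card X * card {A \<in> nsets X k. A \<inter> J \<noteq> {}} \<le> card X * (\<Sum>x\<in>J. card {A \<in> nsets X k. x \<in> A})"
    by (rule mult_left_mono) simp
  also have "\<dots> = (\<Sum>x\<in>J. k * (card X choose k))"
    unfolding sum_distrib_left using assms by (intro sum.cong refl card_nsets_member) auto
  finally show ?thesis by simp
qed

text \<open>The density \<open>g(C)\<close> of the overview. For \<open>card C < k\<close> it is 0
  by the convention for division by zero, which is the value superharmonicity requires.\<close>

definition containment :: "'a set set \<Rightarrow> nat \<Rightarrow> 'a set \<Rightarrow> real" where
  "containment \<F> k C = unif_measure C k {A \<in> \<F>. A \<subseteq> C}"

lemma nsets_subset: "\<F> \<subseteq> nsets X k \<Longrightarrow> {A \<in> \<F>. A \<subseteq> C} \<subseteq> nsets C k"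
  by (auto simp: nsets_def)

lemma containment_bounds:
  assumes "\<F> \<subseteq> nsets X k" "finite C"
  shows "0 \<le> containment \<F> k C" "containment \<F> k C \<le> 1"
proof -
  have "card {A \<in> \<F>. A \<subseteq> C} \<le> card (nsets C k)"
    using assms by (intro card_mono nsets_subset finite_imp_finite_nsets) auto
  then show "0 \<le> containment \<F> k C" "containment \<F> k C \<le> 1"
    by (auto simp: containment_def unif_measure_def divide_le_eq)
qed

text \<open>Each \<open>A\<close> survives the deletion of exactly \<open>card C - k\<close> points,
  which gives equality as long as \<open>k < card C\<close>. For \<open>card C \<le> k\<close> the
  left side is 0 by the default value, and only an inequality remains.\<close>

lemma containment_superharmonic:
  assumes F: "\<F> \<subseteq> nsets X k" and C: "finite C"
  shows "(\<Sum>i\<in>C. containment \<F> k (C - {i})) \<le> real (card C) * containment \<F> k C"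
proof (cases "k < card C")
  case False
  then have "containment \<F> k (C - {i}) = 0" if "i \<in> C" for i
  proof -
    have "card (C - {i}) < k" using False that C card_gt_0_iff[of C] by auto
    then show ?thesis by (simp add: containment_def unif_measure_def binomial_eq_0)
  qed
  then show ?thesis using containment_bounds(1)[OF F C] by simp
next
  case True
  let ?N = "{A \<in> \<F>. A \<subseteq> C}"
  let ?b = "(card C - 1) choose k"
  have finN: "finite ?N" using finite_subset[OF nsets_subset[OF F] finite_imp_finite_nsets[OF C]] .
  have bpos: "0 < ?b" using True by simp
  have card: "card A = k" "finite A" if "A \<in> ?N" for A using that F by (auto simp: nsets_def)
  have "(\<Sum>i\<in>C. real (card {A \<in> \<F>. A \<subseteq> C - {i}})) = (\<Sum>i\<in>C. \<Sum>A\<in>?N. of_bool (i \<notin> A))"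
  proof (rule sum.cong[OF refl])
    fix i
    have "{A \<in> \<F>. A \<subseteq> C - {i}} = {A \<in> ?N. i \<notin> A}" by auto
    then show "real (card {A \<in> \<F>. A \<subseteq> C - {i}}) = (\<Sum>A\<in>?N. of_bool (i \<notin> A))"
      using finN by (simp only: sum_of_bool_card)
  qed
  also have "\<dots> = (\<Sum>A\<in>?N. \<Sum>i\<in>C. of_bool (i \<notin> A))" by (rule sum.swap)
  also have "\<dots> = (\<Sum>A\<in>?N. real (card C - k))"
  proof (rule sum.cong[OF refl])
    fix A assume A: "A \<in> ?N"
    have "(\<Sum>i\<in>C. of_bool (i \<notin> A)) = real (card (C - A))"
      using C by (simp add: of_bool_def sum.If_cases Diff_eq Compl_eq)
    then show "(\<Sum>i\<in>C. of_bool (i \<notin> A)) = real (card C - k)"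
      using A card[OF A] by (simp add: card_Diff_subset)
  qed
  finally have sum: "(\<Sum>i\<in>C. containment \<F> k (C - {i})) = real (card ?N) * (real (card C - k) / real ?b)"
    using C by (simp add: containment_def unif_measure_def flip: sum_divide_distrib)
  have "real (card C - k) / real ?b = real (card C) / real (card C choose k)"
  proof -
    have "real (card C - k) * real (card C choose k) = real (card C) * real ?b"
      using binomial_absorb_comp[of "card C" k] by (metis of_nat_mult)
    moreover have "0 < card C choose k" using True by simp
    ultimately show ?thesis using bpos by (simp add: field_simps)
  qed
  then have "real (card ?N) * (real (card C - k) / real ?b) = real (card C) * containment \<F> k C"
    by (simp add: containment_def unif_measure_def mult.commute)
  with sum show ?thesis by simp
qed

text \<open>Sorts the members inside \<open>B \<union> D\<close> by their trace \<open>B'\<close> on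
  \<open>J\<close>, which lies in \<open>B\<close> because \<open>D\<close> avoids
  \<open>J\<close>.\<close>

lemma card_subsets_Un:
  assumes F: "\<F> \<subseteq> nsets X k" and "finite X" "J \<subseteq> X" "B \<subseteq> J" "D \<subseteq> X - J"
  shows "card {A \<in> \<F>. A \<subseteq> B \<union> D} = (\<Sum>B'\<in>Pow B. card {A \<in> restriction X \<F> J B'. A \<subseteq> D})"
proof -
  let ?N = "{A \<in> \<F>. A \<subseteq> B \<union> D}"
  have "finite \<F>" using F assms(2) finite_imp_finite_nsets finite_subset by blast
  then have "card ?N = (\<Sum>B'\<in>Pow B. card {A \<in> ?N. A \<inter> J = B'})"
  proof -
    have "finite B" using assms(2-4) by (meson finite_subset)
    moreover have "(\<lambda>A. A \<inter> J) ` ?N \<subseteq> Pow B" using assms by auto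
    ultimately have "(\<Sum>B'\<in>Pow B. \<Sum>A | A \<in> ?N \<and> A \<inter> J = B'. 1) = (\<Sum>A\<in>?N. (1 :: nat))"
      using \<open>finite \<F>\<close> by (intro sum.group) auto
    then show ?thesis by simp
  qed
  also have "\<dots> = (\<Sum>B'\<in>Pow B. card {A \<in> restriction X \<F> J B'. A \<subseteq> D})"
  proof (rule sum.cong[OF refl])
    fix B' assume B': "B' \<in> Pow B"
    have "bij_betw (\<lambda>A. A \<union> B') {A \<in> restriction X \<F> J B'. A \<subseteq> D} {A \<in> ?N. A \<inter> J = B'}"
    proof (intro bij_betw_byWitness[where f' = "\<lambda>A. A - B'"] ballI image_subsetI)
      fix A assume "A \<in> {A \<in> restriction X \<F> J B'. A \<subseteq> D}"
      then have A: "A \<subseteq> X - J" "A \<union> B' \<in> \<F>" "A \<subseteq> D" by (auto simp: restriction_def)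
      have "B' \<subseteq> J" using B' assms(4) by auto
      then show "A \<union> B' - B' = A" using A(1) by blast
      have "(A \<union> B') \<inter> J = B'" using \<open>B' \<subseteq> J\<close> A(1) by blast
      moreover have "A \<union> B' \<subseteq> B \<union> D" using A(3) B' by blast
      ultimately show "A \<union> B' \<in> {A \<in> ?N. A \<inter> J = B'}" using A(2) by blast
    next
      fix A assume "A \<in> {A \<in> ?N. A \<inter> J = B'}"
      then have A: "A \<in> \<F>" "A \<subseteq> B \<union> D" "A \<inter> J = B'" by auto
      then show "A - B' \<union> B' = A" by blast
      then have "A - B' \<union> B' \<in> \<F>" using A(1) by simp
      moreover have "A - B' \<subseteq> D" using A(2,3) assms(4) by blast
      moreover have "A - B' \<subseteq> X - J" using \<open>A - B' \<subseteq> D\<close> assms(5) by blast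
      ultimately show "A - B' \<in> {A \<in> restriction X \<F> J B'. A \<subseteq> D}" by (simp add: restriction_def)
    qed
    then show "card {A \<in> ?N. A \<inter> J = B'} = card {A \<in> restriction X \<F> J B'. A \<subseteq> D}"
      by (rule bij_betw_same_card[symmetric])
  qed
  finally show ?thesis .
qed

lemma card_nsets_superset:
  assumes "finite Y" "A \<subseteq> Y" "card A \<le> s"
  shows "card {D \<in> nsets Y s. A \<subseteq> D} = (card Y - card A) choose (s - card A)"
proof -
  have finA: "finite A" using assms finite_subset by auto
  have "bij_betw (\<lambda>D. D - A) {D \<in> nsets Y s. A \<subseteq> D} (nsets (Y - A) (s - card A))"
  proof (intro bij_betw_byWitness[where f' = "\<lambda>D. D \<union> A"])
    show "(\<lambda>D. D \<union> A) ` nsets (Y - A) (s - card A) \<subseteq> {D \<in> nsets Y s. A \<subseteq> D}"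
    proof (intro image_subsetI)
      fix D assume D: "D \<in> nsets (Y - A) (s - card A)"
      then have "card (D \<union> A) = card D + card A"
        using finA by (intro card_Un_disjoint) (auto simp: nsets_def)
      then show "D \<union> A \<in> {D \<in> nsets Y s. A \<subseteq> D}" using D assms finA by (auto simp: nsets_def)
    qed
  qed (use finA in \<open>auto simp: nsets_def card_Diff_subset\<close>)
  then show ?thesis using assms finA by (simp add: bij_betw_same_card card_Diff_subset)
qed

text \<open>Double counting of the pairs \<open>A \<subseteq> D\<close>, followed by the
  subset-of-a-subset identity \<open>choose_mult\<close>.\<close>

lemma sum_card_restriction:
  assumes R: "\<And>A. A \<in> R \<Longrightarrow> A \<subseteq> Y \<and> card A = j" and "finite Y" and s: "s \<le> card Y"
  shows "(\<Sum>D\<in>nsets Y s. real (card {A \<in> R. A \<subseteq> D}))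
    = unif_measure Y j R * real (card Y choose s) * real (s choose j)"
proof -
  have finR: "finite R" using assms(2) R by (intro finite_subset[of R "Pow Y"]) auto
  have finN: "finite (nsets Y s)" using assms(2) by (rule finite_imp_finite_nsets)
  have "(\<Sum>D\<in>nsets Y s. real (card {A \<in> R. A \<subseteq> D})) = (\<Sum>D\<in>nsets Y s. \<Sum>A\<in>R. of_bool (A \<subseteq> D))"
    using finR by (simp only: sum_of_bool_card)
  also have "\<dots> = (\<Sum>A\<in>R. \<Sum>D\<in>nsets Y s. of_bool (A \<subseteq> D))" by (rule sum.swap)
  also have "\<dots> = (\<Sum>A\<in>R. real (card {D \<in> nsets Y s. A \<subseteq> D}))"
    using finN by (simp only: sum_of_bool_card)
  also have "\<dots> = unif_measure Y j R * real (card Y choose s) * real (s choose j)"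
  proof (cases "j \<le> s")
    case True
    have "(\<Sum>A\<in>R. real (card {D \<in> nsets Y s. A \<subseteq> D})) = (\<Sum>A\<in>R. real ((card Y - j) choose (s - j)))"
      using True R assms(2) by (intro sum.cong refl) (auto simp: card_nsets_superset)
    also have "\<dots> = real (card R) * real ((card Y - j) choose (s - j))" by simp
    also have "\<dots> = unif_measure Y j R * (real (card Y choose j) * real ((card Y - j) choose (s - j)))"
      using True s by (simp add: unif_measure_def)
    also have "real (card Y choose j) * real ((card Y - j) choose (s - j)) = real (card Y choose s) * real (s choose j)"
      using choose_mult[OF True s] by (metis of_nat_mult)
    finally show ?thesis by simp
  next
    case False
    have "{D \<in> nsets Y s. A \<subseteq> D} = {}" if "A \<in> R" for A
    proof -
      have "\<not> A \<subseteq> D" if "D \<in> nsets Y s" for D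
        using R[OF \<open>A \<in> R\<close>] that False card_mono[of D A] by (auto simp: nsets_def)
      then show ?thesis by auto
    qed
    then have "(\<Sum>A\<in>R. real (card {D \<in> nsets Y s. A \<subseteq> D})) = (\<Sum>A\<in>R. 0)"
      by (intro sum.cong refl) (simp only: card.empty of_nat_0)
    then show ?thesis using False by (simp add: binomial_eq_0)
  qed
  finally show ?thesis .
qed

text \<open>On one layer the mean of the containment density is a hypergeometric mixture of the
  measures of the restrictions. Traces with \<open>card B' > k\<close> are left out: they carry no
  sets, and truncated subtraction would give them a spurious weight.\<close>

lemma sum_containment:
  assumes F: "\<F> \<subseteq> nsets X k" and fin: "finite X" and JB: "J \<subseteq> X" "B \<subseteq> J" and s: "s \<le> card (X - J)"
  shows "(\<Sum>D\<in>nsets (X - J) s. containment \<F> k (B \<union> D))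
    = (\<Sum>B' | B' \<subseteq> B \<and> card B' \<le> k. unif_measure (X - J) (k - card B') (restriction X \<F> J B') * real (s choose (k - card B')))
      * real (card (X - J) choose s) / real (s + card B choose k)"
proof -
  let ?Y = "X - J"
  have finB: "finite B" "finite J" using JB fin by (meson finite_subset)+
  have R: "A \<subseteq> ?Y \<and> card A = k - card B'" "card B' \<le> k" if "A \<in> restriction X \<F> J B'" "B' \<subseteq> B" for A B'
  proof -
    have A: "A \<subseteq> ?Y" "A \<union> B' \<in> \<F>" using that by (auto simp: restriction_def)
    then have "card (A \<union> B') = k" using F by (auto simp: nsets_def)
    moreover have "card (A \<union> B') = card A + card B'"
      using A that JB fin finB by (intro card_Un_disjoint) (auto intro: finite_subset)
    ultimately show "A \<subseteq> ?Y \<and> card A = k - card B'" "card B' \<le> k" using A by auto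
  qed
  have "(\<Sum>D\<in>nsets ?Y s. containment \<F> k (B \<union> D))
     = (\<Sum>D\<in>nsets ?Y s. (\<Sum>B'\<in>Pow B. real (card {A \<in> restriction X \<F> J B'. A \<subseteq> D})) / real (s + card B choose k))"
  proof (rule sum.cong[OF refl])
    fix D assume D: "D \<in> nsets ?Y s"
    then have "card (B \<union> D) = card B + card D"
      using finB JB by (intro card_Un_disjoint) (auto simp: nsets_def)
    then have "card (B \<union> D) = s + card B" using D by (simp add: nsets_def)
    moreover have "D \<subseteq> ?Y" using D by (simp add: nsets_def)
    ultimately show "containment \<F> k (B \<union> D) = (\<Sum>B'\<in>Pow B. real (card {A \<in> restriction X \<F> J B'. A \<subseteq> D})) / real (s + card B choose k)"
      by (simp add: containment_def unif_measure_def card_subsets_Un[OF F fin JB])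
  qed
  also have "\<dots> = (\<Sum>B'\<in>Pow B. \<Sum>D\<in>nsets ?Y s. real (card {A \<in> restriction X \<F> J B'. A \<subseteq> D})) / real (s + card B choose k)"
    unfolding sum_divide_distrib[symmetric] by (subst sum.swap) simp
  also have "(\<Sum>B'\<in>Pow B. \<Sum>D\<in>nsets ?Y s. real (card {A \<in> restriction X \<F> J B'. A \<subseteq> D}))
     = (\<Sum>B' | B' \<subseteq> B \<and> card B' \<le> k. \<Sum>D\<in>nsets ?Y s. real (card {A \<in> restriction X \<F> J B'. A \<subseteq> D}))"
  proof (rule sum.mono_neutral_right)
    show "\<forall>B'\<in>Pow B - {B'. B' \<subseteq> B \<and> card B' \<le> k}. (\<Sum>D\<in>nsets ?Y s. real (card {A \<in> restriction X \<F> J B'. A \<subseteq> D})) = 0"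
    proof
      fix B' assume "B' \<in> Pow B - {B'. B' \<subseteq> B \<and> card B' \<le> k}"
      then have "restriction X \<F> J B' = {}" using R(2) by blast
      then show "(\<Sum>D\<in>nsets ?Y s. real (card {A \<in> restriction X \<F> J B'. A \<subseteq> D})) = 0" by simp
    qed
  qed (use finB in auto)
  also have "\<dots> = (\<Sum>B' | B' \<subseteq> B \<and> card B' \<le> k. unif_measure ?Y (k - card B') (restriction X \<F> J B') * real (card ?Y choose s) * real (s choose (k - card B')))"
    using R fin s by (intro sum.cong refl sum_card_restriction) auto
  finally show ?thesis by (simp add: sum_distrib_left sum_distrib_right mult_ac)
qed

text \<open>Vandermonde's identity with the traces listed individually; it says that the mixture
  weights in \<open>sum_containment\<close> add up to 1.\<close>

lemma vandermonde_subsets: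
  assumes "finite B"
  shows "(\<Sum>B' | B' \<subseteq> B \<and> card B' \<le> k. s choose (k - card B')) = (s + card B) choose k"
proof -
  have "(\<Sum>B' | B' \<subseteq> B \<and> card B' \<le> k. s choose (k - card B'))
      = (\<Sum>j\<le>k. \<Sum>B' | B' \<in> {B'. B' \<subseteq> B \<and> card B' \<le> k} \<and> card B' = j. s choose (k - card B'))"
    using assms by (intro sum.group[symmetric]) auto
  also have "\<dots> = (\<Sum>j\<le>k. \<Sum>B' | B' \<subseteq> B \<and> card B' = j. s choose (k - j))"
    by (intro sum.cong) auto
  also have "\<dots> = (\<Sum>j\<le>k. (card B choose j) * (s choose (k - j)))"
    using assms by (simp add: n_subsets)
  finally show ?thesis by (simp add: vandermonde add.commute)
qed

text \<open>Under the assumption at most half of the \<open>k\<close>-subsets of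
  \<open>s + b\<close> points meet the first \<open>b\<close> points, by
  \<open>card_nsets_meeting\<close>.\<close>

lemma choose_add_le:
  assumes "2 * b * k \<le> s + b" "0 < s"
  shows "(s + b) choose k \<le> 2 * (s choose k)"
proof -
  let ?X = "{..<s + b}" and ?J = "{..<b}"
  have "{A \<in> nsets ?X k. A \<inter> ?J \<noteq> {}} = nsets ?X k - nsets (?X - ?J) k"
    unfolding nsets_def by blast
  moreover have "nsets (?X - ?J) k \<subseteq> nsets ?X k" by (intro nsets_mono) auto
  moreover have "card (?X - ?J) = s" by (subst card_Diff_subset) auto
  ultimately have c: "card {A \<in> nsets ?X k. A \<inter> ?J \<noteq> {}} = (s + b choose k) - (s choose k)"
    by (simp add: card_Diff_subset finite_imp_finite_nsets)
  have "2 * ((s + b) * ((s + b choose k) - (s choose k))) \<le> 2 * (b * k * (s + b choose k))"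
    using card_nsets_meeting[of ?X ?J k] unfolding c by simp
  also have "\<dots> = (2 * b * k) * (s + b choose k)" by simp
  also have "\<dots> \<le> (s + b) * (s + b choose k)" using assms(1) by (rule mult_right_mono) simp
  finally have "(s + b) * (2 * ((s + b choose k) - (s choose k))) \<le> (s + b) * (s + b choose k)"
    by (simp add: mult.left_commute)
  then have "2 * ((s + b choose k) - (s choose k)) \<le> (s + b choose k)"
    using assms(2) by (simp only: mult_le_cancel1)
  then show ?thesis by linarith
qed

lemma sum_containment_ge:
  fixes c :: real
  assumes F: "\<F> \<subseteq> nsets X k" and fin: "finite X" and JB: "J \<subseteq> X" "B \<subseteq> J" and s: "k \<le> s" "s \<le> card (X - J)"
    and c: "c * real (s + card B choose k) \<le> (\<Sum>B' | B' \<subseteq> B \<and> card B' \<le> k.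
      unif_measure (X - J) (k - card B') (restriction X \<F> J B') * real (s choose (k - card B')))"
  shows "c * real (card (X - J) choose s) \<le> (\<Sum>D\<in>nsets (X - J) s. containment \<F> k (B \<union> D))"
proof -
  have pos: "0 < real (s + card B choose k)" using s by simp
  have "c * real (card (X - J) choose s)
    = c * real (s + card B choose k) * (real (card (X - J) choose s) / real (s + card B choose k))"
    using pos by simp
  also have "\<dots> \<le> (\<Sum>B' | B' \<subseteq> B \<and> card B' \<le> k.
      unif_measure (X - J) (k - card B') (restriction X \<F> J B') * real (s choose (k - card B')))
      * (real (card (X - J) choose s) / real (s + card B choose k))"
    by (rule mult_right_mono[OF c]) simp
  finally show ?thesis unfolding sum_containment[OF F fin JB s(2)] by simp
qed

lemma unif_measure_nonneg: "0 \<le> unif_measure X k \<F>"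
  by (simp add: unif_measure_def)

text \<open>Discarding the sets that meet \<open>J\<close> costs at most the proportion
  \<open>c\<close>, and shrinking the ground set to \<open>X - J\<close> only decreases the
  denominator.\<close>

lemma unif_measure_restriction_empty:
  fixes \<epsilon> c :: real
  assumes F: "\<F> \<subseteq> nsets X k" and fin: "finite X" and J: "J \<subseteq> X" and k: "k \<le> card (X - J)"
    and \<epsilon>: "\<epsilon> \<le> unif_measure X k \<F>" and c: "real (card J) * real k \<le> c * real (card X)" "c \<le> \<epsilon>"
    and X: "0 < card X"
  shows "\<epsilon> - c \<le> unif_measure (X - J) k (restriction X \<F> J {})"
proof -
  let ?n = "card X" and ?M = "{A \<in> nsets X k. A \<inter> J \<noteq> {}}" and ?R = "restriction X \<F> J {}"
  have finF: "finite \<F>" using F fin finite_imp_finite_nsets finite_subset by blast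
  have finM: "finite ?M" using fin by (simp add: finite_imp_finite_nsets)
  have R: "?R \<subseteq> \<F>" by (auto simp: restriction_def)
  have kn: "card (X - J) \<le> ?n" using fin by (intro card_mono) auto
  have pos: "0 < card (X - J) choose k" "0 < ?n choose k" using k kn by auto
  have "\<F> \<subseteq> ?R \<union> ?M" using F by (auto simp: restriction_def nsets_def)
  then have "card \<F> \<le> card (?R \<union> ?M)" using finF finM R finite_subset by (intro card_mono) auto
  also have "\<dots> \<le> card ?R + card ?M" by (rule card_Un_le)
  finally have 1: "real (card \<F>) \<le> real (card ?R) + real (card ?M)" by linarith
  have "real (?n * card ?M) \<le> real (card J * k * (?n choose k))"
    using card_nsets_meeting[OF fin J, of k] by (simp only: of_nat_le_iff)
  also have "\<dots> \<le> c * real ?n * real (?n choose k)"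
    unfolding of_nat_mult by (rule mult_right_mono[OF c(1)]) simp
  finally have "real ?n * real (card ?M) \<le> real ?n * (c * real (?n choose k))" by (simp add: mult_ac)
  then have 2: "real (card ?M) \<le> c * real (?n choose k)" using X by simp
  have "\<epsilon> * real (?n choose k) \<le> real (card \<F>)"
    using \<epsilon> pos by (simp add: unif_measure_def field_simps)
  with 1 2 have "(\<epsilon> - c) * real (?n choose k) \<le> real (card ?R)" by (simp add: left_diff_distrib)
  moreover have "(\<epsilon> - c) * real (card (X - J) choose k) \<le> (\<epsilon> - c) * real (?n choose k)"
    using c(2) binomial_right_mono[OF kn, of k] by (intro mult_left_mono) auto
  ultimately have "(\<epsilon> - c) * real (card (X - J) choose k) \<le> real (card ?R)" by linarith
  then show ?thesis using pos by (simp add: unif_measure_def field_simps)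
qed

text \<open>Feeds \<open>containment\<close> to \<open>lower_tail\<close> with
  \<open>l = \<epsilon> / 8\<close> on the densities from \<open>Q - \<epsilon> / 2\<close> to
  \<open>Q - \<epsilon> / 4\<close>. All of them exceed \<open>k / n\<close> by at least
  \<open>\<epsilon> / 2\<close>, so a random set has room for many \<open>k\<close>-subsets even
  after its trace on \<open>J\<close> is fixed.\<close>

lemma containment_lower_tail:
  fixes Q \<epsilon> \<eta> :: real
  assumes \<epsilon>: "0 < \<epsilon>" "\<epsilon> \<le> Q" and Q: "Q \<le> 1" and \<eta>: "0 < \<eta>"
  shows "\<exists>(\<theta> :: real) (\<delta>\<^sub>0 :: real) (n\<^sub>0 :: nat). 0 < \<theta> \<and> \<theta> < 1 \<and> 0 < \<delta>\<^sub>0 \<and> (\<forall>(X :: 'a set) k \<F> (\<delta> :: real). finite X \<longrightarrow> n\<^sub>0 \<le> card X \<longrightarrow>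
    \<F> \<subseteq> nsets X k \<longrightarrow> real k \<le> (Q - \<epsilon>) * card X \<longrightarrow> \<epsilon> \<le> unif_measure X k \<F> \<longrightarrow> 0 < \<delta> \<longrightarrow> \<delta> \<le> \<delta>\<^sub>0 \<longrightarrow>
    (\<delta> * card X \<le> real k \<longrightarrow> family_regular X k (nat \<lceil>1 / \<delta>\<rceil>) \<delta> \<F>) \<longrightarrow>
    bexp Q X (\<lambda>C. of_bool (containment \<F> k C < \<theta>)) < \<eta>)"
proof -
  have l: "0 < \<epsilon> / 8" "\<epsilon> / 8 \<le> 1/2" using \<epsilon> Q by auto
  from lower_tail[OF l \<eta>, where 'a = 'a] obtain r :: nat and \<theta> where \<theta>: "0 < \<theta>" "\<theta> < 1"
    and all: "\<forall>(X :: 'a set) g a b Q. finite X \<longrightarrow>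
      (\<forall>C\<subseteq>X. 0 \<le> g C \<and> g C \<le> 1 \<and> (\<Sum>i\<in>C. g (C - {i})) \<le> real (card C) * g C) \<longrightarrow>
      \<epsilon> / 8 \<le> a \<longrightarrow> b \<le> 1 - \<epsilon> / 8 \<longrightarrow> a + \<epsilon> / 8 \<le> b \<longrightarrow> b \<le> Q \<longrightarrow> Q \<le> 1 \<longrightarrow>
      (\<forall>q J B. a \<le> q \<longrightarrow> q \<le> b \<longrightarrow> J \<subseteq> X \<longrightarrow> card J \<le> r \<longrightarrow> B \<subseteq> J \<longrightarrow>
        \<epsilon> / 8 * bexp q X (\<lambda>C. of_bool (C \<inter> J = B)) \<le> bexp q X (\<lambda>C. of_bool (C \<inter> J = B) * g C)) \<longrightarrow>
      bexp Q X (\<lambda>C. of_bool (g C < \<theta>)) < \<eta>"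
    by (elim exE conjE) (rule that)
  note tail = all[THEN spec, THEN spec, THEN spec, THEN spec, THEN spec,
    THEN mp, THEN mp, THEN mp, THEN mp, THEN mp, THEN mp, THEN mp, THEN mp]
  \<comment> \<open>Gives \<open>\<delta> * (r + 1) \<le> \<epsilon> / 16\<close>. Hence regularity
    reaches sets \<open>J\<close> of size \<open>r\<close> with error below
    \<open>\<epsilon> / 16\<close>, and for \<open>k < \<delta> n\<close> a random
    \<open>k\<close>-set meets such a \<open>J\<close> with probability at most
    \<open>\<epsilon> / 16\<close>.\<close>
  define \<delta>\<^sub>0 where "\<delta>\<^sub>0 = \<epsilon> / (16 * (real r + 1))"
  have \<delta>0: "0 < \<delta>\<^sub>0" using \<epsilon> by (simp add: \<delta>\<^sub>0_def add_nonneg_pos)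
  \<comment> \<open>The first bound makes the loss of \<open>J\<close> at most
    \<open>\<epsilon> n / 4\<close> points, the second makes the Chebyshev error at most
    \<open>1 / 2\<close>.\<close>
  define n\<^sub>0 where "n\<^sub>0 = nat \<lceil>max (4 * real r / \<epsilon>) (128 / \<epsilon>\<^sup>2)\<rceil>"
  have main: "bexp Q X (\<lambda>C. of_bool (containment \<F> k C < \<theta>)) < \<eta>"
    if fin: "finite X" and n0: "n\<^sub>0 \<le> card X" and F: "\<F> \<subseteq> nsets X k" and k: "real k \<le> (Q - \<epsilon>) * card X"
      and \<mu>: "\<epsilon> \<le> unif_measure X k \<F>" and \<delta>: "0 < \<delta>" "\<delta> \<le> \<delta>\<^sub>0"
      and reg: "\<delta> * card X \<le> real k \<longrightarrow> family_regular X k (nat \<lceil>1 / \<delta>\<rceil>) \<delta> \<F>"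
    for X :: "'a set" and k \<F> and \<delta> :: real
  proof (rule tail[OF fin, of _ "Q - \<epsilon> / 2" "Q - \<epsilon> / 4"])
    define n where "n = real (card X)"
    have n: "4 * real r / \<epsilon> \<le> n" "128 / \<epsilon>\<^sup>2 \<le> n"
      using n0 unfolding n\<^sub>0_def n_def by linarith+
    have npos: "0 < n" using n(2) \<epsilon> by (smt (verit) divide_pos_pos zero_less_power)
    have rn: "real r \<le> \<epsilon> * n / 4" using n(1) \<epsilon> by (simp add: field_simps)
    have \<delta>r: "\<delta> * (real r + 1) \<le> \<epsilon> / 16"
      using \<delta>(2) by (simp add: \<delta>\<^sub>0_def field_simps add_nonneg_pos)
    have \<delta>1: "\<delta> \<le> \<epsilon> / 16"
    proof -
      have "\<delta> * 1 \<le> \<delta> * (real r + 1)" using \<delta> by (intro mult_left_mono) auto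
      then show ?thesis using \<delta>r by linarith
    qed
    show "\<forall>C\<subseteq>X. 0 \<le> containment \<F> k C \<and> containment \<F> k C \<le> 1 \<and>
        (\<Sum>i\<in>C. containment \<F> k (C - {i})) \<le> real (card C) * containment \<F> k C"
      using containment_bounds[OF F] containment_superharmonic[OF F] finite_subset[OF _ fin] by auto
    show "\<forall>q J B. Q - \<epsilon> / 2 \<le> q \<longrightarrow> q \<le> Q - \<epsilon> / 4 \<longrightarrow> J \<subseteq> X \<longrightarrow> card J \<le> r \<longrightarrow> B \<subseteq> J \<longrightarrow>
        \<epsilon> / 8 * bexp q X (\<lambda>C. of_bool (C \<inter> J = B)) \<le> bexp q X (\<lambda>C. of_bool (C \<inter> J = B) * containment \<F> k C)"
    proof (intro allI impI)
      fix q J B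
      assume q: "Q - \<epsilon> / 2 \<le> q" "q \<le> Q - \<epsilon> / 4" and J: "J \<subseteq> X" "card J \<le> r" and B: "B \<subseteq> J"
      have q01: "0 \<le> q" "q \<le> 1" using q \<epsilon> Q by auto
      have finJ: "finite J" and finB: "finite B" using J(1) B fin by (meson finite_subset)+
      let ?Y = "X - J"
      have finY: "finite ?Y" using fin by simp
      have cardY: "real (card ?Y) = n - real (card J)" "real (card ?Y) \<le> n"
        using J(1) fin finJ card_mono[OF fin J(1)] by (auto simp: card_Diff_subset n_def)
      \<comment> \<open>The gap of \<open>\<epsilon> n\<close> between \<open>k\<close> and
        \<open>Q n\<close> is spent on \<open>\<epsilon> n / 2\<close> for the density
        \<open>q\<close>, \<open>\<epsilon> n / 4\<close> for \<open>J\<close> and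
        \<open>\<epsilon> n / 8\<close> for the deviation; the last \<open>\<epsilon> n / 8\<close>
        remains as surplus over \<open>k\<close>.\<close>
      define x where "x = real k + \<epsilon> * n / 8"
      have dense: "\<epsilon> / 4 * real (card ?Y choose s) \<le> (\<Sum>D\<in>nsets ?Y s. containment \<F> k (B \<union> D))"
        if s: "s \<le> card ?Y" "x \<le> real s" for s
      proof -
        have sn: "\<epsilon> * n / 8 \<le> real s" using s(2) by (simp add: x_def)
        have "0 < \<epsilon> * n / 8" using \<epsilon> npos by simp
        then have s0: "0 < s" and ks: "k \<le> s" using s(2) sn by (auto simp: x_def)
        let ?I = "{B'. B' \<subseteq> B \<and> card B' \<le> k}"
        let ?t = "\<lambda>B'. unif_measure ?Y (k - card B') (restriction X \<F> J B') * real (s choose (k - card B'))"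
        have "\<epsilon> / 4 * real (s + card B choose k) \<le> (\<Sum>B'\<in>?I. ?t B')"
        proof (cases "\<delta> * card X \<le> real k")
          case True
          with reg have reg': "family_regular X k (nat \<lceil>1 / \<delta>\<rceil>) \<delta> \<F>" by simp
          have "real r * \<delta> \<le> 1" using \<delta>r \<delta> \<epsilon> Q by (simp add: algebra_simps)
          then have "real r \<le> 1 / \<delta>" using \<delta> by (simp add: field_simps)
          then have J': "card J \<le> nat \<lceil>1 / \<delta>\<rceil>" using J(2) by linarith
          have "\<epsilon> / 4 * real (s + card B choose k) = (\<Sum>B'\<in>?I. \<epsilon> / 4 * real (s choose (k - card B')))"
            unfolding vandermonde_subsets[OF finB, symmetric] by (simp add: sum_distrib_left)
          also have "\<dots> \<le> (\<Sum>B'\<in>?I. ?t B')"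
          proof (rule sum_mono)
            fix B' assume "B' \<in> ?I"
            then have B': "B' \<subseteq> J" "card B' \<le> k" using B by auto
            \<comment> \<open>\<open>family_regular\<close> speaks only about nonempty layers, so
              nonemptiness must be supplied.\<close>
            have "k - card B' \<le> card ?Y" using ks s by linarith
            then have "\<bar>unif_measure ?Y (k - card B') (restriction X \<F> J B') - unif_measure X k \<F>\<bar> < \<delta>"
              using reg'[unfolded family_regular_def] J(1) J' B' by blast
            then have "\<epsilon> / 4 \<le> unif_measure ?Y (k - card B') (restriction X \<F> J B')"
              using \<mu> \<delta>1 \<epsilon> by linarith
            then show "\<epsilon> / 4 * real (s choose (k - card B')) \<le> ?t B'" by (rule mult_right_mono) simp
          qed
          finally show ?thesis .
        next
          case False
          then have k\<delta>: "real k \<le> \<delta> * n" by (simp add: n_def)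
          \<comment> \<open>Without regularity only the empty trace is used: its restriction keeps
            measure at least \<open>\<epsilon> / 2\<close>, and by \<open>choose_add_le\<close> it
            carries at least half of the mixture weight.\<close>
          have "real (card J) * real k \<le> real r * (\<delta> * n)" using J(2) k\<delta> by (intro mult_mono) auto
          also have "\<dots> = (\<delta> * real r) * n" by simp
          also have "\<dots> \<le> \<epsilon> / 16 * n"
            using \<delta>r \<delta> npos by (intro mult_right_mono) (auto simp: algebra_simps)
          finally have Jk: "real (card J) * real k \<le> \<epsilon> / 16 * n" .
          have "\<epsilon> - \<epsilon> / 16 \<le> unif_measure ?Y k (restriction X \<F> J {})"
            using Jk ks s(1) \<epsilon> npos
            by (intro unif_measure_restriction_empty[OF F fin J(1) _ \<mu>]) (auto simp: n_def)
          then have half: "\<epsilon> / 2 \<le> unif_measure ?Y k (restriction X \<F> J {})" using \<epsilon> by linarith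
          have "card B \<le> card J" using B finJ by (rule card_mono[rotated])
          then have "real (card B) * real k \<le> real (card J) * real k" by (intro mult_right_mono) auto
          then have "2 * (real (card B) * real k) \<le> real s" using Jk sn by linarith
          then have "2 * card B * k \<le> s + card B"
            by (metis (no_types, opaque_lifting) mult.assoc of_nat_le_iff of_nat_mult of_nat_numeral trans_le_add1)
          from choose_add_le[OF this s0] have "real (s + card B choose k) \<le> 2 * real (s choose k)"
            by linarith
          then have "\<epsilon> / 4 * real (s + card B choose k) \<le> \<epsilon> / 4 * (2 * real (s choose k))"
            using \<epsilon> by (intro mult_left_mono) auto
          also have "\<dots> = \<epsilon> / 2 * real (s choose k)" by simp
          also have "\<dots> \<le> ?t {}" using mult_right_mono[OF half, of "real (s choose k)"] by simp
          also have "\<dots> \<le> (\<Sum>B'\<in>?I. ?t B')"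
            using finB by (intro member_le_sum mult_nonneg_nonneg unif_measure_nonneg) auto
          finally show ?thesis .
        qed
        then show ?thesis by (rule sum_containment_ge[OF F fin J(1) B ks s(1)])
      qed
      have "1 - real (card ?Y) / (\<epsilon> * n / 8)\<^sup>2 \<le> bexp q ?Y (\<lambda>D. of_bool (x \<le> real (card D)))"
      proof (rule bexp_card_ge[OF finY q01])
        show "0 < \<epsilon> * n / 8" using \<epsilon> npos by simp
        have "(Q - \<epsilon> / 2) * n \<le> q * n" using q npos by (intro mult_right_mono) auto
        moreover have "q * real (card J) \<le> 1 * real r" using q01 J(2) by (intro mult_mono) auto
        moreover have "real k \<le> Q * n - \<epsilon> * n" using k by (simp add: n_def left_diff_distrib)
        ultimately show "x \<le> q * real (card ?Y) - \<epsilon> * n / 8"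
          using rn unfolding x_def cardY(1) right_diff_distrib left_diff_distrib by simp
      qed
      moreover have "real (card ?Y) / (\<epsilon> * n / 8)\<^sup>2 \<le> 1 / 2"
      proof -
        have "128 \<le> \<epsilon>\<^sup>2 * n" using n(2) \<epsilon> by (simp add: field_simps)
        then have "128 * n \<le> \<epsilon>\<^sup>2 * n * n" using npos by (intro mult_right_mono) auto
        then have "real (card ?Y) * 128 \<le> (\<epsilon> * n)\<^sup>2" using cardY(2) by (simp add: power2_eq_square mult_ac)
        then show ?thesis using \<epsilon> npos by (simp add: power_divide field_simps)
      qed
      ultimately have half: "1 / 2 \<le> bexp q ?Y (\<lambda>D. of_bool (x \<le> real (card D)))" by linarith
      \<comment> \<open>Layers of size at least \<open>x\<close> have average at least
        \<open>\<epsilon> / 4\<close> and together probability at least \<open>1 / 2\<close>; the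
        smaller layers contribute nonnegatively.\<close>
      have "\<epsilon> / 8 \<le> \<epsilon> / 4 * bexp q ?Y (\<lambda>D. of_bool (x \<le> real (card D)))"
        using mult_left_mono[OF half, of "\<epsilon> / 4"] \<epsilon> by simp
      also have "\<dots> = bexp q ?Y (\<lambda>D. \<epsilon> / 4 * of_bool (x \<le> real (card D)))" by (simp only: bexp_cmult)
      also have "\<dots> \<le> bexp q ?Y (\<lambda>D. containment \<F> k (B \<union> D))"
      proof (rule bexp_mono_levels[OF finY q01])
        fix s assume s: "s \<le> card ?Y"
        have "(\<Sum>D\<in>nsets ?Y s. \<epsilon> / 4 * of_bool (x \<le> real (card D)))
            = (\<Sum>D\<in>nsets ?Y s. \<epsilon> / 4 * of_bool (x \<le> real s))"
          by (intro sum.cong) (auto simp: nsets_def)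
        also have "\<dots> = \<epsilon> / 4 * of_bool (x \<le> real s) * real (card ?Y choose s)"
          by simp
        also have "\<dots> \<le> (\<Sum>D\<in>nsets ?Y s. containment \<F> k (B \<union> D))"
        proof (cases "x \<le> real s")
          case True
          then show ?thesis using dense[OF s] by simp
        next
          case False
          have "0 \<le> (\<Sum>D\<in>nsets ?Y s. containment \<F> k (B \<union> D))"
            using finB by (intro sum_nonneg containment_bounds(1)[OF F]) (auto simp: nsets_def)
          then show ?thesis using False by simp
        qed
        finally show "(\<Sum>D\<in>nsets ?Y s. \<epsilon> / 4 * of_bool (x \<le> real (card D))) \<le> (\<Sum>D\<in>nsets ?Y s. containment \<F> k (B \<union> D))" .
      qed
      finally have main: "\<epsilon> / 8 \<le> bexp q ?Y (\<lambda>D. containment \<F> k (B \<union> D))" .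
      have "bexp q X (\<lambda>C. of_bool (C \<inter> J = B)) = bweight q J B"
        using bexp_restrict[OF fin J(1) B, of q "\<lambda>_. 1"] finY by (simp add: bexp_const)
      then show "\<epsilon> / 8 * bexp q X (\<lambda>C. of_bool (C \<inter> J = B)) \<le> bexp q X (\<lambda>C. of_bool (C \<inter> J = B) * containment \<F> k C)"
        unfolding bexp_restrict[OF fin J(1) B]
        using mult_left_mono[OF main bweight_nonneg[OF q01, of J B]] by (simp add: mult.commute)
    qed
  qed (use \<epsilon> Q in auto)
  show ?thesis
    by (intro exI[of _ \<theta>] exI[of _ \<delta>\<^sub>0] exI[of _ n\<^sub>0] conjI allI impI \<theta> \<delta>0) (rule main)
qed

section \<open>Random colourings\<close>

text \<open>Glues bijections between the fibres. Applied to labellings, it shows that the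
  permutations of \<open>X\<close> act transitively on disjoint tuples with prescribed
  sizes.\<close>

lemma bij_betw_matching_fibres:
  assumes "finite X" and fib: "\<And>j. card {x \<in> X. f x = j} = card {x \<in> X. g x = j}"
  shows "\<exists>\<pi>. bij_betw \<pi> X X \<and> (\<forall>x\<in>X. g (\<pi> x) = f x)"
proof -
  have "\<exists>\<phi>. bij_betw \<phi> {x \<in> X. f x = j} {x \<in> X. g x = j}" for j
    using assms by (intro finite_same_card_bij) auto
  then obtain \<phi> where \<phi>: "\<And>j. bij_betw (\<phi> j) {x \<in> X. f x = j} {x \<in> X. g x = j}" by metis
  define \<pi> where "\<pi> x = \<phi> (f x) x" for x
  have \<pi>: "\<pi> x \<in> X \<and> g (\<pi> x) = f x" if "x \<in> X" for x
    using bij_betwE[OF \<phi>[of "f x"]] that by (auto simp: \<pi>_def)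
  have "inj_on \<pi> X"
  proof (rule inj_onI)
    fix x y assume xy: "x \<in> X" "y \<in> X" "\<pi> x = \<pi> y"
    then have "f x = f y" using \<pi> by metis
    then show "x = y"
      using xy inj_onD[OF bij_betw_imp_inj_on[OF \<phi>[of "f x"]], of x y] by (auto simp: \<pi>_def)
  qed
  moreover have "\<pi> ` X \<subseteq> X" using \<pi> by auto
  ultimately have "bij_betw \<pi> X X"
    using assms(1) by (simp add: bij_betw_def endo_inj_surj)
  then show ?thesis using \<pi> by blast
qed

text \<open>Greedy choice. It supplies a tuple when \<open>n\<close> is bounded; for large
  \<open>n\<close> existence comes out of the positive lower bound on weights.\<close>

lemma exists_disjoint_subsets:
  assumes "finite I" "finite X" "(\<Sum>i\<in>I. k i) \<le> card X"
  shows "\<exists>A. (\<forall>i\<in>I. A i \<in> nsets X (k i)) \<and> disjoint_family_on A I"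
  using assms(1,3)
proof (induction I rule: finite_induct)
  case (insert j I)
  then obtain A where A: "\<forall>i\<in>I. A i \<in> nsets X (k i)" "disjoint_family_on A I" by auto
  let ?U = "\<Union>i\<in>I. A i"
  have U: "?U \<subseteq> X" "finite ?U" using A(1) insert.hyps(1) by (auto simp: nsets_def)
  have "card ?U \<le> (\<Sum>i\<in>I. card (A i))" using insert.hyps(1) by (rule card_UN_le)
  also have "\<dots> = (\<Sum>i\<in>I. k i)" using A(1) by (intro sum.cong) (auto simp: nsets_def)
  finally have "k j \<le> card (X - ?U)"
    using insert U by (simp add: card_Diff_subset)
  then obtain D where D: "D \<subseteq> X - ?U" "card D = k j" "finite D"
    by (rule obtain_subset_with_card_n)
  have "(A(j := D)) i \<in> nsets X (k i)" if "i \<in> insert j I" for i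
    using that A(1) D by (auto simp: nsets_def)
  moreover have "disjoint_family_on (A(j := D)) (insert j I)"
    using A(2) D(1) insert.hyps(2) unfolding disjoint_family_on_def
    by (auto simp: disjoint_iff)
  ultimately show ?case by blast
qed (auto simp: disjoint_family_on_def)

section \<open>Colour classes and the weight of a disjoint tuple\<close>

definition colour_class :: "'a set \<Rightarrow> ('a \<Rightarrow> nat) \<Rightarrow> nat \<Rightarrow> 'a set" where
  "colour_class X c i = {x \<in> X. c x = i}"

text \<open>A colour class of a uniform colouring is a \<open>1 / h\<close>-random set, since
  exactly \<open>(h - 1) ^ card (X - C)\<close> colourings have class \<open>C\<close>. The joint
  law of the classes never enters: the colours are combined by a union bound.\<close>

lemma sum_colour_class:
  fixes f :: "'a set \<Rightarrow> real"
  assumes fin: "finite X" and i: "i \<in> {1..h}"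
  shows "(\<Sum>c\<in>X \<rightarrow>\<^sub>E {1..h}. f (colour_class X c i)) = real h ^ card X * bexp (1 / real h) X f"
proof -
  have h: "0 < h" using i by auto
  have finC: "finite (X \<rightarrow>\<^sub>E {1..h})" using fin by (intro finite_PiE) auto
  have fibre: "real (card {c \<in> X \<rightarrow>\<^sub>E {1..h}. colour_class X c i = C}) = real h ^ card X * bweight (1 / real h) X C"
    if C: "C \<subseteq> X" for C
  proof -
    have "{c \<in> X \<rightarrow>\<^sub>E {1..h}. colour_class X c i = C} = (\<Pi>\<^sub>E x\<in>X. if x \<in> C then {i} else {1..h} - {i})"
      using C i by (auto simp: colour_class_def PiE_def Pi_def extensional_def split: if_splits)
    then have "card {c \<in> X \<rightarrow>\<^sub>E {1..h}. colour_class X c i = C} = (\<Prod>x\<in>X. if x \<in> C then 1 else h - 1)"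
      using fin i by (simp add: card_PiE if_distrib cong: if_cong)
    also have "\<dots> = (h - 1) ^ card (X - C)"
      using fin by (simp add: prod.If_cases Diff_eq)
    finally have "real (card {c \<in> X \<rightarrow>\<^sub>E {1..h}. colour_class X c i = C}) = (real h - 1) ^ card (X - C)"
      using h by (simp add: of_nat_diff)
    also have "\<dots> = real h ^ card X * bweight (1 / real h) X C"
    proof -
      have "card X = card C + card (X - C)"
        using C fin by (metis card_Diff_subset card_mono finite_subset le_add_diff_inverse)
      then have "real h ^ card X * bweight (1 / real h) X C
         = (real h * (1 / real h)) ^ card C * (real h * (1 - 1 / real h)) ^ card (X - C)"
        unfolding bweight_def power_mult_distrib by (simp add: power_add)
      then show ?thesis using h by (simp add: right_diff_distrib)
    qed
    finally show ?thesis .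
  qed
  have "(\<Sum>c\<in>X \<rightarrow>\<^sub>E {1..h}. f (colour_class X c i))
      = (\<Sum>C\<in>Pow X. \<Sum>c | c \<in> (X \<rightarrow>\<^sub>E {1..h}) \<and> colour_class X c i = C. f (colour_class X c i))"
    using fin finC by (intro sum.group[symmetric]) (auto simp: colour_class_def)
  also have "\<dots> = (\<Sum>C\<in>Pow X. real (card {c \<in> X \<rightarrow>\<^sub>E {1..h}. colour_class X c i = C}) * f C)"
    by (intro sum.cong refl) (simp add: sum.cong[where h = "\<lambda>_. f _"])
  also have "\<dots> = (\<Sum>C\<in>Pow X. real h ^ card X * (bweight (1 / real h) X C * f C))"
    using fibre by (intro sum.cong) (auto simp: mult_ac)
  finally show ?thesis by (simp add: bexp_def sum_distrib_left)
qed

text \<open>For a disjoint tuple this is \<open>h ^ card X\<close> times the probability that a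
  uniform colouring, followed by independent uniform \<open>k i\<close>-subsets of its classes,
  produces \<open>A\<close>. The binomials are then positive, as the classes contain the sets
  \<open>A i\<close>.\<close>

definition colouring_weight :: "'a set \<Rightarrow> nat \<Rightarrow> (nat \<Rightarrow> nat) \<Rightarrow> (nat \<Rightarrow> 'a set) \<Rightarrow> real" where
  "colouring_weight X h k A = (\<Sum>c | c \<in> (X \<rightarrow>\<^sub>E {1..h}) \<and> (\<forall>i\<in>{1..h}. A i \<subseteq> colour_class X c i).
     1 / (\<Prod>i=1..h. real (card (colour_class X c i) choose k i)))"

text \<open>Symmetry: a permutation of \<open>X\<close> carrying \<open>A\<close> to
  \<open>A'\<close> acts on the colourings and preserves the sizes of their classes.\<close>

lemma colouring_weight_eq:
  assumes fin: "finite X" and A: "A \<in> disjoint_tuples X h k" and A': "A' \<in> disjoint_tuples X h k"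
  shows "colouring_weight X h k A = colouring_weight X h k A'"
proof -
  \<comment> \<open>Encodes a tuple as one function, so that a permutation can be found by matching
    fibres. The label 0 is free for uncovered points because indices start at 1.\<close>
  define lab where "lab A x = (if \<exists>i\<in>{1..h}. x \<in> A i then THE i. i \<in> {1..h} \<and> x \<in> A i else 0)"
    for A :: "nat \<Rightarrow> 'a set" and x
  have lab: "lab A x = i" if "A \<in> disjoint_tuples X h k" "i \<in> {1..h}" "x \<in> A i" for A i x
  proof -
    have "(THE i. i \<in> {1..h} \<and> x \<in> A i) = i"
    proof (rule the_equality)
      fix j assume j: "j \<in> {1..h} \<and> x \<in> A j"
      show "j = i"
      proof (rule ccontr)
        assume "j \<noteq> i"
        then have "A j \<inter> A i = {}" using that(1,2) j by (simp add: disjoint_tuples_def disjoint_family_on_def)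
        then show False using j that(3) by blast
      qed
    qed (use that in simp)
    then show ?thesis using that by (auto simp: lab_def)
  qed
  have labi: "{x \<in> X. lab A x = i} = A i" if "A \<in> disjoint_tuples X h k" "i \<in> {1..h}" for A i
  proof (intro equalityI subsetI)
    fix x assume "x \<in> {x \<in> X. lab A x = i}"
    then have "lab A x \<noteq> 0" "lab A x = i" using that(2) by auto
    then obtain j where "j \<in> {1..h}" "x \<in> A j" by (auto simp: lab_def split: if_splits)
    then show "x \<in> A i" using lab[OF that(1)] \<open>lab A x = i\<close> by auto
  next
    fix x assume "x \<in> A i"
    then show "x \<in> {x \<in> X. lab A x = i}"
      using that lab[OF that] by (auto simp: disjoint_tuples_def PiE_iff nsets_def)
  qed
  have cardA: "card (A i) = k i" "A i \<subseteq> X" if "A \<in> disjoint_tuples X h k" "i \<in> {1..h}" for A i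
    using that by (auto simp: disjoint_tuples_def PiE_iff nsets_def)
  have lab0: "card {x \<in> X. lab A x = 0} = card X - (\<Sum>i=1..h. k i)" if T: "A \<in> disjoint_tuples X h k" for A
  proof -
    have "{x \<in> X. lab A x = 0} = X - (\<Union>i\<in>{1..h}. A i)"
    proof (intro equalityI subsetI)
      fix x assume "x \<in> {x \<in> X. lab A x = 0}"
      then show "x \<in> X - (\<Union>i\<in>{1..h}. A i)" using lab[OF T] by fastforce
    qed (auto simp: lab_def)
    moreover have "card (\<Union>i\<in>{1..h}. A i) = (\<Sum>i=1..h. card (A i))"
    proof (rule card_UN_disjoint')
      show "disjoint_family_on A {1..h}" using T by (simp add: disjoint_tuples_def)
      show "finite (A i)" if "i \<in> {1..h}" for i using finite_subset[OF cardA(2)[OF T that] fin] .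
    qed simp
    moreover have "(\<Sum>i=1..h. card (A i)) = (\<Sum>i=1..h. k i)"
      using cardA(1)[OF T] by (rule sum.cong[OF refl])
    moreover have U: "(\<Union>i\<in>{1..h}. A i) \<subseteq> X" using cardA(2)[OF T] by blast
    ultimately show ?thesis
      using card_Diff_subset[OF finite_subset[OF U fin] U] by simp
  qed
  have labh: "{x \<in> X. lab A x = j} = {}" if "A \<in> disjoint_tuples X h k" "j \<notin> {1..h}" "j \<noteq> 0" for A j
  proof -
    note T = that(1)
    have False if x: "lab A x = j" for x
    proof -
      obtain i where "i \<in> {1..h}" "x \<in> A i"
        using x \<open>j \<noteq> 0\<close> by (auto simp: lab_def split: if_splits)
      moreover from this have "lab A x = i" by (rule lab[OF T])
      ultimately show False using x \<open>j \<notin> {1..h}\<close> by simp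
    qed
    then show ?thesis by blast
  qed
  have "card {x \<in> X. lab A x = j} = card {x \<in> X. lab A' x = j}" for j
  proof -
    consider "j \<in> {1..h}" | "j = 0" | "j \<notin> {1..h}" "j \<noteq> 0" by blast
    then show ?thesis
    proof cases
      case 1
      show ?thesis unfolding labi[OF A 1] labi[OF A' 1] cardA(1)[OF A 1] cardA(1)[OF A' 1] ..
    next
      case 2
      show ?thesis unfolding 2 lab0[OF A] lab0[OF A'] ..
    next
      case 3
      show ?thesis unfolding labh[OF A 3] labh[OF A' 3] ..
    qed
  qed
  from bij_betw_matching_fibres[OF fin this]
  obtain \<pi> where bij: "bij_betw \<pi> X X" and \<pi>: "\<forall>x\<in>X. lab A' (\<pi> x) = lab A x" by blast
  have \<pi>X: "\<pi> x \<in> X" if "x \<in> X" for x using bij that by (auto simp: bij_betw_def)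
  have img: "\<pi> ` A i = A' i" if i: "i \<in> {1..h}" for i
  proof
    show "\<pi> ` A i \<subseteq> A' i"
      unfolding labi[OF A i, symmetric] labi[OF A' i, symmetric] using \<pi> \<pi>X by auto
    show "A' i \<subseteq> \<pi> ` A i"
    proof
      fix y assume y: "y \<in> A' i"
      then have "y \<in> X" using cardA(2)[OF A' i] by auto
      then obtain x where x: "x \<in> X" "y = \<pi> x" using bij by (auto simp: bij_betw_def)
      then have "lab A x = i" using \<pi> lab[OF A' i y] by auto
      then show "y \<in> \<pi> ` A i" using x labi[OF A i] by auto
    qed
  qed
  \<comment> \<open>The permutation and its inverse acting on colourings; \<open>restrict\<close>
    keeps the results extensional, so that the two maps are mutually inverse on the function
    space.\<close>
  define \<Phi> where "\<Phi> c = restrict (c \<circ> \<pi>) X" for c :: "'a \<Rightarrow> nat"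
  define \<Psi> where "\<Psi> c = restrict (c \<circ> inv_into X \<pi>) X" for c :: "'a \<Rightarrow> nat"
  have inv: "inv_into X \<pi> (\<pi> x) = x" "\<pi> (inv_into X \<pi> x) = x" "inv_into X \<pi> x \<in> X" if "x \<in> X" for x
    using that bij_betw_inv_into_left[OF bij] bij_betw_inv_into_right[OF bij]
      bij_betwE[OF bij_betw_inv_into[OF bij]] by blast+
  let ?Col = "X \<rightarrow>\<^sub>E {1..h}"
  have \<Phi>\<Psi>: "\<Phi> (\<Psi> c) = c" "\<Psi> (\<Phi> c) = c" "\<Phi> c \<in> ?Col" "\<Psi> c \<in> ?Col" if c: "c \<in> ?Col" for c
  proof -
    show "\<Phi> (\<Psi> c) = c"
    proof
      fix x show "\<Phi> (\<Psi> c) x = c x"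
      proof (cases "x \<in> X")
        case True
        then show ?thesis by (simp add: \<Phi>_def \<Psi>_def \<pi>X inv(1))
      next
        case False
        then show ?thesis using PiE_arb[OF c False] by (simp add: \<Phi>_def)
      qed
    qed
    show "\<Psi> (\<Phi> c) = c"
    proof
      fix x show "\<Psi> (\<Phi> c) x = c x"
      proof (cases "x \<in> X")
        case True
        then show ?thesis by (simp add: \<Phi>_def \<Psi>_def inv(2,3))
      next
        case False
        then show ?thesis using PiE_arb[OF c False] by (simp add: \<Psi>_def)
      qed
    qed
    show "\<Phi> c \<in> ?Col" "\<Psi> c \<in> ?Col"
      unfolding \<Phi>_def \<Psi>_def using PiE_mem[OF c] \<pi>X inv(3)
      by (auto simp del: atLeastAtMost_iff)
  qed
  have cls: "colour_class X c i = \<pi> ` colour_class X (\<Phi> c) i" for c i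
  proof -
    have "colour_class X (\<Phi> c) i = {x \<in> X. c (\<pi> x) = i}" by (auto simp: colour_class_def \<Phi>_def)
    moreover have "\<pi> ` {x \<in> X. c (\<pi> x) = i} = colour_class X c i"
      using bij by (auto simp: colour_class_def bij_betw_def image_iff)
    ultimately show ?thesis by simp
  qed
  have inj: "inj_on \<pi> X" using bij by (simp add: bij_betw_def)
  have cls_sub: "colour_class X c i \<subseteq> X" for c i by (auto simp: colour_class_def)
  have cls_card: "card (colour_class X c i) = card (colour_class X (\<Phi> c) i)" for c i
    unfolding cls[of c i] by (rule card_image[OF inj_on_subset[OF inj cls_sub]])
  have sub: "A' i \<subseteq> colour_class X c i \<longleftrightarrow> A i \<subseteq> colour_class X (\<Phi> c) i" if i: "i \<in> {1..h}" for c i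
    unfolding cls[of c i] img[OF i, symmetric]
    using inj_on_image_subset_iff[OF inj cardA(2)[OF A i] cls_sub] .
  show ?thesis
    unfolding colouring_weight_def
  proof (rule sum.reindex_bij_witness[where i = \<Phi> and j = \<Psi>], goal_cases)
    case (2 c)
    have "\<Psi> c \<in> ?Col" "\<Phi> (\<Psi> c) = c" using 2 \<Phi>\<Psi> by auto
    then show ?case using 2 sub[of _ "\<Psi> c"] by auto
  next
    case (5 c)
    have "\<Phi> (\<Psi> c) = c" using 5 \<Phi>\<Psi> by auto
    then show ?case by (simp add: cls_card[of "\<Psi> c"])
  qed (use \<Phi>\<Psi> sub in auto)
qed

lemma finite_disjoint_tuples: "finite X \<Longrightarrow> finite (disjoint_tuples X h k)"
  unfolding disjoint_tuples_def
  by (rule finite_subset[of _ "\<Pi>\<^sub>E i\<in>{1..h}. nsets X (k i)"]) (auto intro!: finite_PiE finite_imp_finite_nsets)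

text \<open>Exchanging the sums fixes the colouring first. The sets are then chosen independently
  inside its classes, and disjointness is automatic.\<close>

lemma sum_colouring_weight:
  assumes fin: "finite X" and G: "\<And>i. i \<in> {1..h} \<Longrightarrow> \<G> i \<subseteq> nsets X (k i)"
  shows "(\<Sum>A | A \<in> disjoint_tuples X h k \<and> (\<forall>i\<in>{1..h}. A i \<in> \<G> i). colouring_weight X h k A)
    = (\<Sum>c\<in>X \<rightarrow>\<^sub>E {1..h}. \<Prod>i=1..h. containment (\<G> i) (k i) (colour_class X c i))"
proof -
  let ?T = "{A \<in> disjoint_tuples X h k. \<forall>i\<in>{1..h}. A i \<in> \<G> i}"
  let ?Col = "X \<rightarrow>\<^sub>E {1..h}"
  let ?in = "\<lambda>A c. \<forall>i\<in>{1..h}. A i \<subseteq> colour_class X c i"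
  let ?p = "\<lambda>c. \<Prod>i=1..h. real (card (colour_class X c i) choose k i)"
  have finT: "finite ?T" using finite_disjoint_tuples[OF fin] by simp
  have finC: "finite ?Col" using fin by (intro finite_PiE) auto
  have "(\<Sum>A\<in>?T. colouring_weight X h k A) = (\<Sum>A\<in>?T. \<Sum>c\<in>?Col. of_bool (?in A c) * (1 / ?p c))"
    unfolding colouring_weight_def using finC
    by (intro sum.cong refl sum.mono_neutral_cong_left) auto
  also have "\<dots> = (\<Sum>c\<in>?Col. \<Sum>A\<in>?T. of_bool (?in A c) * (1 / ?p c))" by (rule sum.swap)
  also have "\<dots> = (\<Sum>c\<in>?Col. \<Prod>i=1..h. containment (\<G> i) (k i) (colour_class X c i))"
  proof (rule sum.cong[OF refl])
    fix c
    have "{A \<in> ?T. ?in A c} = (\<Pi>\<^sub>E i\<in>{1..h}. {B \<in> \<G> i. B \<subseteq> colour_class X c i})"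
    proof (intro equalityI subsetI)
      fix A assume "A \<in> {A \<in> ?T. ?in A c}"
      then show "A \<in> (\<Pi>\<^sub>E i\<in>{1..h}. {B \<in> \<G> i. B \<subseteq> colour_class X c i})"
        by (auto simp: disjoint_tuples_def PiE_iff)
    next
      fix A assume A: "A \<in> (\<Pi>\<^sub>E i\<in>{1..h}. {B \<in> \<G> i. B \<subseteq> colour_class X c i})"
      then have "\<And>i. i \<in> {1..h} \<Longrightarrow> A i \<subseteq> colour_class X c i" by (auto simp: PiE_iff)
      then have "disjoint_family_on A {1..h}"
        by (auto simp: disjoint_family_on_def colour_class_def) blast
      moreover have "A i \<in> nsets X (k i)" if "i \<in> {1..h}" for i
        using A G[OF that] that by (auto simp: PiE_iff)
      ultimately show "A \<in> {A \<in> ?T. ?in A c}"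
        using A by (auto simp: disjoint_tuples_def PiE_iff)
    qed
    then have "real (card {A \<in> ?T. ?in A c}) = (\<Prod>i=1..h. real (card {B \<in> \<G> i. B \<subseteq> colour_class X c i}))"
      by (simp add: card_PiE)
    moreover have "(\<Sum>A\<in>?T. of_bool (?in A c) * (1 / ?p c)) = real (card {A \<in> ?T. ?in A c}) * (1 / ?p c)"
      unfolding sum_distrib_right[symmetric] by (simp only: sum_of_bool_card[OF finT])
    ultimately show "(\<Sum>A\<in>?T. of_bool (?in A c) * (1 / ?p c)) = (\<Prod>i=1..h. containment (\<G> i) (k i) (colour_class X c i))"
      by (simp add: containment_def unif_measure_def prod_dividef)
  qed
  finally show ?thesis .
qed

text \<open>Every disjoint tuple refines the same weighted number of colourings, so choosing a random
  colouring first and then random sets inside the colour classes does not bias the tuple.\<close>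

lemma prob_disjoint_tuples_ge:
  fixes \<gamma> :: real
  assumes fin: "finite X" and h: "1 \<le> h" and F: "\<And>i. i \<in> {1..h} \<Longrightarrow> \<F> i \<subseteq> nsets X (k i)"
    and \<gamma>: "0 < \<gamma>"
    and sum: "\<gamma> * real h ^ card X \<le> (\<Sum>c\<in>X \<rightarrow>\<^sub>E {1..h}. \<Prod>i=1..h. containment (\<F> i) (k i) (colour_class X c i))"
  shows "\<gamma> \<le> measure_pmf.prob (pmf_of_set (disjoint_tuples X h k)) {A. \<forall>i\<in>{1..h}. A i \<in> \<F> i}"
proof -
  let ?T = "disjoint_tuples X h k"
  let ?TF = "{A \<in> ?T. \<forall>i\<in>{1..h}. A i \<in> \<F> i}"
  let ?w = "colouring_weight X h k"
  have finT: "finite ?T" by (rule finite_disjoint_tuples[OF fin])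
  have hn: "0 < real h ^ card X" using h by simp
  have good: "\<gamma> * real h ^ card X \<le> (\<Sum>A\<in>?TF. ?w A)"
    using sum sum_colouring_weight[OF fin F] by simp
  \<comment> \<open>This also shows that \<open>pmf_of_set\<close> is taken over a nonempty set, on
    which alone it is the uniform distribution.\<close>
  then have "?TF \<noteq> {}" using mult_pos_pos[OF \<gamma> hn] by (metis leD sum.empty)
  then obtain A0 where A0: "A0 \<in> ?T" by blast
  have w: "?w A = ?w A0" if "A \<in> ?T" for A by (rule colouring_weight_eq[OF fin that A0])
  \<comment> \<open>Normalisation, from the same formula applied to full layers. Colourings with too
    small a class contribute 0, so the total is only bounded by \<open>h ^ card X\<close>; this is
    the direction required.\<close>
  have "(\<Sum>A\<in>?T. ?w A) = (\<Sum>A | A \<in> ?T \<and> (\<forall>i\<in>{1..h}. A i \<in> nsets X (k i)). ?w A)"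
    by (intro sum.cong) (auto simp: disjoint_tuples_def PiE_iff)
  also have "\<dots> = (\<Sum>c\<in>X \<rightarrow>\<^sub>E {1..h}. \<Prod>i=1..h. containment (nsets X (k i)) (k i) (colour_class X c i))"
    by (rule sum_colouring_weight[OF fin]) simp
  also have "\<dots> \<le> (\<Sum>c\<in>X \<rightarrow>\<^sub>E {1..h}. 1)"
  proof (intro sum_mono prod_le_1 conjI)
    fix c i
    have "finite (colour_class X c i)" using fin by (simp add: colour_class_def)
    then show "0 \<le> containment (nsets X (k i)) (k i) (colour_class X c i)"
      "containment (nsets X (k i)) (k i) (colour_class X c i) \<le> 1"
      using containment_bounds[OF order.refl] by auto
  qed
  also have "\<dots> = real h ^ card X" using fin by (simp add: card_PiE)
  finally have all: "real (card ?T) * ?w A0 \<le> real h ^ card X" using w by simp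
  have goodw: "\<gamma> * real h ^ card X \<le> real (card ?TF) * ?w A0"
  proof -
    have "(\<Sum>A\<in>?TF. ?w A) = (\<Sum>A\<in>?TF. ?w A0)" by (intro sum.cong refl w) auto
    then show ?thesis using good by simp
  qed
  then have "0 < real (card ?TF) * ?w A0" using mult_pos_pos[OF \<gamma> hn] by linarith
  then have wpos: "0 < ?w A0" by (simp add: zero_less_mult_iff)
  have "\<gamma> * (real (card ?T) * ?w A0) \<le> \<gamma> * real h ^ card X" using all \<gamma> by (intro mult_left_mono) auto
  with goodw have "(\<gamma> * real (card ?T)) * ?w A0 \<le> real (card ?TF) * ?w A0" by (simp add: mult_ac)
  then have "\<gamma> * real (card ?T) \<le> real (card ?TF)" using wpos by simp
  moreover have "0 < card ?T" using A0 finT card_gt_0_iff by blast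
  moreover have "?T \<inter> {A. \<forall>i\<in>{1..h}. A i \<in> \<F> i} = ?TF" by auto
  ultimately show ?thesis
    using A0 finT by (subst measure_pmf_of_set) (auto simp: field_simps)
qed

text \<open>Union bound over the colours: the tails add up to at most \<open>1 / 2\<close>, so at
  least half of all colourings have every factor at least \<theta>.\<close>

lemma sum_prod_containment_ge:
  fixes \<theta> :: real
  assumes fin: "finite X" and h: "1 \<le> h" and F: "\<And>i. i \<in> {1..h} \<Longrightarrow> \<F> i \<subseteq> nsets X (k i)"
    and \<theta>: "0 < \<theta>"
    and tail: "\<And>i. i \<in> {1..h} \<Longrightarrow> bexp (1 / real h) X (\<lambda>C. of_bool (containment (\<F> i) (k i) C < \<theta>)) \<le> 1 / (2 * real h)"
  shows "\<theta> ^ h / 2 * real h ^ card X \<le> (\<Sum>c\<in>X \<rightarrow>\<^sub>E {1..h}. \<Prod>i=1..h. containment (\<F> i) (k i) (colour_class X c i))"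
proof -
  let ?g = "\<lambda>c i. containment (\<F> i) (k i) (colour_class X c i)"
  let ?Col = "X \<rightarrow>\<^sub>E {1..h}"
  have g0: "0 \<le> ?g c i" if "i \<in> {1..h}" for c i
    using fin by (intro containment_bounds(1)[OF F[OF that]]) (simp add: colour_class_def)
  \<comment> \<open>Linearises the product: the left side is \<open>\<theta> ^ h\<close> when no
    colour is bad and at most 0 otherwise.\<close>
  have pointwise: "\<theta> ^ h * (1 - (\<Sum>i=1..h. of_bool (?g c i < \<theta>))) \<le> (\<Prod>i=1..h. ?g c i)" for c
  proof (cases "\<exists>i\<in>{1..h}. ?g c i < \<theta>")
    case True
    then obtain i where i: "i \<in> {1..h}" "?g c i < \<theta>" by blast
    then have "1 \<le> (\<Sum>i=1..h. of_bool (?g c i < \<theta>) :: real)"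
      using member_le_sum[of i "{1..h}" "\<lambda>i. of_bool (?g c i < \<theta>) :: real"] by simp
    then have "\<theta> ^ h * (1 - (\<Sum>i=1..h. of_bool (?g c i < \<theta>))) \<le> 0"
      using \<theta> by (intro mult_nonneg_nonpos) auto
    also have "\<dots> \<le> (\<Prod>i=1..h. ?g c i)" using g0 by (intro prod_nonneg) auto
    finally show ?thesis .
  next
    case False
    then have "(\<Prod>i=1..h. \<theta>) \<le> (\<Prod>i=1..h. ?g c i)" using \<theta> by (intro prod_mono) force
    then show ?thesis using False by simp
  qed
  have "(\<Sum>c\<in>?Col. \<Sum>i=1..h. of_bool (?g c i < \<theta>)) = (\<Sum>i=1..h. \<Sum>c\<in>?Col. (of_bool (?g c i < \<theta>) :: real))"
    by (rule sum.swap)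
  also have "\<dots> = (\<Sum>i=1..h. real h ^ card X * bexp (1 / real h) X (\<lambda>C. of_bool (containment (\<F> i) (k i) C < \<theta>)))"
    by (intro sum.cong refl sum_colour_class[OF fin])
  also have "\<dots> \<le> (\<Sum>i=1..h. real h ^ card X * (1 / (2 * real h)))"
    using tail by (intro sum_mono mult_left_mono) auto
  also have "\<dots> = real h ^ card X / 2" using h by simp
  finally have bad: "(\<Sum>c\<in>?Col. \<Sum>i=1..h. (of_bool (?g c i < \<theta>) :: real)) \<le> real h ^ card X / 2" .
  have "\<theta> ^ h / 2 * real h ^ card X = \<theta> ^ h * (real h ^ card X - real h ^ card X / 2)" by simp
  also have "\<dots> \<le> \<theta> ^ h * (real h ^ card X - (\<Sum>c\<in>?Col. \<Sum>i=1..h. of_bool (?g c i < \<theta>)))"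
    using bad \<theta> by (intro mult_left_mono) auto
  also have "\<dots> = \<theta> ^ h * ((\<Sum>c\<in>?Col. 1) - (\<Sum>c\<in>?Col. \<Sum>i=1..h. of_bool (?g c i < \<theta>)))"
    using fin by (simp add: card_PiE)
  also have "\<dots> = (\<Sum>c\<in>?Col. \<theta> ^ h * (1 - (\<Sum>i=1..h. of_bool (?g c i < \<theta>))))"
    by (subst sum_subtractf[symmetric]) (rule sum_distrib_left)
  also have "\<dots> \<le> (\<Sum>c\<in>?Col. \<Prod>i=1..h. ?g c i)" by (intro sum_mono pointwise)
  finally show ?thesis .
qed

text \<open>With \<open>J = X\<close> and \<open>B = A\<close> the restriction is decided by the
  single question whether \<open>A\<close> belongs to \<open>\<F>\<close>. For a missing
  \<open>A\<close> its measure is 0, too far from that of \<open>\<F>\<close>. This settles bounded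
  \<open>n\<close>.\<close>

lemma family_regular_full:
  assumes "finite X" and F: "\<F> \<subseteq> nsets X k" and reg: "family_regular X k r \<delta> \<F>"
    and r: "card X \<le> r" and \<delta>: "\<delta> \<le> unif_measure X k \<F>"
  shows "\<F> = nsets X k"
proof (rule ccontr)
  assume "\<F> \<noteq> nsets X k"
  then obtain A where A: "A \<in> nsets X k" "A \<notin> \<F>" using F by blast
  then have A': "A \<subseteq> X" "card A = k" by (auto simp: nsets_def)
  have "restriction X \<F> X A = {}" using A by (auto simp: restriction_def)
  moreover have "\<bar>unif_measure (X - X) (k - card A) (restriction X \<F> X A) - unif_measure X k \<F>\<bar> < \<delta>"
    using reg[unfolded family_regular_def, rule_format, of X A] r A' by simp
  ultimately show False using \<delta> by (simp add: unif_measure_def)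
qed

theorem theorem6p1:
  fixes h :: nat and \<epsilon> :: real
  assumes "h \<ge> 1" and "\<epsilon> > 0"
  shows "\<exists>\<delta>>0. \<forall>(n::nat) (k :: nat \<Rightarrow> nat) (\<F> :: nat \<Rightarrow> nat set set).
    (\<forall>i\<in>{1..h}. real (k i) \<le> (1 / real h - \<epsilon>) * real n) \<longrightarrow>
    (\<forall>i\<in>{1..h}. \<F> i \<subseteq> nsets {1..n} (k i)) \<longrightarrow>
    (\<forall>i\<in>{1..h}. unif_measure {1..n} (k i) (\<F> i) \<ge> \<epsilon>) \<longrightarrow>
    (\<forall>i\<in>{1..h}. real (k i) \<ge> \<delta> * real n \<longrightarrow>
      family_regular {1..n} (k i) (nat \<lceil>1 / \<delta>\<rceil>) \<delta> (\<F> i)) \<longrightarrow>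
    measure_pmf.prob (pmf_of_set (disjoint_tuples {1..n} h k))
      {A. \<forall>i\<in>{1..h}. A i \<in> \<F> i} > \<delta>"
proof -
  \<comment> \<open>\<open>containment_lower_tail\<close> requires its \<epsilon> to be at most
    \<open>Q = 1 / h\<close>.\<close>
  define \<epsilon>' where "\<epsilon>' = min \<epsilon> (1 / real h)"
  have h: "0 < real h" using assms(1) by simp
  have \<epsilon>': "0 < \<epsilon>'" "\<epsilon>' \<le> 1 / real h" "\<epsilon>' \<le> \<epsilon>" using assms h by (auto simp: \<epsilon>'_def)
  have h1: "1 / real h \<le> 1" and \<eta>: "0 < 1 / (2 * real h)" using assms(1) by auto
  from containment_lower_tail[OF \<epsilon>'(1,2) h1 \<eta>, where 'a = nat] obtain \<theta> \<delta>\<^sub>0 :: real and n\<^sub>0 :: nat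
    where \<theta>: "0 < \<theta>" "\<theta> < 1" and \<delta>0: "0 < \<delta>\<^sub>0"
      and all: "\<forall>(X :: nat set) k \<F> (\<delta> :: real). finite X \<longrightarrow> n\<^sub>0 \<le> card X \<longrightarrow>
        \<F> \<subseteq> nsets X k \<longrightarrow> real k \<le> (1 / real h - \<epsilon>') * card X \<longrightarrow> \<epsilon>' \<le> unif_measure X k \<F> \<longrightarrow>
        0 < \<delta> \<longrightarrow> \<delta> \<le> \<delta>\<^sub>0 \<longrightarrow>
        (\<delta> * card X \<le> real k \<longrightarrow> family_regular X k (nat \<lceil>1 / \<delta>\<rceil>) \<delta> \<F>) \<longrightarrow>
        bexp (1 / real h) X (\<lambda>C. of_bool (containment \<F> k C < \<theta>)) < 1 / (2 * real h)"
    by (elim exE conjE) (rule that)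
  \<comment> \<open>\<epsilon> serves \<open>family_regular_full\<close>, and
    \<open>\<theta> ^ h / 4\<close> makes the final inequality strict. The term with
    \<open>n\<^sub>0\<close> matters for \<open>n < n\<^sub>0\<close>: it lets \<open>J\<close> be
    all of \<open>{1..n}\<close>, makes \<open>\<delta> * n\<close> at most 1, and keeps \<delta>
    below the probability 1.\<close>
  define \<delta> where "\<delta> = min (min \<delta>\<^sub>0 \<epsilon>) (min (1 / (real n\<^sub>0 + 2)) (\<theta> ^ h / 4))"
  have \<delta>: "0 < \<delta>" "\<delta> \<le> \<delta>\<^sub>0" "\<delta> \<le> \<epsilon>" "\<delta> \<le> 1 / (real n\<^sub>0 + 2)" "\<delta> \<le> \<theta> ^ h / 4"
    using \<delta>0 assms(2) \<theta> by (auto simp: \<delta>_def)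
  have "\<delta> * (real n\<^sub>0 + 2) \<le> 1" using \<delta>(4) by (simp add: field_simps)
  then have n0\<delta>: "real n\<^sub>0 + 2 \<le> 1 / \<delta>" using \<delta>(1) by (simp add: field_simps)
  have "1 / (real n\<^sub>0 + 2) < 1" by simp
  then have \<delta>1: "\<delta> < 1" using \<delta>(4) by linarith
  have "measure_pmf.prob (pmf_of_set (disjoint_tuples {1..n} h k)) {A. \<forall>i\<in>{1..h}. A i \<in> \<F> i} > \<delta>"
    if k: "\<forall>i\<in>{1..h}. real (k i) \<le> (1 / real h - \<epsilon>) * real n"
      and F: "\<forall>i\<in>{1..h}. \<F> i \<subseteq> nsets {1..n} (k i)"
      and \<mu>: "\<forall>i\<in>{1..h}. unif_measure {1..n} (k i) (\<F> i) \<ge> \<epsilon>"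
      and reg: "\<forall>i\<in>{1..h}. real (k i) \<ge> \<delta> * real n \<longrightarrow>
        family_regular {1..n} (k i) (nat \<lceil>1 / \<delta>\<rceil>) \<delta> (\<F> i)"
    for n and k :: "nat \<Rightarrow> nat" and \<F> :: "nat \<Rightarrow> nat set set"
  proof (cases "n\<^sub>0 \<le> n")
    case True
    have tail: "bexp (1 / real h) {1..n} (\<lambda>C. of_bool (containment (\<F> i) (k i) C < \<theta>)) \<le> 1 / (2 * real h)"
      if i: "i \<in> {1..h}" for i
    proof (rule less_imp_le, rule all[rule_format])
      have "(1 / real h - \<epsilon>) * real n \<le> (1 / real h - \<epsilon>') * real n"
        using \<epsilon>'(3) by (intro mult_right_mono) auto
      then show "real (k i) \<le> (1 / real h - \<epsilon>') * real (card {1..n})" using bspec[OF k i] by simp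
      show "\<epsilon>' \<le> unif_measure {1..n} (k i) (\<F> i)" using bspec[OF \<mu> i] \<epsilon>'(3) by linarith
    qed (use True F \<delta> reg i in auto)
    have "\<theta> ^ h / 2 * real h ^ card {1..n}
      \<le> (\<Sum>c\<in>{1..n} \<rightarrow>\<^sub>E {1..h}. \<Prod>i=1..h. containment (\<F> i) (k i) (colour_class {1..n} c i))"
      using F assms(1) \<theta> tail by (intro sum_prod_containment_ge) auto
    then have "\<theta> ^ h / 2 \<le> measure_pmf.prob (pmf_of_set (disjoint_tuples {1..n} h k)) {A. \<forall>i\<in>{1..h}. A i \<in> \<F> i}"
      using F assms(1) \<theta> by (intro prob_disjoint_tuples_ge) auto
    moreover have "\<delta> < \<theta> ^ h / 2"
    proof -
      have "0 < \<theta> ^ h" using \<theta> by simp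
      then show ?thesis using \<delta>(5) by linarith
    qed
    ultimately show ?thesis by linarith
  next
    case False
    then have n: "real n \<le> real n\<^sub>0" by simp
    have full: "\<F> i = nsets {1..n} (k i)" if i: "i \<in> {1..h}" for i
    proof (cases "\<delta> * real n \<le> real (k i)")
      case True
      have "card {1..n} \<le> nat \<lceil>1 / \<delta>\<rceil>" using n n0\<delta> by (simp, linarith)
      moreover have "\<delta> \<le> unif_measure {1..n} (k i) (\<F> i)" using bspec[OF \<mu> i] \<delta>(3) by linarith
      ultimately show ?thesis using F reg i True by (intro family_regular_full) auto
    next
      case False
      \<comment> \<open>Here \<open>k i < \<delta> * n \<le> 1\<close> leaves only the empty set,
        and positive measure puts it into the family.\<close>
      have "\<delta> * real n \<le> \<delta> * (real n\<^sub>0 + 2)" using n \<delta>(1) by (intro mult_left_mono) auto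
      then have "k i = 0" using False \<open>\<delta> * (real n\<^sub>0 + 2) \<le> 1\<close> by linarith
      then have nsets: "nsets {1..n} (k i) = {{}}" by (auto simp: nsets_def)
      have "0 < unif_measure {1..n} (k i) (\<F> i)" using bspec[OF \<mu> i] assms(2) by linarith
      then have "\<F> i \<noteq> {}" by (auto simp: unif_measure_def)
      moreover have "\<F> i \<subseteq> {{}}" using bspec[OF F i] unfolding nsets .
      ultimately show ?thesis unfolding nsets by blast
    qed
    \<comment> \<open>The sizes fit into \<open>{1..n}\<close>, so disjoint tuples exist and the
      probability 1 below refers to a genuine uniform distribution.\<close>
    have "(\<Sum>i=1..h. real (k i)) \<le> (\<Sum>i=1..h. (1 / real h - \<epsilon>) * real n)"
      using k by (intro sum_mono) auto
    also have "\<dots> = (1 - real h * \<epsilon>) * real n" using h by (simp add: field_simps)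
    also have "\<dots> \<le> 1 * real n" using h assms(2) by (intro mult_right_mono) auto
    finally have "(\<Sum>i=1..h. k i) \<le> card {1..n}" by (simp flip: of_nat_sum)
    from exists_disjoint_subsets[OF _ _ this]
    obtain A where A: "\<forall>i\<in>{1..h}. A i \<in> nsets {1..n} (k i)" "disjoint_family_on A {1..h}" by auto
    then have "restrict A {1..h} \<in> disjoint_tuples {1..n} h k"
      by (auto simp: disjoint_tuples_def disjoint_family_on_def)
    then have ne: "disjoint_tuples {1..n} h k \<noteq> {}" by blast
    have fin: "finite (disjoint_tuples {1..n} h k)" by (simp add: finite_disjoint_tuples)
    have "disjoint_tuples {1..n} h k \<inter> {A. \<forall>i\<in>{1..h}. A i \<in> \<F> i} = disjoint_tuples {1..n} h k"
      using full by (auto simp: disjoint_tuples_def PiE_iff)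
    then have "measure_pmf.prob (pmf_of_set (disjoint_tuples {1..n} h k)) {A. \<forall>i\<in>{1..h}. A i \<in> \<F> i} = 1"
      using ne fin by (subst measure_pmf_of_set) (auto simp: card_gt_0_iff)
    then show ?thesis using \<delta>1 by simp
  qed
  then show ?thesis using \<delta>(1) by (intro exI[of _ \<delta>]) simp
qed

end
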